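(* Let $p>1$ and let $\Phi:\mathbb{B}\to\mathbb{B}$ be a slice regular map such that $\Phi(\mathbb{B}_i)\subset\mathbb{B}_i$ for some $i\in\mathbb{S}$; fix such an $i$. For $a\in\mathbb{B}$ let $\sigma_a(q)=(1-q\bar a)^{-\star}\star(a-q)$, $q\in\mathbb{B}$. Then $C_\Phi:\mathfrak{B}_p\to\mathcal{B}$ is compact if and only if $$\|C_\Phi\sigma_a\|_{\mathcal{B}}\to0\quad\text{as }|a|\to1,$$ where $\|f\|_{\mathcal{B}}=\sup_{I\in\mathbb{S}}\sup_{z\in\mathbb{B}_I}(1-|z|^2)\left|\frac{\partial f}{\partial x_0}(z)\right|$.
   Context: $\mathbb{H}$ is the skew field of quaternions with Euclidean norm $|\cdot|$, $\mathbb{S}=\{q\in\mathbb{H}: q^2=-1\}$ is the sphere of imaginary units, $\mathbb{B}=\{q\in\mathbb{H}:|q|<1\}$. For $i\in\mathbb{S}$, $\mathbb{C}(i)=\mathbb{R}+\mathbb{R}i$ and $\mathbb{B}_i=\mathbb{B}\cap\mathbb{C}(i)$, identified with the unit disk. A real differentiable function $f:\mathbb{B}\to\mathbb{H}$ is (left) slice regular (also called slice holomorphic or slice hyperholomorphic) if for every $i\in\mathbb{S}$ its restriction $f_i$ to $\mathbb{B}_i$ satisfies $\frac{\partial}{\partial x}f_i(x+iy)+i\frac{\partial}{\partial y}f_i(x+iy)=0$. $SR(\mathbb{B})$ denotes the set of such functions. $\frac{\partial f}{\partial x_0}$ is the derivative in the real direction. Besov space: for $p>1$, $\mathfrak{B}_p$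 is the space of $f\in SR(\mathbb{B})$ with $\sup_{i\in\mathbb{S}}\int_{\mathbb{B}_i}\left|(1-|q|^2)\frac{\partial f}{\partial x_0}(q)\right|^p d\lambda_i(q)<\infty$, where $d\lambda_i(q)=\frac{dA_i(q)}{(1-|q|^2)^2}$ and $dA_i$ is normalized area measure on $\mathbb{B}_i$. It is a Banach space under $$\|f\|_{\mathfrak{B}_p}=|f(0)|+\left(\sup_{i\in\mathbb{S}}\int_{\mathbb{B}_i}\left|(1-|q|^2)\frac{\partial f}{\partial x_0}(q)\right|^p d\lambda_i(q)\right)^{1/p}.$$ Bloch space: $\mathcal{B}$ is the slice regular Bloch space of all $f\in SR(\mathbb{B})$ for which the seminorm $\|f\|_{\mathcal{B}}$ is finite; as a Banach space it carries the norm $|f(0)|+\|f\|_{\mathcal{B}}$. Composition operator: if $\Phi:\mathbb{B}\to\mathbb{B}$ is slice regular with $\Phi(\mathbb{B}_i)\subset\mathbb{B}_i$, then $C_\Phi f=f\circ_i\Phi$ is the unique slice regular function on $\mathbb{B}$ whose restriction to $\mathbb{B}_i$ is $f|_{\mathbb{B}_i}\circ\Phi|_{\mathbb{B}_i}$. Explicitly, writing $g=f|_{\mathbb{B}_i}\circ\Phi|_{\mathbb{B}_i}$, for $q=x+I_qy$ with $I_q\in\mathbb{S}$, $(C_\Phi f)(q)=\frac12\left[(1-I_qi)g(x+iy)+(1+I_qi)g(x-iy)\right]$. Regular product: for $f(q)=\sum q^na_n$, $g(q)=\sum q^nb_n$, $f\star g(q)=\sum_n q^n\sum_{k=0}^n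 a_kb_{n-k}$, and $f^{-\star}$ is the inverse with respect to $\star$. *)

theory Defs
  imports "HOL-Analysis.Analysis"
begin

section \<open>Quaternions\<close>

codatatype quat = Quat (Re0: real) (Im1: real) (Im2: real) (Im3: real)

lemma quat_eq_iff: "x = y \<longleftrightarrow> Re0 x = Re0 y \<and> Im1 x = Im1 y \<and> Im2 x = Im2 y \<and> Im3 x = Im3 y"
  by (auto intro: quat.expand)

instantiation quat :: ab_group_add
begin

primcorec zero_quat where
  "Re0 0 = 0" | "Im1 0 = 0" | "Im2 0 = 0" | "Im3 0 = 0"

primcorec plus_quat where
  "Re0 (x + y) = Re0 x + Re0 y"
| "Im1 (x + y) = Im1 x + Im1 y"
| "Im2 (x + y) = Im2 x + Im2 y"
| "Im3 (x + y) = Im3 x + Im3 y"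

primcorec uminus_quat where
  "Re0 (- x) = - Re0 x"
| "Im1 (- x) = - Im1 x"
| "Im2 (- x) = - Im2 x"
| "Im3 (- x) = - Im3 x"

primcorec minus_quat where
  "Re0 (x - y) = Re0 x - Re0 y"
| "Im1 (x - y) = Im1 x - Im1 y"
| "Im2 (x - y) = Im2 x - Im2 y"
| "Im3 (x - y) = Im3 x - Im3 y"

instance
  by standard (simp_all add: quat_eq_iff)

end

instantiation quat :: ring_1
begin

primcorec one_quat where
  "Re0 1 = 1" | "Im1 1 = 0" | "Im2 1 = 0" | "Im3 1 = 0"

primcorec times_quat where
  "Re0 (x * y) = Re0 x * Re0 y - Im1 x * Im1 y - Im2 x * Im2 y - Im3 x * Im3 y"
| "Im1 (x * y) = Re0 x * Im1 y + Im1 x * Re0 y + Im2 x * Im3 y - Im3 x * Im2 y"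
| "Im2 (x * y) = Re0 x * Im2 y - Im1 x * Im3 y + Im2 x * Re0 y + Im3 x * Im1 y"
| "Im3 (x * y) = Re0 x * Im3 y + Im1 x * Im2 y - Im2 x * Im1 y + Im3 x * Re0 y"

instance
  by standard (simp_all add: quat_eq_iff algebra_simps)

end

instantiation quat :: real_algebra_1
begin

primcorec scaleR_quat where
  "Re0 (scaleR r x) = r * Re0 x"
| "Im1 (scaleR r x) = r * Im1 x"
| "Im2 (scaleR r x) = r * Im2 x"
| "Im3 (scaleR r x) = r * Im3 x"

instance
  by standard (simp_all add: quat_eq_iff algebra_simps)

end

instantiation quat :: real_inner
begin

definition inner_quat :: "quat \<Rightarrow> quat \<Rightarrow> real" where
  "inner_quat x y = Re0 x * Re0 y + Im1 x * Im1 y + Im2 x * Im2 y + Im3 x * Im3 y"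

definition norm_quat :: "quat \<Rightarrow> real" where
  "norm_quat x = sqrt ((Re0 x)\<^sup>2 + (Im1 x)\<^sup>2 + (Im2 x)\<^sup>2 + (Im3 x)\<^sup>2)"

definition sgn_quat :: "quat \<Rightarrow> quat" where
  "sgn_quat x = x /\<^sub>R norm x"

definition dist_quat :: "quat \<Rightarrow> quat \<Rightarrow> real" where
  "dist_quat x y = norm (x - y)"

definition uniformity_quat_def [code del]:
  "(uniformity :: (quat \<times> quat) filter) = (INF e\<in>{0<..}. principal {(x, y). dist x y < e})"

definition open_quat_def [code del]:
  "open (U :: quat set) \<longleftrightarrow> (\<forall>x\<in>U. eventually (\<lambda>(x', y). x' = x \<longrightarrow> y \<in> U) uniformity)"

instance
proof
  fix x y z :: quat and r :: real and U :: "quat set"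
  show "dist x y = norm (x - y)" by (rule dist_quat_def)
  show "sgn x = x /\<^sub>R norm x" by (rule sgn_quat_def)
  show "uniformity = (INF e\<in>{0<..}. principal {(x::quat, y). dist x y < e})"
    by (rule uniformity_quat_def)
  show "open U \<longleftrightarrow> (\<forall>x\<in>U. eventually (\<lambda>(x', y). x' = x \<longrightarrow> y \<in> U) uniformity)"
    by (rule open_quat_def)
  show "inner x y = inner y x" by (simp add: inner_quat_def mult.commute)
  show "inner (x + y) z = inner x z + inner y z" by (simp add: inner_quat_def algebra_simps)
  show "inner (scaleR r x) y = r * inner x y" by (simp add: inner_quat_def algebra_simps)
  show "0 \<le> inner x x" by (simp add: inner_quat_def)
  show "inner x x = 0 \<longleftrightarrow> x = 0"
    by (auto simp: inner_quat_def quat_eq_iff add_nonneg_eq_0_iff)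
  show "norm x = sqrt (inner x x)"
    by (simp add: norm_quat_def inner_quat_def power2_eq_square)
qed

end

definition qcnj :: "quat \<Rightarrow> quat" where
  "qcnj q = Quat (Re0 q) (- Im1 q) (- Im2 q) (- Im3 q)"

lemma qcnj_sel [simp]:
  "Re0 (qcnj q) = Re0 q" "Im1 (qcnj q) = - Im1 q" "Im2 (qcnj q) = - Im2 q" "Im3 (qcnj q) = - Im3 q"
  by (simp_all add: qcnj_def)

lemma mult_qcnj: "q * qcnj q = (norm q)\<^sup>2 *\<^sub>R 1" "qcnj q * q = (norm q)\<^sup>2 *\<^sub>R 1"
  by (simp_all add: quat_eq_iff norm_quat_def power2_eq_square)

instantiation quat :: real_normed_div_algebra
begin

definition inverse_quat :: "quat \<Rightarrow> quat" where
  "inverse_quat q = qcnj q /\<^sub>R (norm q)\<^sup>2"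

definition divide_quat :: "quat \<Rightarrow> quat \<Rightarrow> quat" where
  "divide_quat x y = x * inverse y"

instance
proof
  fix x y :: quat
  show "x \<noteq> 0 \<Longrightarrow> inverse x * x = 1" "x \<noteq> 0 \<Longrightarrow> x * inverse x = 1"
    by (simp_all add: inverse_quat_def mult_qcnj)
  show "inverse (0::quat) = 0" by (simp add: inverse_quat_def quat_eq_iff)
  show "x div y = x * inverse y" by (rule divide_quat_def)
  show "norm (x * y) = norm x * norm y"
  proof -
    have "qcnj (x * y) = qcnj y * qcnj x"
      by (simp add: quat_eq_iff)
    then have "(norm (x * y))\<^sup>2 *\<^sub>R 1 = x * (y * qcnj y) * qcnj x"
      by (simp only: mult_qcnj(1) [symmetric] mult.assoc)
    also have "\<dots> = (norm y)\<^sup>2 *\<^sub>R (x * qcnj x)"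
      by (simp add: mult_qcnj(1))
    also have "\<dots> = (norm x * norm y)\<^sup>2 *\<^sub>R 1"
      by (simp add: mult_qcnj(1) power_mult_distrib)
    finally have "(norm (x * y))\<^sup>2 = (norm x * norm y)\<^sup>2"
      by (simp add: quat_eq_iff)
    then show ?thesis
      by (simp add: power2_eq_iff_nonneg)
  qed
qed

end

instantiation quat :: euclidean_space
begin

definition Basis_quat :: "quat set" where
  "Basis_quat = {Quat 1 0 0 0, Quat 0 1 0 0, Quat 0 0 1 0, Quat 0 0 0 1}"

instance
proof
  show "(Basis :: quat set) \<noteq> {}" "finite (Basis :: quat set)"
    by (simp_all add: Basis_quat_def)
  show "inner u v = (if u = v then 1 else 0)" if "u \<in> Basis" "v \<in> Basis" for u v :: quat
    using that unfolding Basis_quat_def insert_iff empty_iff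
    by (elim disjE; simp add: inner_quat_def)
  show "(\<forall>u\<in>Basis. inner x u = 0) \<longleftrightarrow> x = 0" for x :: quat
    by (simp add: Basis_quat_def inner_quat_def quat_eq_iff [of x 0])
qed

end

lemma Re0_of_real [simp]: "Re0 (of_real r) = r" "Im1 (of_real r) = 0" "Im2 (of_real r) = 0" "Im3 (of_real r) = 0"
  by (simp_all add: of_real_def)


section \<open>Slice regular functions on the unit ball\<close>

abbreviation qball :: "quat set" where
  "qball \<equiv> ball 0 1"

definition imag_units :: "quat set" where
  "imag_units = {q. q\<^sup>2 = - 1}"

text \<open>The identification of the complex plane with the slice \<open>\<real> + \<real>i\<close>.\<close>

definition slice :: "quat \<Rightarrow> complex \<Rightarrow> quat" where
  "slice i z = of_real (Re z) + i * of_real (Im z)"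

definition slice_ball :: "quat \<Rightarrow> quat set" where
  "slice_ball i = qball \<inter> range (slice i)"

definition slice_regular :: "(quat \<Rightarrow> quat) \<Rightarrow> bool" where
  "slice_regular f \<longleftrightarrow> f differentiable_on qball \<and>
     (\<forall>i\<in>imag_units. \<forall>x y. slice i (Complex x y) \<in> qball \<longrightarrow>
        vector_derivative (\<lambda>t. f (slice i (Complex t y))) (at x)
        + i * vector_derivative (\<lambda>t. f (slice i (Complex x t))) (at y) = 0)"

text \<open>Functions on the ball are represented by total functions that are \<open>undefined\<close> off
  the ball, so that equality of elements of \<open>SR\<close> is equality on the ball.\<close>

definition SR :: "(quat \<Rightarrow> quat) set" where
  "SR = {f \<in> extensional qball. slice_regular f}"

definition deriv_x0 :: "(quat \<Rightarrow> quat) \<Rightarrow> quat \<Rightarrow> quat" where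
  "deriv_x0 f q = vector_derivative (\<lambda>t. f (q + of_real t)) (at 0)"


section \<open>Besov and Bloch spaces\<close>

text \<open>The area measure of the unit disc, normalised to total mass \<open>1\<close>, with the weight
  \<open>(1 - \<bar>z\<bar>\<^sup>2)\<^sup>-\<^sup>2\<close>; it represents \<open>d\<lambda>\<^sub>i\<close> on every slice through \<open>slice i\<close>.\<close>

definition hyp_area :: "complex measure" where
  "hyp_area = density (uniform_measure lborel (ball 0 1)) (\<lambda>z. ennreal (1 / (1 - (norm z)\<^sup>2)\<^sup>2))"

text \<open>The suprema are taken in \<open>ennreal\<close>, where an unbounded family has supremum \<open>\<infinity>\<close>;
  \<open>enn2real\<close> (which maps \<open>\<infinity>\<close> to \<open>0\<close>) is only relevant on functions with finite supremum.\<close>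

definition besov_energy :: "real \<Rightarrow> (quat \<Rightarrow> quat) \<Rightarrow> ennreal" where
  "besov_energy p f = (SUP i\<in>imag_units. \<integral>\<^sup>+ z \<in> ball 0 1.
     ennreal (((1 - (norm (slice i z))\<^sup>2) * norm (deriv_x0 f (slice i z))) powr p) \<partial>hyp_area)"

definition Besov :: "real \<Rightarrow> (quat \<Rightarrow> quat) set" where
  "Besov p = {f \<in> SR. besov_energy p f < \<infinity>}"

definition besov_norm :: "real \<Rightarrow> (quat \<Rightarrow> quat) \<Rightarrow> real" where
  "besov_norm p f = norm (f 0) + enn2real (besov_energy p f) powr (1 / p)"

definition bloch_seminorm :: "(quat \<Rightarrow> quat) \<Rightarrow> ennreal" where
  "bloch_seminorm f = (SUP i\<in>imag_units. SUP z\<in>slice_ball i.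
     ennreal ((1 - (norm z)\<^sup>2) * norm (deriv_x0 f z)))"

definition Bloch :: "(quat \<Rightarrow> quat) set" where
  "Bloch = {f \<in> SR. bloch_seminorm f < \<infinity>}"

definition bloch_norm :: "(quat \<Rightarrow> quat) \<Rightarrow> real" where
  "bloch_norm f = norm (f 0) + enn2real (bloch_seminorm f)"

definition bloch_dist :: "(quat \<Rightarrow> quat) \<Rightarrow> (quat \<Rightarrow> quat) \<Rightarrow> real" where
  "bloch_dist f g = bloch_norm (\<lambda>q. f q - g q)"

text \<open>\<open>T\<close> maps the Besov space into the Bloch space and norm-bounded sets to relatively
  compact sets.\<close>

definition compact_Besov_Bloch :: "real \<Rightarrow> ((quat \<Rightarrow> quat) \<Rightarrow> (quat \<Rightarrow> quat)) \<Rightarrow> bool" where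
  "compact_Besov_Bloch p T \<longleftrightarrow> T ` Besov p \<subseteq> Bloch \<and>
     (\<forall>F\<subseteq>Besov p. bdd_above (besov_norm p ` F) \<longrightarrow>
        compactin (Metric_space.mtopology Bloch bloch_dist)
          (Metric_space.mtopology Bloch bloch_dist closure_of (T ` F)))"


section \<open>Composition operators\<close>

text \<open>A quaternion \<open>q\<close> is \<open>x + I y\<close> with \<open>x = Re0 q\<close>, \<open>y = norm (qIm q) \<ge> 0\<close> and
  \<open>I = im_unit i q\<close>; for real \<open>q\<close> the unit is arbitrary and \<open>i\<close> is used.\<close>

definition qIm :: "quat \<Rightarrow> quat" where
  "qIm q = q - of_real (Re0 q)"

definition im_unit :: "quat \<Rightarrow> quat \<Rightarrow> quat" where
  "im_unit i q = (if qIm q = 0 then i else sgn (qIm q))"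

definition slice_extend :: "quat \<Rightarrow> (quat \<Rightarrow> quat) \<Rightarrow> quat \<Rightarrow> quat" where
  "slice_extend i g = (\<lambda>q\<in>qball. (1/2) *\<^sub>R
     (let x = Re0 q; y = norm (qIm q); I = im_unit i q in
       (1 - I * i) * g (slice i (Complex x y)) + (1 + I * i) * g (slice i (Complex x (- y)))))"

definition comp_op :: "quat \<Rightarrow> (quat \<Rightarrow> quat) \<Rightarrow> (quat \<Rightarrow> quat) \<Rightarrow> (quat \<Rightarrow> quat)" where
  "comp_op i \<Phi> f = slice_extend i (f \<circ> \<Phi>)"


section \<open>Regular product\<close>

text \<open>Power series with coefficients on the right. For formal power series over the
  quaternions, the library product is the convolution \<open>\<Sum>k\<le>n. a k * b (n - k)\<close> and
  \<open>inverse\<close> is the two-sided inverse for it when the constant coefficient is nonzero.\<close>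

definition rps_eval :: "quat fps \<Rightarrow> quat \<Rightarrow> quat" where
  "rps_eval F q = (\<Sum>n. q ^ n * fps_nth F n)"

definition rps_of :: "(quat \<Rightarrow> quat) \<Rightarrow> quat fps" where
  "rps_of f = (THE F. \<forall>q\<in>qball. (\<lambda>n. q ^ n * fps_nth F n) sums f q)"

definition star_mult :: "(quat \<Rightarrow> quat) \<Rightarrow> (quat \<Rightarrow> quat) \<Rightarrow> (quat \<Rightarrow> quat)" (infixl \<open>\<star>\<close> 70) where
  "f \<star> g = (\<lambda>q\<in>qball. rps_eval (rps_of f * rps_of g) q)"

definition star_inverse :: "(quat \<Rightarrow> quat) \<Rightarrow> (quat \<Rightarrow> quat)" where
  "star_inverse f = (\<lambda>q\<in>qball. rps_eval (inverse (rps_of f)) q)"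

definition qmoebius :: "quat \<Rightarrow> quat \<Rightarrow> quat" where
  "qmoebius a = star_inverse (\<lambda>q. 1 - q * qcnj a) \<star> (\<lambda>q. a - q)"


section \<open>Consistency of the definitions\<close>

text \<open>\<open>slice_extend\<close> does not depend on the representation \<open>q = x + I y\<close>, power series expansions
  on the ball are unique, and \<open>bloch_dist\<close> is a metric on \<open>Bloch\<close>.\<close>

lemma imag_units_iff: "i \<in> imag_units \<longleftrightarrow> Re0 i = 0 \<and> norm i = 1"
proof
  assume "i \<in> imag_units"
  then have i: "i * i = - 1" by (simp add: imag_units_def power2_eq_square)
  then have n: "norm i * norm i = 1" by (metis norm_minus_cancel norm_mult norm_one)
  then have n1: "norm i = 1"
    by (metis norm_ge_zero power2_eq_1_iff power2_eq_square le_minus_one_simps(1) order_trans zero_neq_one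
       le_minus_one_simps(3))
  have "Re0 (i * i) = -1" using i by simp
  moreover have "(norm i)\<^sup>2 = 1" using n1 by simp
  then have "Re0 i * Re0 i + Im1 i * Im1 i + Im2 i * Im2 i + Im3 i * Im3 i = 1"
    by (simp add: norm_quat_def power2_eq_square)
  ultimately have "Re0 i * Re0 i = 0" unfolding times_quat.sel uminus_quat.sel one_quat.sel by linarith
  then show "Re0 i = 0 \<and> norm i = 1" using n1 by simp
next
  assume h: "Re0 i = 0 \<and> norm i = 1"
  then have "(norm i)\<^sup>2 = 1" by simp
  then have "i * i = -1" using h by (simp add: quat_eq_iff norm_quat_def power2_eq_square)
  then show "i \<in> imag_units" by (simp add: imag_units_def power2_eq_square)
qed

lemma slice_extend_slice:
  assumes "i \<in> imag_units" "I \<in> imag_units" "slice I (Complex x y) \<in> qball"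
  shows "slice_extend i g (slice I (Complex x y)) = (1/2) *\<^sub>R
    ((1 - I * i) * g (slice i (Complex x y)) + (1 + I * i) * g (slice i (Complex x (- y))))"
proof -
  define q where "q = slice I (Complex x y)"
  have I: "Re0 I = 0" "norm I = 1" using assms(2) by (auto simp: imag_units_iff)
  have ii: "i * i = -1" using assms(1) by (simp add: imag_units_def power2_eq_square)
  have re: "Re0 q = x" using I by (simp add: q_def slice_def)
  have im: "qIm q = y *\<^sub>R I" unfolding qIm_def re by (simp add: q_def slice_def scaleR_conv_of_real Reals_of_real)
     (simp add: quat_eq_iff)
  have nim: "norm (qIm q) = \<bar>y\<bar>" by (simp add: im I)
  have un: "im_unit i q = (if y = 0 then i else sgn y *\<^sub>R I)"
    using I by (auto simp: im_unit_def im sgn_scaleR sgn_div_norm)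
  have "q \<in> qball" using assms by (simp add: q_def)
  then have "slice_extend i g q = (1/2) *\<^sub>R
     ((1 - im_unit i q * i) * g (slice i (Complex x \<bar>y\<bar>)) + (1 + im_unit i q * i) * g (slice i (Complex x (- \<bar>y\<bar>))))"
    by (simp add: slice_extend_def re nim Let_def)
  also have "\<dots> = (1/2) *\<^sub>R
    ((1 - I * i) * g (slice i (Complex x y)) + (1 + I * i) * g (slice i (Complex x (- y))))"
  proof (cases y "0::real" rule: linorder_cases)
    case equal
    have "(1 - J * i) * c + (1 + J * i) * c = 2 * c" for J c :: quat
      by (simp add: algebra_simps mult_2)
    then show ?thesis using equal by (simp only: un abs_zero minus_zero)
  next
    case less then show ?thesis by (simp add: un algebra_simps)
  next
    case greater then show ?thesis by (simp add: un)
  qed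
  finally show ?thesis by (simp add: q_def)
qed

lemma slice_ball_iff: "q \<in> slice_ball i \<longleftrightarrow> q \<in> qball \<and> (\<exists>x y. q = slice i (Complex x y))"
  unfolding slice_ball_def by (metis Int_iff complex_surj rangeE rangeI)

lemma slice_extend_self:
  assumes "i \<in> imag_units" "q \<in> slice_ball i"
  shows "slice_extend i g q = g q"
proof -
  obtain x y where q: "q = slice i (Complex x y)" "q \<in> qball" using assms(2) slice_ball_iff by metis
  have ii: "i * i = -1" using assms(1) by (simp add: imag_units_def power2_eq_square)
  show ?thesis using slice_extend_slice[OF assms(1,1), of x y g] q by (simp add: ii scaleR_2[symmetric] mult_2[symmetric])
qed

lemma rps_unique:
  assumes F: "\<And>q. q \<in> qball \<Longrightarrow> (\<lambda>n. q ^ n * fps_nth F n) sums f q"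
    and G: "\<And>q. q \<in> qball \<Longrightarrow> (\<lambda>n. q ^ n * fps_nth G n) sums f q"
  shows "F = G"
proof -
  have key: "inner (fps_nth F n - fps_nth G n) b = 0" for b n
  proof (rule ccontr)
    define c where "c = (\<lambda>n. inner (fps_nth F n - fps_nth G n) b)"
    assume "\<not> ?thesis"
    then have n: "c n \<noteq> 0" by (simp add: c_def)
    define m where "m = (LEAST m. c m \<noteq> 0)"
    have m: "c m \<noteq> 0"
      unfolding m_def by (rule LeastI) (rule n)
    have mk: "c k = 0" if "k < m" for k
      using not_less_Least [OF that [unfolded m_def]] by blast
    have s: "(\<lambda>n. c n * x ^ n) sums 0" if "norm x < 1" for x :: real
    proof -
      have "(of_real x :: quat) \<in> qball" using that by simp
      from sums_diff[OF F[OF this] G[OF this]]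
      have "(\<lambda>n. x ^ n *\<^sub>R (fps_nth F n - fps_nth G n)) sums 0"
        by (simp add: right_diff_distrib[symmetric] of_real_power[symmetric] scaleR_conv_of_real del: of_real_power)
      from bounded_linear.sums[OF bounded_linear_inner_left this, of b]
      show ?thesis by (simp add: c_def mult.commute)
    qed
    have s': "(\<lambda>n. c (n + m) * x ^ n) sums 0" if "norm x < 1" "x \<noteq> 0" for x :: real
    proof -
      have "(\<lambda>n. c (n+m) * x ^ (n+m)) sums (0 - (\<Sum>k<m. c k * x ^ k))"
        using s[OF that(1)] by (rule sums_split_initial_segment)
      then have "(\<lambda>n. c (n+m) * x ^ (n+m)) sums 0" using mk by simp
      then have "(\<lambda>n. (c (n+m) * x ^ (n+m)) * inverse (x^m)) sums (0 * inverse (x^m))" by (rule sums_mult2)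
      then show ?thesis using that by (simp add: power_add field_simps)
    qed
    have "((\<lambda>x::real. 0) \<longlongrightarrow> c (0 + m)) (at 0)"
    proof (rule powser_limit_0_strong[of 1])
      fix x :: real assume "x \<noteq> 0" "norm x < 1"
      then show "(\<lambda>n. c (n + m) * x ^ n) sums 0" using s' by simp
    qed simp
    then have "c m = 0" by (simp add: tendsto_const_iff)
    with m show False by simp
  qed
  have "fps_nth F n = fps_nth G n" for n
    using key[of n "fps_nth F n - fps_nth G n"] by simp
  then show ?thesis by (simp add: fps_eq_iff)
qed

lemma rps_of_eqI:
  assumes "\<And>q. q \<in> qball \<Longrightarrow> (\<lambda>n. q ^ n * fps_nth F n) sums f q"
  shows "rps_of f = F"
  unfolding rps_of_def
proof (rule the_equality)
  show "\<forall>q\<in>qball. (\<lambda>n. q ^ n * fps_nth F n) sums f q" using assms by simp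
  show "G = F" if "\<forall>q\<in>qball. (\<lambda>n. q ^ n * fps_nth G n) sums f q" for G
    by (rule rps_unique [of G f F]) (use that assms in blast)+
qed

lemma qmoebius_series: "rps_of (\<lambda>q. 1 - q * qcnj a) = 1 - fps_X * fps_const (qcnj a)"
  "rps_of (\<lambda>q. a - q) = fps_const a - fps_X"
proof -
  have *: "(\<lambda>n. q ^ n * fps_nth F n) sums (fps_nth F 0 + q * fps_nth F 1)" 
    if "\<And>n. n \<ge> 2 \<Longrightarrow> fps_nth F n = 0" for F and q :: quat
  proof -
    have "(\<lambda>n. q ^ n * fps_nth F n) sums (\<Sum>n\<in>{0,1}. q ^ n * fps_nth F n)"
    proof (rule sums_finite)
      fix n :: nat assume "n \<notin> {0, 1}"
      then have "n \<ge> 2" by auto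
      then show "q ^ n * fps_nth F n = 0" using that by simp
    qed simp
    then show ?thesis by simp
  qed
  let ?F = "1 - fps_X * fps_const (qcnj a)"
  have F: "fps_nth ?F 0 = 1" "fps_nth ?F 1 = - qcnj a" "n \<ge> 2 \<Longrightarrow> fps_nth ?F n = 0" for n
    by (auto simp: fps_X_mult_nth)
  show "rps_of (\<lambda>q. 1 - q * qcnj a) = ?F"
  proof (rule rps_of_eqI)
    show "(\<lambda>n. q ^ n * fps_nth ?F n) sums (1 - q * qcnj a)" for q
      using *[of ?F q, OF F(3)] unfolding F(1,2) by (simp del: fps_sub_nth)
  qed
  let ?G = "fps_const a - fps_X"
  have G: "fps_nth ?G 0 = a" "fps_nth ?G 1 = - 1" "n \<ge> 2 \<Longrightarrow> fps_nth ?G n = 0" for n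
    by auto
  show "rps_of (\<lambda>q. a - q) = ?G"
  proof (rule rps_of_eqI)
    show "(\<lambda>n. q ^ n * fps_nth ?G n) sums (a - q)" for q
      using *[of ?G q, OF G(3)] unfolding G(1,2) by (simp del: fps_sub_nth)
  qed
qed

lemma slice_regular_has_deriv:
  assumes "slice_regular f" "q \<in> qball"
  shows "((\<lambda>t. f (q + of_real t)) has_vector_derivative deriv_x0 f q) (at 0)"
    "((\<lambda>t. f (q + t *\<^sub>R v)) differentiable (at 0))"
proof -
  have d: "f differentiable (at q)"
    using assms by (auto simp: slice_regular_def differentiable_on_def at_within_open[OF _ open_ball])
  have "(\<lambda>t. f (q + t *\<^sub>R v)) differentiable (at 0)" for v
  proof (rule differentiable_chain_at[of "\<lambda>t. q + t *\<^sub>R v" 0 f, unfolded o_def])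
    show "(\<lambda>t. q + t *\<^sub>R v) differentiable at 0" by (intro derivative_intros)
  qed (use d in simp)
  note * = this
  show "((\<lambda>t. f (q + t *\<^sub>R v)) differentiable (at 0))" by (rule *)
  show "((\<lambda>t. f (q + of_real t)) has_vector_derivative deriv_x0 f q) (at 0)"
    unfolding deriv_x0_def using *[of 1] by (simp add: vector_derivative_works of_real_def)
qed

lemma deriv_x0_diff:
  assumes "slice_regular f" "slice_regular g" "q \<in> qball"
  shows "deriv_x0 (\<lambda>q. f q - g q) q = deriv_x0 f q - deriv_x0 g q"
  unfolding deriv_x0_def[of "\<lambda>q. f q - g q"]
  by (rule vector_derivative_at) (intro has_vector_derivative_diff slice_regular_has_deriv assms)

lemma norm_deriv_x0_commute: "norm (deriv_x0 (\<lambda>q. f q - g q) q) = norm (deriv_x0 (\<lambda>q. g q - f q) q)"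
proof (cases "(\<lambda>t. f (q + of_real t) - g (q + of_real t)) differentiable (at 0)")
  case True
  then have "((\<lambda>t. f (q + of_real t) - g (q + of_real t)) has_vector_derivative deriv_x0 (\<lambda>q. f q - g q) q) (at 0)"
    by (simp add: deriv_x0_def vector_derivative_works)
  from vector_derivative_at[OF has_vector_derivative_minus[OF this]]
  show ?thesis by (simp add: deriv_x0_def)
next
  case False
  have "\<not> (\<lambda>t. g (q + of_real t) - f (q + of_real t)) differentiable (at 0)"
    using differentiable_minus[of "\<lambda>t. g (q + of_real t) - f (q + of_real t)" "at 0"] False by auto
  with False show ?thesis
    by (simp add: deriv_x0_def vector_derivative_def has_vector_derivative_def differentiable_def)
qed

lemma bloch_dist_commute: "bloch_dist f g = bloch_dist g f"
  unfolding bloch_dist_def bloch_norm_def bloch_seminorm_def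
  by (simp add: norm_deriv_x0_commute[of f g] norm_minus_commute)

lemma slice_ball_qball: "q \<in> slice_ball i \<Longrightarrow> q \<in> qball"
  by (simp add: slice_ball_def)

lemma bloch_seminorm_triangle:
  assumes "slice_regular f" "slice_regular g" "slice_regular h"
  shows "bloch_seminorm (\<lambda>q. f q - h q) \<le> bloch_seminorm (\<lambda>q. f q - g q) + bloch_seminorm (\<lambda>q. g q - h q)"
  unfolding bloch_seminorm_def[of "\<lambda>q. f q - h q"]
proof (intro SUP_least)
  fix i q assume i: "i \<in> imag_units" "q \<in> slice_ball i"
  then have q: "q \<in> qball" using slice_ball_qball by blast
  have n: "(1 - (norm q)\<^sup>2) \<ge> 0" using q by (simp add: power_le_one)
  have "norm (deriv_x0 (\<lambda>q. f q - h q) q) \<le> norm (deriv_x0 (\<lambda>q. f q - g q) q) + norm (deriv_x0 (\<lambda>q. g q - h q) q)"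
    unfolding deriv_x0_diff[OF assms(1,2) q] deriv_x0_diff[OF assms(1,3) q] deriv_x0_diff[OF assms(2,3) q]
    by (rule norm_diff_triangle_le[OF order_refl order_refl])
  then have "(1 - (norm q)\<^sup>2) * norm (deriv_x0 (\<lambda>q. f q - h q) q) \<le>
    (1 - (norm q)\<^sup>2) * norm (deriv_x0 (\<lambda>q. f q - g q) q) + (1 - (norm q)\<^sup>2) * norm (deriv_x0 (\<lambda>q. g q - h q) q)"
    using n by (simp only: distrib_left [symmetric] mult_left_mono)
  then have "ennreal ((1 - (norm q)\<^sup>2) * norm (deriv_x0 (\<lambda>q. f q - h q) q)) \<le>
    ennreal ((1 - (norm q)\<^sup>2) * norm (deriv_x0 (\<lambda>q. f q - g q) q)) + ennreal ((1 - (norm q)\<^sup>2) * norm (deriv_x0 (\<lambda>q. g q - h q) q))"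
    using n by (simp add: ennreal_plus[symmetric] del: ennreal_plus)
  also have "\<dots> \<le> bloch_seminorm (\<lambda>q. f q - g q) + bloch_seminorm (\<lambda>q. g q - h q)"
    unfolding bloch_seminorm_def using i by (intro add_mono SUP_upper2[OF i(1)] SUP_upper2[OF i(2)]) auto
  finally show "ennreal ((1 - (norm q)\<^sup>2) * norm (deriv_x0 (\<lambda>q. f q - h q) q)) \<le>
    bloch_seminorm (\<lambda>q. f q - g q) + bloch_seminorm (\<lambda>q. g q - h q)" .
qed

lemma bloch_seminorm_diff_finite:
  assumes "f \<in> Bloch" "g \<in> Bloch"
  shows "bloch_seminorm (\<lambda>q. f q - g q) < \<infinity>"
proof -
  have z: "slice_regular (\<lambda>q. 0)" by (simp add: slice_regular_def)
  have "bloch_seminorm (\<lambda>q. f q - g q) \<le> bloch_seminorm (\<lambda>q. f q - 0) + bloch_seminorm (\<lambda>q. 0 - g q)"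
    by (rule bloch_seminorm_triangle) (use assms z in \<open>auto simp: Bloch_def SR_def\<close>)
  also have "bloch_seminorm (\<lambda>q. 0 - g q) = bloch_seminorm (\<lambda>q. g q - 0)"
    unfolding bloch_seminorm_def norm_deriv_x0_commute[of "\<lambda>q. 0" g] ..
  finally have "bloch_seminorm (\<lambda>q. f q - g q) \<le> bloch_seminorm f + bloch_seminorm g" by simp
  also have "\<dots> < \<infinity>" using assms by (simp add: Bloch_def)
  finally show ?thesis .
qed

lemma slice_decomp:
  obtains i x y where "i \<in> imag_units" "q = slice i (Complex x y)"
proof (cases "q = of_real (Re0 q)")
  case True
  have "Quat 0 1 0 0 \<in> imag_units" by (simp add: imag_units_iff norm_quat_def)
  moreover have "q = slice (Quat 0 1 0 0) (Complex (Re0 q) 0)" using True by (simp add: slice_def)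
  ultimately show ?thesis by (rule that)
next
  case False
  define v where "v = q - of_real (Re0 q)"
  have v: "v \<noteq> 0" "Re0 v = 0" using False by (auto simp: v_def)
  have vq: "Re0 v = 0" "Im1 v = Im1 q" "Im2 v = Im2 q" "Im3 v = Im3 q" by (simp_all add: v_def)
  have "Re0 (sgn v) = 0" using v(2) by (simp add: sgn_quat_def)
  moreover have "norm (sgn v) = 1" using v(1) by (simp add: norm_sgn)
  ultimately have "sgn v \<in> imag_units" by (simp add: imag_units_iff)
  moreover have "q = slice (sgn v) (Complex (Re0 q) (norm v))"
    using v(1) vq by (simp add: slice_def sgn_quat_def quat_eq_iff[of q])
  ultimately show ?thesis by (rule that)
qed


lemma deriv_eq_imp_eq:
  assumes f: "slice_regular f" and g: "slice_regular g" and z: "f 0 = g 0"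
    and d: "\<And>q. q \<in> qball \<Longrightarrow> deriv_x0 f q = deriv_x0 g q" and q: "q \<in> qball"
  shows "f q = g q"
proof -
  obtain i x y where i: "i \<in> imag_units" and qxy: "q = slice i (Complex x y)" using slice_decomp .
  have i1: "norm i = 1" "Re0 i = 0" using i by (auto simp: imag_units_iff)
  have ns: "norm (slice i (Complex a b)) = sqrt (a\<^sup>2 + b\<^sup>2)" for a b
  proof -
    have "(norm i)\<^sup>2 = 1" using i1 by simp
    then have "(Im1 i)\<^sup>2 + (Im2 i)\<^sup>2 + (Im3 i)\<^sup>2 = 1" using i1(2) by (simp add: norm_quat_def)
    then have "(Im1 i * b)\<^sup>2 + (Im2 i * b)\<^sup>2 + (Im3 i * b)\<^sup>2 = b\<^sup>2"
      by (simp add: power_mult_distrib distrib_right[symmetric])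
    then show ?thesis using i1(2) by (simp add: slice_def norm_quat_def add.assoc)
  qed
  have xy: "x\<^sup>2 + y\<^sup>2 < 1" using q unfolding qxy by (simp add: ns)
  have x1: "\<bar>x\<bar> < 1" using xy zero_le_power2[of y] abs_square_less_1[of x] by linarith
  define h where "h = (\<lambda>q. f q - g q)"
  have dx: "((\<lambda>t. h (of_real t)) has_vector_derivative 0) (at s)" if "\<bar>s\<bar> < 1" for s
  proof -
    have sq: "of_real s \<in> qball" using that by simp
    have "((\<lambda>t. h (of_real s + of_real t)) has_vector_derivative (deriv_x0 f (of_real s) - deriv_x0 g (of_real s))) (at 0)"
      unfolding h_def by (intro has_vector_derivative_diff slice_regular_has_deriv f g sq)
    then have "((\<lambda>t. h (of_real (s + t))) has_vector_derivative 0) (at 0)" using d[OF sq] by simp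
    then have "((\<lambda>t. h (of_real t)) \<circ> (\<lambda>t. s + t) has_vector_derivative 0) (at 0)" by (simp add: o_def)
    then show ?thesis using vector_diff_chain_at[of "\<lambda>t. t - s" 1 s "\<lambda>t. h (of_real (s + t))" 0]
      by (simp add: o_def has_vector_derivative_diff_const)
  qed
  have dy: "((\<lambda>t. h (slice i (Complex x t))) has_vector_derivative 0) (at s)" if "\<bar>s\<bar> \<le> \<bar>y\<bar>" for s
  proof -
    let ?q = "slice i (Complex x s)"
    have "s\<^sup>2 \<le> y\<^sup>2" using that by (simp add: abs_le_square_iff)
    then have sq: "?q \<in> qball" using xy by (simp add: ns)
    have shift: "((\<lambda>t. F (slice i (Complex x t))) differentiable (at s))"
       "vector_derivative (\<lambda>t. F (slice i (Complex t s))) (at x) = deriv_x0 F ?q"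
      if F: "slice_regular F" for F
    proof -
      have D: "F differentiable (at ?q)"
        using F sq by (auto simp: slice_regular_def differentiable_on_def at_within_open[OF _ open_ball])
      show "((\<lambda>t. F (slice i (Complex x t))) differentiable (at s))"
        by (rule differentiable_chain_at[of "\<lambda>t. slice i (Complex x t)" s F, unfolded o_def])
          (auto simp: slice_def of_real_def intro!: derivative_intros bounded_linear_imp_differentiable D[unfolded slice_def of_real_def, simplified])
      have e: "F (slice i (Complex t s)) = F (?q + of_real (t - x))" for t by (simp add: slice_def algebra_simps)
      have "((\<lambda>t. F (?q + of_real t)) has_vector_derivative deriv_x0 F ?q) (at (x - x))"
        using slice_regular_has_deriv(1)[OF F sq] by simp
      from vector_diff_chain_at[of "\<lambda>t. t - x" 1 x, OF _ this]
      have "((\<lambda>t. F (?q + of_real (t - x))) has_vector_derivative deriv_x0 F ?q) (at x)"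
        by (simp add: o_def has_vector_derivative_diff_const)
      then show "vector_derivative (\<lambda>t. F (slice i (Complex t s))) (at x) = deriv_x0 F ?q"
        unfolding e by (rule vector_derivative_at)
    qed
    let ?D = "\<lambda>F. vector_derivative (\<lambda>t. F (slice i (Complex x t))) (at s)"
    have "deriv_x0 f ?q + i * ?D f = 0" "deriv_x0 g ?q + i * ?D g = 0"
      using f g i sq shift(2)[OF f] shift(2)[OF g] unfolding slice_regular_def by metis+
    then have "i * ?D f = i * ?D g" using d[OF sq] by (metis add_left_cancel)
    then have eq: "?D f = ?D g" using i1 by force
    have "((\<lambda>t. h (slice i (Complex x t))) has_vector_derivative (?D f - ?D g)) (at s)"
      unfolding h_def by (intro has_vector_derivative_diff) (use shift(1) f g in \<open>auto simp: vector_derivative_works\<close>)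
    then show ?thesis by (simp add: eq)
  qed
  have "h (of_real x) = h (of_real 0)"
  proof (rule has_vector_derivative_zero_constant [of "{-\<bar>x\<bar>..\<bar>x\<bar>}" "\<lambda>t. h (of_real t)"])
    fix s assume "s \<in> {-\<bar>x\<bar>..\<bar>x\<bar>}"
    then have "\<bar>s\<bar> < 1" using x1 unfolding atLeastAtMost_iff by linarith
    then show "((\<lambda>t. h (of_real t)) has_vector_derivative 0) (at s within {-\<bar>x\<bar>..\<bar>x\<bar>})"
      by (rule has_vector_derivative_at_within [OF dx])
  next
    fix c assume c: "\<And>t. t \<in> {-\<bar>x\<bar>..\<bar>x\<bar>} \<Longrightarrow> h (of_real t) = c"
    have "x \<in> {-\<bar>x\<bar>..\<bar>x\<bar>}" "0 \<in> {-\<bar>x\<bar>..\<bar>x\<bar>}" unfolding atLeastAtMost_iff by linarith+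
    then show ?thesis by (simp only: c)
  qed simp
  then have 1: "h (of_real x) = 0" using z by (simp add: h_def)
  have "h (slice i (Complex x y)) = h (slice i (Complex x 0))"
  proof (rule has_vector_derivative_zero_constant [of "{-\<bar>y\<bar>..\<bar>y\<bar>}" "\<lambda>t. h (slice i (Complex x t))"])
    fix s assume "s \<in> {-\<bar>y\<bar>..\<bar>y\<bar>}"
    then have "\<bar>s\<bar> \<le> \<bar>y\<bar>" unfolding atLeastAtMost_iff by linarith
    then show "((\<lambda>t. h (slice i (Complex x t))) has_vector_derivative 0) (at s within {-\<bar>y\<bar>..\<bar>y\<bar>})"
      by (rule has_vector_derivative_at_within [OF dy])
  next
    fix c assume c: "\<And>t. t \<in> {-\<bar>y\<bar>..\<bar>y\<bar>} \<Longrightarrow> h (slice i (Complex x t)) = c"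
    have "y \<in> {-\<bar>y\<bar>..\<bar>y\<bar>}" "0 \<in> {-\<bar>y\<bar>..\<bar>y\<bar>}" unfolding atLeastAtMost_iff by linarith+
    then show ?thesis by (simp only: c)
  qed simp
  with 1 have "h q = 0" by (simp add: qxy slice_def)
  then show ?thesis by (simp add: h_def)
qed

lemma Metric_space_Bloch: "Metric_space Bloch bloch_dist"
proof
  show "0 \<le> bloch_dist f g" for f g by (simp add: bloch_dist_def bloch_norm_def)
  show "bloch_dist f g = bloch_dist g f" for f g by (rule bloch_dist_commute)
  fix f g h assume f: "f \<in> Bloch" and g: "g \<in> Bloch"
  then have fS: "slice_regular f" "slice_regular g" "f \<in> extensional qball" "g \<in> extensional qball"
    by (auto simp: Bloch_def SR_def)
  { assume h: "h \<in> Bloch" then have hS: "slice_regular h" by (auto simp: Bloch_def SR_def)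
    have "enn2real (bloch_seminorm (\<lambda>q. f q - h q)) \<le>
      enn2real (bloch_seminorm (\<lambda>q. f q - g q) + bloch_seminorm (\<lambda>q. g q - h q))"
      by (rule enn2real_mono[OF bloch_seminorm_triangle])
        (use fS hS f g h in \<open>auto intro: bloch_seminorm_diff_finite[unfolded infinity_ennreal_def]\<close>)
    also have "\<dots> = enn2real (bloch_seminorm (\<lambda>q. f q - g q)) + enn2real (bloch_seminorm (\<lambda>q. g q - h q))"
      by (rule enn2real_plus) (use f g h in \<open>auto intro: bloch_seminorm_diff_finite[unfolded infinity_ennreal_def]\<close>)
    finally show "bloch_dist f h \<le> bloch_dist f g + bloch_dist g h"
      unfolding bloch_dist_def bloch_norm_def
      using norm_diff_triangle_le[OF order_refl order_refl, of "f 0" "h 0" "g 0"] by linarith }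
  show "bloch_dist f g = 0 \<longleftrightarrow> f = g"
  proof
    assume "f = g"
    have "deriv_x0 (\<lambda>q. 0) q = 0" for q by (simp add: deriv_x0_def)
    then have "bloch_seminorm (\<lambda>q. 0) \<le> 0" unfolding bloch_seminorm_def by (intro SUP_least) simp
    with \<open>f = g\<close> show "bloch_dist f g = 0"
      by (simp add: bloch_dist_def bloch_norm_def)
  next
    assume 0: "bloch_dist f g = 0"
    have e: "enn2real (bloch_seminorm (\<lambda>q. f q - g q)) = 0" "norm (f 0 - g 0) = 0"
      using 0 unfolding bloch_dist_def bloch_norm_def using norm_ge_zero[of "f 0 - g 0"] enn2real_nonneg[of "bloch_seminorm (\<lambda>q. f q - g q)"] by linarith+
    then have s: "bloch_seminorm (\<lambda>q. f q - g q) = 0"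
      using bloch_seminorm_diff_finite[OF f g] by (auto simp: enn2real_eq_0_iff)
    have "deriv_x0 f q = deriv_x0 g q" if q: "q \<in> qball" for q
    proof -
      obtain i x y where i: "i \<in> imag_units" "q = slice i (Complex x y)" using slice_decomp .
      then have qi: "q \<in> slice_ball i" using q by (auto simp: slice_ball_def)
      have "ennreal ((1 - (norm q)\<^sup>2) * norm (deriv_x0 (\<lambda>q. f q - g q) q)) \<le> bloch_seminorm (\<lambda>q. f q - g q)"
        unfolding bloch_seminorm_def by (intro SUP_upper2[OF i(1)] SUP_upper2[OF qi]) auto
      then have "(1 - (norm q)\<^sup>2) * norm (deriv_x0 (\<lambda>q. f q - g q) q) \<le> 0" using s by (simp add: ennreal_eq_0_iff)
      moreover have "1 - (norm q)\<^sup>2 > 0" using q by (simp add: power_less_one_iff)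
      ultimately have "norm (deriv_x0 (\<lambda>q. f q - g q) q) \<le> 0" by (simp add: mult_le_0_iff)
      then show ?thesis using deriv_x0_diff[OF fS(1,2) q] by simp
    qed
    then have "f q = g q" if "q \<in> qball" for q
      using deriv_eq_imp_eq[OF fS(1,2) _ _ that] e(2) by simp
    then show "f = g" using fS(3,4) by (rule extensionalityI[rotated 2])
  qed
qed

end

theory Submission
  imports Defs "HOL-Complex_Analysis.Complex_Analysis"
begin

text \<open>
  On the slice of \<open>i\<close> the map \<open>\<Phi>\<close> is a holomorphic self-map \<open>\<phi>\<close> of the disc, and
  \<open>(C\<^sub>\<Phi> f)' = \<phi>' \<cdot> (f' \<circ> \<phi>)\<close> there; the representation formula transfers bounds from this
  slice to the ball at the cost of a factor two.

  Necessity: the maps \<open>\<sigma>\<^sub>a\<close> are bounded in the Besov space, by the Moebius invariance of the energy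
  (a change of variables), while their derivatives tend to \<open>0\<close> locally uniformly as \<open>\<bar>a\<bar> \<rightarrow> 1\<close>. Hence
  every Bloch limit point of \<open>C\<^sub>\<Phi> \<sigma>\<^sub>a\<close> has derivative \<open>0\<close>.

  Sufficiency: \<open>(1 - \<bar>a\<bar>\<^sup>2) \<bar>\<sigma>\<^sub>a'(a)\<bar> = 1\<close>, so that with \<open>a = \<phi> z\<close> the hypothesis says that
  \<open>(1 - \<bar>z\<bar>\<^sup>2) \<bar>\<phi>' z\<bar> / (1 - \<bar>\<phi> z\<bar>\<^sup>2)\<close> is small where \<open>\<bar>\<phi> z\<bar>\<close> is close to \<open>1\<close>. The area mean value
  property bounds the Bloch seminorm by the Besov norm; a bounded sequence then has, by Montel's
  theorem, a subsequence converging locally uniformly with its derivatives, which controls the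
  points where \<open>\<bar>\<phi> z\<bar>\<close> stays away from \<open>1\<close>, while the hypothesis controls the others.
\<close>

section \<open>Slices\<close>

text \<open>Left multiplication by \<open>i\<close> makes the quaternions a two-dimensional complex
  space. With a unit \<open>j\<close> anticommuting with \<open>i\<close>, every value is A + B j
  with A and B in the slice of \<open>i\<close>, and slice regularity on that slice says exactly
  that A and B are holomorphic. Mean values, Cauchy estimates and Montel's theorem are applied to
  these components. The way back to the ball is a power series with right coefficients: the Taylor
  coefficients of A and B combine to quaternionic ones, and the sum of such a series is slice
  regular and obeys the representation formula. This is how \<open>comp_op\<close> is seen to
  produce slice regular functions. A second obstacle is that a ranges over the whole ball and not
  just over the slice of \<open>i\<close>. On its own slice \<open>qmoebius a\<close> is a disc
  automorphism with parameter \<alpha>; on other slices it mixes the automorphisms for \<alpha> and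
  its conjugate, so both occur in every bound. Their common energy is, up to a factor, the integral
  of (1 - |w|^2)^(p-2) over the disc, which is finite because p > 1.\<close>

lemma slice_alt: "slice i z = Re z *\<^sub>R 1 + Im z *\<^sub>R i"
  by (simp add: slice_def quat_eq_iff)

lemma imag_units_mult_self: "i \<in> imag_units \<Longrightarrow> i * i = - 1"
  by (simp add: imag_units_def power2_eq_square)

lemma imag_units_norm: "i \<in> imag_units \<Longrightarrow> norm i = 1"
  and imag_units_Re0: "i \<in> imag_units \<Longrightarrow> Re0 i = 0"
  by (simp_all add: imag_units_iff)

lemma slice_0 [simp]: "slice i 0 = 0"
  and slice_1 [simp]: "slice i 1 = 1"
  and slice_add: "slice i (z + w) = slice i z + slice i w"
  and slice_diff: "slice i (z - w) = slice i z - slice i w"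
  and slice_scaleR: "slice i (r *\<^sub>R z) = r *\<^sub>R slice i z"
  by (simp_all add: slice_alt algebra_simps)

lemma slice_i [simp]: "slice i \<i> = i"
  by (simp add: slice_alt)

lemma slice_mult:
  assumes "i \<in> imag_units"
  shows "slice i (z * w) = slice i z * slice i w"
  by (simp add: slice_alt distrib_left distrib_right imag_units_mult_self[OF assms] algebra_simps)

lemma slice_power: "i \<in> imag_units \<Longrightarrow> slice i (z ^ n) = slice i z ^ n"
  by (induction n) (simp_all add: slice_mult)

lemma norm_slice:
  assumes "i \<in> imag_units"
  shows "norm (slice i z) = norm z"
proof -
  have "(norm i)\<^sup>2 = 1" using imag_units_norm[OF assms] by simp
  then have "(Im1 i)\<^sup>2 + (Im2 i)\<^sup>2 + (Im3 i)\<^sup>2 = 1"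
    using imag_units_Re0[OF assms] by (simp add: norm_quat_def)
  then have "(Im z * Im1 i)\<^sup>2 + (Im z * Im2 i)\<^sup>2 + (Im z * Im3 i)\<^sup>2 = (Im z)\<^sup>2"
    by (simp add: power_mult_distrib distrib_left[symmetric])
  then show ?thesis
    using imag_units_Re0[OF assms] by (simp add: slice_alt norm_quat_def cmod_def add.assoc)
qed

lemma bounded_linear_slice: "bounded_linear (slice i)"
proof -
  have "linear (slice i)"
    by (rule linearI) (simp_all add: slice_add slice_scaleR)
  then show ?thesis by (rule linear_conv_bounded_linear[THEN iffD1])
qed

lemma slice_in_slice_ball [simp]: "i \<in> imag_units \<Longrightarrow> slice i z \<in> slice_ball i \<longleftrightarrow> norm z < 1"
  by (auto simp: slice_ball_def norm_slice)

lemma slice_cases: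
  obtains i z where "i \<in> imag_units" "q = slice i z"
  using slice_decomp by metis

lemma slice_ball_cases:
  assumes "q \<in> slice_ball i" "i \<in> imag_units"
  obtains z where "q = slice i z" "norm z < 1"
  using assms by (auto simp: slice_ball_def norm_slice)

text \<open>The sum of \<open>slice i z\<close> and its conjugate is 2 Re z, their difference is 2
  Im z times \<open>i\<close>, and multiplying the latter by - I i replaces \<open>i\<close> by
  \<open>I\<close>. Used at \<open>z ^ n\<close>, this is the representation formula for
  monomials.\<close>

lemma slice_representation:
  assumes "i \<in> imag_units"
  shows "slice I z = (1/2) *\<^sub>R ((1 - I * i) * slice i z + (1 + I * i) * slice i (cnj z))"
proof -
  have "(1 - I * i) * slice i z + (1 + I * i) * slice i (cnj z)
      = (slice i z + slice i (cnj z)) - I * (i * (slice i z - slice i (cnj z)))"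
    by (simp only: left_diff_distrib distrib_right right_diff_distrib mult.assoc mult_1_left) simp
  also have "slice i z + slice i (cnj z) = (2 * Re z) *\<^sub>R 1"
    by (simp add: slice_alt scaleR_2[symmetric])
  also have "slice i z - slice i (cnj z) = (2 * Im z) *\<^sub>R i"
    by (simp add: slice_alt scaleR_2[symmetric])
  also have "i * ((2 * Im z) *\<^sub>R i) = - ((2 * Im z) *\<^sub>R 1)"
    by (simp add: imag_units_mult_self[OF assms])
  finally show ?thesis
    by (simp add: slice_alt scaleR_add_right)
qed

section \<open>Power series on the ball\<close>

text \<open>The derivative of q^n in direction h without commutativity: the sum of q^(n-1-k) h q^k
  over k < n.\<close>

primrec power_diff :: "nat \<Rightarrow> 'a::real_normed_algebra_1 \<Rightarrow> 'a \<Rightarrow> 'a" where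
  "power_diff 0 q h = 0"
| "power_diff (Suc n) q h = q * power_diff n q h + h * q ^ n"

lemma has_derivative_power_diff:
  "((\<lambda>q. q ^ n) has_derivative power_diff n q) (at q within S)"
proof (induction n)
  case (Suc n)
  have "((\<lambda>q. q * q ^ n) has_derivative (\<lambda>h. q * power_diff n q h + h * q ^ n)) (at q within S)"
    by (rule has_derivative_mult[OF has_derivative_ident Suc])
  also have "(\<lambda>h. q * power_diff n q h + h * q ^ n) = power_diff (Suc n) q"
    by (rule ext) simp
  finally show ?case by simp
next
  case 0
  have "power_diff 0 q = (\<lambda>h. 0)" by (rule ext) simp
  then show ?case by simp
qed

lemma norm_power_diff:
  fixes q :: "'a::real_normed_div_algebra"
  shows "norm (power_diff n q h) \<le> real n * norm q ^ (n - 1) * norm h"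
proof (induction n)
  case (Suc n)
  have "norm (power_diff (Suc n) q h) \<le> norm q * norm (power_diff n q h) + norm h * norm q ^ n"
    using norm_triangle_ineq[of "q * power_diff n q h" "h * q ^ n"] by (simp add: norm_mult norm_power)
  also have "norm q * norm (power_diff n q h) \<le> norm q * (real n * norm q ^ (n - 1) * norm h)"
    by (rule mult_left_mono[OF Suc]) simp
  also have "\<dots> = real n * norm q ^ n * norm h" by (cases n) simp_all
  finally show ?case by (simp add: algebra_simps)
qed simp

text \<open>The directions that matter for slice regularity, \<open>1\<close> and the unit of the
  slice through \<open>q\<close>, commute with \<open>q\<close>. The factor \<open>h\<close> is kept
  on the left since the coefficients of a series are multiplied on the right.\<close>

lemma power_diff_commute:
  assumes "q * h = h * q"
  shows "power_diff n q h = h * (of_nat n * q ^ (n - 1))"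
proof (induction n)
  case (Suc n)
  have "power_diff (Suc n) q h = q * (h * (of_nat n * q ^ (n - 1))) + h * q ^ n"
    by (simp only: power_diff.simps Suc)
  also have "q * (h * (of_nat n * q ^ (n - 1))) = h * (q * of_nat n * q ^ (n - 1))"
    by (simp only: mult.assoc[symmetric] assms)
  also have "q * of_nat n = of_nat n * q" by (rule mult_of_nat_commute[symmetric])
  also have "h * (of_nat n * q * q ^ (n - 1)) = h * (of_nat n * (q * q ^ (n - 1)))"
    by (simp only: mult.assoc)
  also have "\<dots> = h * (of_nat n * q ^ n)" by (cases n) simp_all
  finally show ?case by (simp add: algebra_simps)
qed simp

section \<open>Convergence and termwise differentiation of series with right coefficients\<close>

definition ball_convergent :: "quat fps \<Rightarrow> bool" where
  "ball_convergent F \<longleftrightarrow> (\<forall>r. 0 \<le> r \<and> r < 1 \<longrightarrow> summable (\<lambda>n. norm (fps_nth F n) * r ^ n))"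

lemma ball_convergent_sums:
  assumes "ball_convergent F" "q \<in> qball"
  shows "(\<lambda>n. q ^ n * fps_nth F n) sums rps_eval F q"
proof -
  have "summable (\<lambda>n. norm (fps_nth F n) * norm q ^ n)"
    using assms by (simp add: ball_convergent_def)
  then have "summable (\<lambda>n. norm (q ^ n * fps_nth F n))"
    by (simp add: norm_mult norm_power mult.commute)
  then show ?thesis unfolding rps_eval_def by (rule summable_sums[OF summable_norm_cancel])
qed

lemma ball_convergent_deriv:
  assumes "ball_convergent F"
  shows "ball_convergent (fps_deriv F)"
  unfolding ball_convergent_def
proof (intro allI impI)
  fix r :: real assume r: "0 \<le> r \<and> r < 1"
  have "summable (\<lambda>n. diffs (\<lambda>n. norm (fps_nth F n)) n * r ^ n)"
  proof (rule termdiff_converges[where K = 1])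
    show "norm r < 1" using r by simp
    fix x :: real assume "norm x < 1"
    then have "summable (\<lambda>n. norm (fps_nth F n) * \<bar>x\<bar> ^ n)"
      using assms by (simp add: ball_convergent_def)
    then have "summable (\<lambda>n. norm (norm (fps_nth F n) * x ^ n))"
      by (simp add: abs_mult power_abs)
    then show "summable (\<lambda>n. norm (fps_nth F n) * x ^ n)" by (rule summable_norm_cancel)
  qed
  also have "(\<lambda>n. diffs (\<lambda>n. norm (fps_nth F n)) n * r ^ n) = (\<lambda>n. norm (fps_nth (fps_deriv F) n) * r ^ n)"
    unfolding fps_deriv_nth norm_mult norm_of_nat by (simp add: diffs_def)
  finally show "summable (\<lambda>n. norm (fps_nth (fps_deriv F) n) * r ^ n)" .
qed

text \<open>Termwise Frechet differentiation: on a ball of radius r strictly between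
  \<open>norm q\<close> and 1, the derivatives of the terms are dominated by
  \<open>u n * norm h\<close>, where \<open>u\<close> is the term sequence of the differentiated
  real majorant at r.\<close>

lemma rps_eval_has_derivative:
  fixes q :: quat
  assumes F: "ball_convergent F" and q: "q \<in> qball"
  shows "(rps_eval F has_derivative (\<lambda>h. \<Sum>n. power_diff n q h * fps_nth F n)) (at q)"
proof -
  define r where "r = (1 + norm q) / 2"
  have r: "0 \<le> r" "norm q < r" "r < 1" using q by (auto simp: r_def)
  define u where "u = (\<lambda>n. real n * r ^ (n - 1) * norm (fps_nth F n))"
  have "summable (\<lambda>n. norm (fps_nth (fps_deriv F) n) * r ^ n)"
    using ball_convergent_deriv[OF F] r by (simp add: ball_convergent_def)
  then have "summable (\<lambda>n. u (Suc n))"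
    unfolding fps_deriv_nth norm_mult norm_of_nat by (simp add: u_def mult_ac)
  then have u: "summable u" by (subst (asm) summable_Suc_iff)
  have u0: "0 \<le> u n" for n using r by (simp add: u_def)
  have bd: "norm (power_diff n x h * fps_nth F n) \<le> u n * norm h" if "x \<in> ball 0 r" for n and x h :: quat
  proof -
    have "norm x ^ (n - 1) \<le> r ^ (n - 1)" using that by (intro power_mono) auto
    then have "real n * norm x ^ (n - 1) * norm h \<le> real n * r ^ (n - 1) * norm h"
      by (intro mult_right_mono mult_left_mono) auto
    then have "norm (power_diff n x h) \<le> real n * r ^ (n - 1) * norm h"
      using norm_power_diff[of n x h] by linarith
    then have "norm (power_diff n x h) * norm (fps_nth F n) \<le> real n * r ^ (n - 1) * norm h * norm (fps_nth F n)"
      by (rule mult_right_mono) simp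
    then show ?thesis by (simp add: norm_mult u_def mult_ac)
  qed
  have sm: "summable (\<lambda>n. norm (power_diff n x h * fps_nth F n))" if "x \<in> ball 0 r" for x h :: quat
    by (rule summable_comparison_test'[where g = "\<lambda>n. u n * norm h" and N = 0])
      (use u bd[OF that] in \<open>auto intro: summable_mult2\<close>)
  have "\<exists>g. \<forall>x\<in>ball 0 r. (\<lambda>n. x ^ n * fps_nth F n) sums g x \<and>
     (g has_derivative (\<lambda>h. \<Sum>n. power_diff n x h * fps_nth F n)) (at x within ball 0 r)"
  proof (rule has_derivative_series)
    show "(\<lambda>n. q ^ n * fps_nth F n) sums rps_eval F q"
      by (rule ball_convergent_sums[OF F q])
    show "q \<in> ball 0 r" using r by simp
    show "((\<lambda>x. x ^ n * fps_nth F n) has_derivative (\<lambda>h. power_diff n x h * fps_nth F n)) (at x within ball 0 r)" for n and x :: quat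
      by (rule has_derivative_mult_left[OF has_derivative_power_diff])
    fix e :: real assume e: "e > 0"
    have "(\<lambda>N. \<Sum>n. u (n + N)) \<longlonglongrightarrow> 0" by (rule suminf_exist_split2[OF u])
    then have "\<forall>\<^sub>F N in sequentially. (\<Sum>n. u (n + N)) < e" using e by (rule order_tendstoD)
    then show "\<forall>\<^sub>F N in sequentially. \<forall>x\<in>ball 0 r. \<forall>h.
       norm ((\<Sum>n<N. power_diff n x h * fps_nth F n) - (\<Sum>n. power_diff n x h * fps_nth F n)) \<le> e * norm h"
    proof eventually_elim
      case (elim N)
      show ?case
      proof (intro ballI allI)
        fix x h :: quat assume x: "x \<in> ball 0 r"
        let ?g = "\<lambda>n. power_diff n x h * fps_nth F n"
        have g: "summable ?g" using sm[OF x] by (rule summable_norm_cancel)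
        have "norm ((\<Sum>n<N. ?g n) - (\<Sum>n. ?g n)) = norm (\<Sum>n. ?g (n + N))"
          using suminf_split_initial_segment[OF g, of N] by (simp add: norm_minus_commute)
        also have "\<dots> \<le> (\<Sum>n. u (n + N) * norm h)"
          by (rule norm_suminf_le) (use bd[OF x] u in \<open>auto intro!: summable_mult2 simp: summable_iff_shift\<close>)
        also have "\<dots> = (\<Sum>n. u (n + N)) * norm h"
          by (rule suminf_mult2[symmetric]) (use u in \<open>simp add: summable_iff_shift\<close>)
        also have "\<dots> \<le> e * norm h" using elim by (intro mult_right_mono) auto
        finally show "norm ((\<Sum>n<N. ?g n) - (\<Sum>n. ?g n)) \<le> e * norm h" .
      qed
    qed
  qed simp
  then obtain g where g: "\<And>x. x \<in> ball 0 r \<Longrightarrow> (\<lambda>n. x ^ n * fps_nth F n) sums g x"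
    "\<And>x. x \<in> ball 0 r \<Longrightarrow> (g has_derivative (\<lambda>h. \<Sum>n. power_diff n x h * fps_nth F n)) (at x within ball 0 r)"
    by blast
  have qr: "q \<in> ball 0 r" using r by simp
  have "(g has_derivative (\<lambda>h. \<Sum>n. power_diff n q h * fps_nth F n)) (at q)"
    using g(2)[OF qr] at_within_open[OF qr open_ball] by simp
  then show ?thesis
  proof (rule has_derivative_transform_within_open[OF _ open_ball qr])
    fix x :: quat assume "x \<in> ball 0 r"
    then show "g x = rps_eval F x" unfolding rps_eval_def by (rule sums_unique[OF g(1)])
  qed
qed

lemma rps_eval_derivative_commute:
  fixes q :: quat
  assumes F: "ball_convergent F" and q: "q \<in> qball" and h: "q * h = h * q"
  shows "(\<Sum>n. power_diff n q h * fps_nth F n) = h * rps_eval (fps_deriv F) q"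
proof -
  have "(\<lambda>n. q ^ n * fps_nth (fps_deriv F) n) sums rps_eval (fps_deriv F) q"
    by (rule ball_convergent_sums[OF ball_convergent_deriv[OF F] q])
  then have "(\<lambda>n. h * (q ^ n * fps_nth (fps_deriv F) n)) sums (h * rps_eval (fps_deriv F) q)"
    by (rule sums_mult)
  also have "(\<lambda>n. h * (q ^ n * fps_nth (fps_deriv F) n)) = (\<lambda>n. power_diff (Suc n) q h * fps_nth F (Suc n))"
  proof
    fix n
    have "q ^ n * of_nat (Suc n) = of_nat (Suc n) * q ^ n" by (rule mult_of_nat_commute[symmetric])
    then show "h * (q ^ n * fps_nth (fps_deriv F) n) = power_diff (Suc n) q h * fps_nth F (Suc n)"
      unfolding power_diff_commute[OF h] fps_deriv_nth by (metis Suc_eq_plus1 diff_Suc_1 mult.assoc)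
  qed
  \<comment> \<open>Prepending the term for 0 leaves the sum unchanged, because
    \<open>power_diff 0\<close> vanishes.\<close>
  finally have "(\<lambda>n. power_diff n q h * fps_nth F n) sums (h * rps_eval (fps_deriv F) q)"
    by (subst (asm) sums_Suc_iff) simp
  then show ?thesis by (rule sums_unique[symmetric])
qed

text \<open>Formulated along a curve, so that the real direction and both coordinate lines of a
  slice are instances of one rule.\<close>

lemma vector_derivative_rps_eval:
  fixes f :: "quat \<Rightarrow> quat"
  assumes F: "ball_convergent F" and eq: "\<And>q. q \<in> qball \<Longrightarrow> f q = rps_eval F q"
    and q: "q \<in> qball" and h: "q * h = h * q"
    and \<gamma>: "(\<gamma> has_vector_derivative h) (at s)" "\<gamma> s = q"
  shows "((\<lambda>t. f (\<gamma> t)) has_vector_derivative h * rps_eval (fps_deriv F) q) (at s)"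
proof -
  have "(f has_derivative (\<lambda>h. \<Sum>n. power_diff n q h * fps_nth F n)) (at q)"
    using rps_eval_has_derivative[OF F q]
    by (rule has_derivative_transform_within_open[OF _ open_ball q]) (simp add: eq)
  with \<gamma> have "(f has_derivative (\<lambda>h. \<Sum>n. power_diff n q h * fps_nth F n)) (at (\<gamma> s) within range \<gamma>)"
    by (auto intro: has_derivative_at_withinI)
  from vector_derivative_diff_chain_within[OF \<gamma>(1) this]
  show ?thesis by (simp add: o_def rps_eval_derivative_commute[OF F q h])
qed

lemma deriv_x0_rps_eval:
  fixes f :: "quat \<Rightarrow> quat"
  assumes F: "ball_convergent F" and eq: "\<And>q. q \<in> qball \<Longrightarrow> f q = rps_eval F q" and q: "q \<in> qball"
  shows "deriv_x0 f q = rps_eval (fps_deriv F) q"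
proof -
  have "((\<lambda>t. f (q + of_real t)) has_vector_derivative 1 * rps_eval (fps_deriv F) q) (at 0)"
    by (rule vector_derivative_rps_eval[OF F eq q])
      (auto simp: of_real_def intro!: derivative_eq_intros)
  then show ?thesis unfolding deriv_x0_def by (simp add: vector_derivative_at)
qed

lemma slice_regular_rps_eval:
  fixes f :: "quat \<Rightarrow> quat"
  assumes F: "ball_convergent F" and eq: "\<And>q. q \<in> qball \<Longrightarrow> f q = rps_eval F q"
  shows "slice_regular f"
  unfolding slice_regular_def
proof (intro conjI ballI allI impI)
  show "f differentiable_on qball"
    unfolding differentiable_on_def
  proof
    fix q assume q: "q \<in> qball"
    have "(f has_derivative (\<lambda>h. \<Sum>n. power_diff n q h * fps_nth F n)) (at q)"
      using rps_eval_has_derivative[OF F q]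
      by (rule has_derivative_transform_within_open[OF _ open_ball q]) (simp add: eq)
    then show "f differentiable at q within qball"
      by (auto simp: differentiable_def intro: has_derivative_at_withinI)
  qed
next
  fix i x y assume i: "i \<in> imag_units" and q: "slice i (Complex x y) \<in> qball"
  let ?q = "slice i (Complex x y)"
  have comm: "?q * 1 = 1 * ?q" "?q * i = i * ?q" by (simp_all add: slice_alt algebra_simps)
  have "((\<lambda>t. f (slice i (Complex t y))) has_vector_derivative 1 * rps_eval (fps_deriv F) ?q) (at x)"
    by (rule vector_derivative_rps_eval[OF F eq q comm(1)])
      (auto simp: slice_alt intro!: derivative_eq_intros)
  moreover have "((\<lambda>t. f (slice i (Complex x t))) has_vector_derivative i * rps_eval (fps_deriv F) ?q) (at y)"
    by (rule vector_derivative_rps_eval[OF F eq q comm(2)])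
      (auto simp: slice_alt intro!: derivative_eq_intros)
  ultimately show "vector_derivative (\<lambda>t. f (slice i (Complex t y))) (at x) +
      i * vector_derivative (\<lambda>t. f (slice i (Complex x t))) (at y) = 0"
    by (simp add: vector_derivative_at mult.assoc[symmetric] imag_units_mult_self[OF i])
qed

text \<open>Each monomial satisfies the formula by \<open>slice_representation\<close>. As the
  coefficients stand on the right and the factors 1 - I i and 1 + I i on the left, the formula
  survives summation.\<close>

lemma rps_eval_representation:
  assumes F: "ball_convergent F" and i: "i \<in> imag_units" "I \<in> imag_units" and z: "norm z < 1"
  shows "rps_eval F (slice I z) = (1/2) *\<^sub>R
    ((1 - I * i) * rps_eval F (slice i z) + (1 + I * i) * rps_eval F (slice i (cnj z)))"
proof -
  have "(\<lambda>n. (1/2) *\<^sub>R ((1 - I * i) * (slice i z ^ n * fps_nth F n) + (1 + I * i) * (slice i (cnj z) ^ n * fps_nth F n)))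
    sums ((1/2) *\<^sub>R ((1 - I * i) * rps_eval F (slice i z) + (1 + I * i) * rps_eval F (slice i (cnj z))))"
    by (intro sums_scaleR_right sums_add sums_mult ball_convergent_sums F) (use i z in \<open>auto simp: norm_slice\<close>)
  also have "(\<lambda>n. (1/2) *\<^sub>R ((1 - I * i) * (slice i z ^ n * fps_nth F n) + (1 + I * i) * (slice i (cnj z) ^ n * fps_nth F n)))
    = (\<lambda>n. slice I z ^ n * fps_nth F n)"
  proof
    fix n
    have "slice I z ^ n = (1/2) *\<^sub>R ((1 - I * i) * slice i z ^ n + (1 + I * i) * slice i (cnj z) ^ n)"
      using slice_representation[OF i(1), of I "z ^ n"] i by (simp add: slice_power)
    then show "(1/2) *\<^sub>R ((1 - I * i) * (slice i z ^ n * fps_nth F n) + (1 + I * i) * (slice i (cnj z) ^ n * fps_nth F n)) = slice I z ^ n * fps_nth F n"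
      by (simp add: distrib_right mult.assoc scaleR_add_right)
  qed
  finally show ?thesis unfolding rps_eval_def[of F "slice I z"] by (rule sums_unique[symmetric])
qed

lemma norm_rps_eval_representation:
  assumes F: "ball_convergent F" and i: "i \<in> imag_units" "I \<in> imag_units" and z: "norm z < 1"
  shows "norm (rps_eval F (slice I z)) \<le> norm (rps_eval F (slice i z)) + norm (rps_eval F (slice i (cnj z)))"
proof -
  have I: "norm (I * i) = 1" using i by (simp add: norm_mult imag_units_norm)
  have n: "norm (1 - I * i) \<le> 2" "norm (1 + I * i) \<le> 2"
    using norm_triangle_ineq4[of 1 "I * i"] norm_triangle_ineq[of 1 "I * i"] I by simp_all
  have "norm (rps_eval F (slice I z)) \<le> (1/2) * (norm (1 - I * i) * norm (rps_eval F (slice i z))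
     + norm (1 + I * i) * norm (rps_eval F (slice i (cnj z))))"
    unfolding rps_eval_representation[OF assms] norm_scaleR norm_mult[symmetric]
    using norm_triangle_ineq by simp
  also have "\<dots> \<le> (1/2) * (2 * norm (rps_eval F (slice i z)) + 2 * norm (rps_eval F (slice i (cnj z))))"
    by (intro mult_left_mono add_mono mult_right_mono n) auto
  finally show ?thesis by simp
qed

text \<open>\<open>slice_extend\<close> is the representation formula read as a definition, so a
  series that agrees with \<open>g\<close> on one slice is the extension on the whole ball.\<close>

lemma slice_extend_rps_eval:
  assumes F: "ball_convergent F" and i: "i \<in> imag_units"
    and g: "\<And>z. norm z < 1 \<Longrightarrow> g (slice i z) = rps_eval F (slice i z)" and q: "q \<in> qball"
  shows "slice_extend i g q = rps_eval F q"
proof -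
  obtain I x y where I: "I \<in> imag_units" and qI: "q = slice I (Complex x y)" by (rule slice_decomp)
  have n: "norm (Complex x y) < 1" using q I qI by (simp add: norm_slice)
  then have n': "norm (Complex x (- y)) < 1" by (simp add: cmod_def)
  have "cnj (Complex x y) = Complex x (- y)" by (simp add: complex_eq_iff)
  then show ?thesis
    unfolding qI using slice_extend_slice[OF i I, of x y g] q qI rps_eval_representation[OF F i I n] g[OF n] g[OF n']
    by simp
qed

section \<open>Splitting along a slice\<close>

text \<open>The orthogonal projection onto the slice of \<open>i\<close>, read as a complex number:
  for an imaginary unit \<open>i\<close>, \<open>- Re0 (i * q)\<close> is the inner product of
  \<open>i\<close> and \<open>q\<close>.\<close>

definition slice_coord :: "quat \<Rightarrow> quat \<Rightarrow> complex" where
  "slice_coord i q = Complex (Re0 q) (- Re0 (i * q))"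

lemma bounded_linear_slice_coord: "bounded_linear (slice_coord i)"
proof -
  have "linear (slice_coord i)"
    by (rule linearI) (simp_all add: slice_coord_def complex_eq_iff algebra_simps)
  then show ?thesis by (rule linear_conv_bounded_linear[THEN iffD1])
qed

lemma Re0_slice: "i \<in> imag_units \<Longrightarrow> Re0 (slice i z) = Re z"
  by (simp add: slice_alt imag_units_Re0)

lemma slice_coord_slice: "i \<in> imag_units \<Longrightarrow> slice_coord i (slice i z) = z"
  by (simp add: slice_coord_def slice_mult[of i \<i>, simplified, symmetric] Re0_slice complex_eq_iff del: times_quat.sel)

text \<open>Complex linearity for left multiplication. It turns slice regularity into complex
  differentiability of the components.\<close>

lemma slice_coord_mult:
  assumes "i \<in> imag_units"
  shows "slice_coord i (slice i z * q) = z * slice_coord i q"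
proof -
  have "i * (i * q) = - q" for q by (simp add: mult.assoc[symmetric] imag_units_mult_self[OF assms])
  then show ?thesis
    by (simp add: slice_coord_def slice_alt complex_eq_iff distrib_left distrib_right del: times_quat.sel)
qed

lemma norm_Re0_le: "\<bar>Re0 q\<bar> \<le> norm q"
  using abs_le_square_iff[of "Re0 q" "norm q"] by (simp add: norm_quat_def)

lemma norm_slice_coord_le:
  assumes "i \<in> imag_units"
  shows "norm (slice_coord i q) \<le> 2 * norm q"
  using norm_Re0_le[of q] norm_Re0_le[of "i * q"] cmod_le[of "slice_coord i q"] imag_units_norm[OF assms]
  by (simp add: slice_coord_def norm_mult del: times_quat.sel)

text \<open>The map q -> - i q i fixes the slice and negates its orthogonal complement, so its
  average with the identity is the projection.\<close>

lemma slice_slice_coord: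
  assumes "i \<in> imag_units"
  shows "slice i (slice_coord i q) = (1/2) *\<^sub>R (q - i * q * i)"
proof -
  have 0: "Re0 i = 0" using assms by (rule imag_units_Re0)
  have "(norm i)\<^sup>2 = 1" using imag_units_norm[OF assms] by simp
  then have 1: "Im1 i * Im1 i + Im2 i * Im2 i + Im3 i * Im3 i = 1"
    using 0 by (simp add: norm_quat_def power2_eq_square)
  show ?thesis
    apply (simp add: quat_eq_iff slice_alt slice_coord_def 0)
    using 1 apply (intro conjI; algebra)
    done
qed

text \<open>Orthogonal imaginary quaternions anticommute. The vector with coordinates Im2 i, - Im1
  i, 0 is orthogonal to \<open>i\<close> and vanishes only if \<open>i\<close> is plus or minus the
  third unit, for which the first unit serves.\<close>

lemma anticommuting_unit_exists:
  assumes "i \<in> imag_units"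
  obtains j where "j \<in> imag_units" "i * j = - (j * i)"
proof (cases "Im1 i = 0 \<and> Im2 i = 0")
  case True
  then have "i * Quat 0 1 0 0 = - (Quat 0 1 0 0 * i)"
    using imag_units_Re0[OF assms] by (simp add: quat_eq_iff)
  moreover have "Quat 0 1 0 0 \<in> imag_units" by (simp add: imag_units_iff norm_quat_def)
  ultimately show ?thesis by (rule that[rotated])
next
  case False
  define v where "v = Quat 0 (Im2 i) (- Im1 i) 0"
  have v: "v \<noteq> 0" using False by (auto simp: v_def quat_eq_iff)
  have iv: "i * v = - (v * i)"
    using imag_units_Re0[OF assms] by (simp add: quat_eq_iff v_def)
  have "i * sgn v = - (sgn v * i)" using iv by (simp add: sgn_div_norm)
  moreover have "sgn v \<in> imag_units"
    using v by (simp add: imag_units_iff norm_sgn) (simp add: sgn_div_norm v_def)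
  ultimately show ?thesis by (rule that[rotated])
qed

text \<open>If q = A + B j, then - q j = B - A j, and A j is orthogonal to the slice. Hence B is the
  projection of - q j.\<close>

lemma slice_coord_decomposition:
  assumes i: "i \<in> imag_units" and j: "j \<in> imag_units" and ij: "i * j = - (j * i)"
  shows "q = slice i (slice_coord i q) + slice i (slice_coord i (- (q * j))) * j"
proof -
  have "(q - i * q * i) + (- (q * j) - i * (- (q * j)) * i) * j = 2 *\<^sub>R q"
  proof -
    have "- (q * j) * j = q" using imag_units_mult_self[OF j] by (simp add: mult.assoc)
    moreover have "i * (- (q * j)) * i * j = - (i * q * i)"
    proof -
      have "i * (- (q * j)) * i * j = - (i * q * j * (i * j))" by (simp add: mult.assoc)
      also have "\<dots> = i * q * (j * j) * i" by (simp add: ij mult.assoc)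
      finally show ?thesis by (simp add: imag_units_mult_self[OF j])
    qed
    ultimately show ?thesis by (simp add: left_diff_distrib scaleR_2)
  qed
  then show ?thesis
    by (simp add: slice_slice_coord[OF i] scaleR_add_right[symmetric])
qed

text \<open>For the Frechet derivative L at the point, slice regularity reads L 1 + i L i = 0, that
  is L i = i L 1. So L restricted to the slice is left multiplication of L 1 by the
  increment.\<close>

lemma slice_regular_has_derivative_slice:
  assumes f: "slice_regular f" and i: "i \<in> imag_units" and z: "norm z < 1"
  shows "((\<lambda>w. f (slice i w)) has_derivative (\<lambda>h. slice i h * deriv_x0 f (slice i z))) (at z)"
proof -
  define q where "q = slice i z"
  have q: "q \<in> qball" using z i by (simp add: q_def norm_slice)
  have "f differentiable (at q)"
    using f q by (auto simp: slice_regular_def differentiable_on_def at_within_open[OF _ open_ball])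
  then obtain L where L: "(f has_derivative L) (at q)" unfolding differentiable_def by blast
  have "linear L" using L by (rule has_derivative_linear)
  have line: "((\<lambda>t. f (\<gamma> t)) has_vector_derivative L v) (at s)"
    if "(\<gamma> has_vector_derivative v) (at s)" "\<gamma> s = q" for \<gamma> :: "real \<Rightarrow> quat" and v s
    using vector_derivative_diff_chain_within[OF that(1), of f L] L that(2)
    by (auto simp: o_def intro: has_derivative_at_withinI)
  have d0: "deriv_x0 f q = L 1"
    unfolding deriv_x0_def
    by (rule vector_derivative_at, rule line) (auto simp: of_real_def intro!: derivative_eq_intros)
  have "((\<lambda>t. f (slice i (Complex t (Im z)))) has_vector_derivative L 1) (at (Re z))"
    by (rule line) (auto simp: slice_alt q_def intro!: derivative_eq_intros)
  moreover have "((\<lambda>t. f (slice i (Complex (Re z) t))) has_vector_derivative L i) (at (Im z))"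
    by (rule line) (auto simp: slice_alt q_def intro!: derivative_eq_intros)
  moreover have "slice i (Complex (Re z) (Im z)) \<in> qball" using q by (simp add: q_def)
  ultimately have "L 1 + i * L i = 0"
    using f i unfolding slice_regular_def by (metis vector_derivative_at)
  then have "i * L 1 + (i * i) * L i = 0"
    by (metis distrib_left mult.assoc mult_zero_right)
  then have Li: "L i = i * L 1" by (simp add: imag_units_mult_self[OF i])
  have "((\<lambda>w. f (slice i w)) has_derivative (\<lambda>h. L (slice i h))) (at z)"
    using has_derivative_compose[OF bounded_linear_imp_has_derivative[OF bounded_linear_slice] L[unfolded q_def]] .
  also have "(\<lambda>h. L (slice i h)) = (\<lambda>h. slice i h * deriv_x0 f q)"
    by (rule ext) (simp add: slice_alt linear_add[OF \<open>linear L\<close>] linear_scale[OF \<open>linear L\<close>] Li d0 distrib_right)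
  finally show ?thesis by (simp add: q_def)
qed

lemma slice_coord_has_field_derivative:
  assumes f: "slice_regular f" and i: "i \<in> imag_units" and z: "norm z < 1"
  shows "((\<lambda>w. slice_coord i (f (slice i w) * c)) has_field_derivative slice_coord i (deriv_x0 f (slice i z) * c)) (at z)"
proof -
  have "bounded_linear (\<lambda>q. slice_coord i (q * c))"
    by (rule bounded_linear_compose[OF bounded_linear_slice_coord bounded_linear_mult_left])
  from bounded_linear.has_derivative[OF this slice_regular_has_derivative_slice[OF assms]]
  have "((\<lambda>w. slice_coord i (f (slice i w) * c)) has_derivative
      (\<lambda>h. h * slice_coord i (deriv_x0 f (slice i z) * c))) (at z)"
    by (simp add: mult.assoc slice_coord_mult[OF i])
  also have "(\<lambda>h. h * slice_coord i (deriv_x0 f (slice i z) * c)) = (*) (slice_coord i (deriv_x0 f (slice i z) * c))"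
    by (rule ext) (rule mult.commute)
  finally show ?thesis unfolding has_field_derivative_def .
qed

lemma slice_coord_holomorphic:
  assumes f: "slice_regular f" and i: "i \<in> imag_units"
  shows "(\<lambda>w. slice_coord i (f (slice i w) * c)) holomorphic_on ball 0 1"
  using slice_coord_has_field_derivative[OF f i]
  unfolding holomorphic_on_open[OF open_ball] by (metis dist_0_norm mem_ball)

text \<open>Converse of the splitting: the coefficients are a_n + b_n j with the Taylor coefficients
  of \<open>A\<close> and \<open>B\<close>. Powers of \<open>slice i z\<close> commute with the
  slice, hence can be moved to the left, where \<open>rps_eval\<close> has them.\<close>

lemma rps_eval_of_holomorphic_pair:
  assumes i: "i \<in> imag_units"
    and A: "A holomorphic_on ball 0 1" and B: "B holomorphic_on ball 0 1"
  obtains F where "ball_convergent F"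
    "\<And>z. norm z < 1 \<Longrightarrow> rps_eval F (slice i z) = slice i (A z) + slice i (B z) * j"
proof
  define a where "a = (\<lambda>n. (deriv ^^ n) A 0 / fact n)"
  define b where "b = (\<lambda>n. (deriv ^^ n) B 0 / fact n)"
  define F where "F = Abs_fps (\<lambda>n. slice i (a n) + slice i (b n) * j)"
  have a: "(\<lambda>n. a n * z ^ n) sums A z" and b: "(\<lambda>n. b n * z ^ n) sums B z" if "norm z < 1" for z
    using holomorphic_power_series[OF A, of z] holomorphic_power_series[OF B, of z] that
    by (simp_all add: a_def b_def)
  show "ball_convergent F"
    unfolding ball_convergent_def
  proof (intro allI impI)
    fix r :: real assume r: "0 \<le> r \<and> r < 1"
    define s where "s = complex_of_real ((1 + r) / 2)"
    have s: "norm s < 1" "norm (complex_of_real r) < norm s"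
      using r unfolding s_def norm_of_real by simp_all
    have "summable (\<lambda>n. norm (a n * of_real r ^ n))" "summable (\<lambda>n. norm (b n * of_real r ^ n))"
      using powser_insidea[OF sums_summable[OF a[OF s(1)]] s(2)] powser_insidea[OF sums_summable[OF b[OF s(1)]] s(2)] by auto
    then have "summable (\<lambda>n. norm (a n) * r ^ n + norm (b n) * norm j * r ^ n)"
      using r summable_mult2[of "\<lambda>n. norm (b n) * r ^ n" "norm j"]
      by (intro summable_add) (simp_all add: norm_mult norm_power mult_ac)
    then show "summable (\<lambda>n. norm (fps_nth F n) * r ^ n)"
    proof (rule summable_comparison_test'[where N = 0])
      fix n
      have "norm (fps_nth F n) \<le> norm (a n) + norm (b n) * norm j"
        unfolding F_def by (simp add: norm_slice[OF i] norm_triangle_le norm_mult)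
      from mult_right_mono[OF this, of "r ^ n"]
      show "norm (norm (fps_nth F n) * r ^ n) \<le> norm (a n) * r ^ n + norm (b n) * norm j * r ^ n"
        using r by (simp add: distrib_right)
    qed
  qed
  fix z :: complex assume z: "norm z < 1"
  have "(\<lambda>n. slice i (a n * z ^ n) + slice i (b n * z ^ n) * j) sums (slice i (A z) + slice i (B z) * j)"
    by (intro sums_add sums_mult2 bounded_linear.sums[OF bounded_linear_slice] a b z)
  moreover have "slice i (a n * z ^ n) + slice i (b n * z ^ n) * j = slice i z ^ n * fps_nth F n" for n
    by (simp add: F_def slice_mult[OF i] slice_power[OF i] distrib_left mult.assoc[symmetric] mult.commute[of _ "z ^ n"])
  ultimately show "rps_eval F (slice i z) = slice i (A z) + slice i (B z) * j"
    unfolding rps_eval_def by (simp add: sums_iff)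
qed


section \<open>Composition operators through a holomorphic self-map of the disc\<close>

lemma slice_preserving_map:
  assumes \<Phi>: "slice_regular \<Phi>" and i: "i \<in> imag_units" and im: "\<Phi> ` slice_ball i \<subseteq> slice_ball i"
  obtains \<phi> where "\<phi> holomorphic_on ball 0 1" "\<And>z. norm z < 1 \<Longrightarrow> norm (\<phi> z) < 1"
    "\<And>z. norm z < 1 \<Longrightarrow> \<Phi> (slice i z) = slice i (\<phi> z)"
proof
  \<comment> \<open>The factor \<open>1\<close> is the instance \<open>c = 1\<close> of the
    component lemmas, which carry a right factor \<open>c\<close>.\<close>
  define \<phi> where "\<phi> = (\<lambda>z. slice_coord i (\<Phi> (slice i z) * 1))"
  show "\<phi> holomorphic_on ball 0 1" unfolding \<phi>_def by (rule slice_coord_holomorphic[OF \<Phi> i])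
  have *: "\<Phi> (slice i z) = slice i (\<phi> z) \<and> norm (\<phi> z) < 1" if "norm z < 1" for z
  proof -
    have "\<Phi> (slice i z) \<in> slice_ball i" using im slice_in_slice_ball[OF i, of z] that by blast
    then obtain w where "\<Phi> (slice i z) = slice i w" "norm w < 1" using i by (rule slice_ball_cases)
    then show ?thesis by (simp add: \<phi>_def slice_coord_slice[OF i])
  qed
  show "norm z < 1 \<Longrightarrow> norm (\<phi> z) < 1" "norm z < 1 \<Longrightarrow> \<Phi> (slice i z) = slice i (\<phi> z)" for z
    using * by blast+
qed

text \<open>On the slice of \<open>i\<close> the components of the composite are those of
  \<open>f\<close> composed with \<phi>, hence holomorphic. Their series agrees with f o \<Phi> on
  the slice and therefore with \<open>slice_extend\<close> on the ball.\<close>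

lemma comp_op_power_series:
  assumes f: "slice_regular f" and i: "i \<in> imag_units"
    and \<phi>: "\<phi> holomorphic_on ball 0 1" "\<And>z. norm z < 1 \<Longrightarrow> norm (\<phi> z) < 1"
    and \<Phi>: "\<And>z. norm z < 1 \<Longrightarrow> \<Phi> (slice i z) = slice i (\<phi> z)"
  obtains F where "ball_convergent F" "\<And>q. q \<in> qball \<Longrightarrow> comp_op i \<Phi> f q = rps_eval F q"
proof -
  obtain j where j: "j \<in> imag_units" "i * j = - (j * i)" using anticommuting_unit_exists[OF i] .
  have im: "\<phi> ` ball 0 1 \<subseteq> ball 0 1" using \<phi>(2) by auto
  have "(\<lambda>z. slice_coord i (f (slice i (\<phi> z)) * c)) holomorphic_on ball 0 1" for c
    using holomorphic_on_compose_gen[OF \<phi>(1) slice_coord_holomorphic[OF f i] im] by (simp add: o_def)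
  \<comment> \<open>The right factors \<open>1\<close> and \<open>- j\<close> pick out the two
    components of \<open>slice_coord_decomposition\<close>.\<close>
  from rps_eval_of_holomorphic_pair[OF i this this, of 1 "- j" j]
  obtain F where F: "ball_convergent F" "\<And>z. norm z < 1 \<Longrightarrow> rps_eval F (slice i z) =
      slice i (slice_coord i (f (slice i (\<phi> z)) * 1)) + slice i (slice_coord i (f (slice i (\<phi> z)) * (- j))) * j"
    by blast
  have "rps_eval F (slice i z) = (f \<circ> \<Phi>) (slice i z)" if "norm z < 1" for z
    using F(2)[OF that] slice_coord_decomposition[OF i j, of "f (slice i (\<phi> z))"] \<Phi>[OF that] by simp
  then have "comp_op i \<Phi> f q = rps_eval F q" if "q \<in> qball" for q
    unfolding comp_op_def using slice_extend_rps_eval[OF F(1) i _ that] by simp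
  with F(1) show ?thesis by (rule that)
qed

lemma comp_op_SR:
  assumes "slice_regular f" and "i \<in> imag_units"
    and "\<phi> holomorphic_on ball 0 1" "\<And>z. norm z < 1 \<Longrightarrow> norm (\<phi> z) < 1"
    and "\<And>z. norm z < 1 \<Longrightarrow> \<Phi> (slice i z) = slice i (\<phi> z)"
  shows "comp_op i \<Phi> f \<in> SR"
proof -
  obtain F where "ball_convergent F" "\<And>q. q \<in> qball \<Longrightarrow> comp_op i \<Phi> f q = rps_eval F q"
    using comp_op_power_series[OF assms] by blast
  then have "slice_regular (comp_op i \<Phi> f)" by (rule slice_regular_rps_eval)
  then show ?thesis by (simp add: SR_def comp_op_def slice_extend_def)
qed

lemma comp_op_slice:
  assumes "i \<in> imag_units" "norm z < 1" "\<Phi> (slice i z) = slice i w"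
  shows "comp_op i \<Phi> f (slice i z) = f (slice i w)"
  using assms slice_extend_self[of i "slice i z" "f \<circ> \<Phi>"] slice_in_slice_ball[OF assms(1), of z]
  by (simp add: comp_op_def)

text \<open>Both sides come from Frechet derivatives of the same map of z, one from regularity of
  the composite and one from the chain rule; uniqueness is evaluated in the direction 1.\<close>

lemma deriv_x0_comp_op:
  assumes f: "slice_regular f" and i: "i \<in> imag_units"
    and \<phi>: "\<phi> holomorphic_on ball 0 1" "\<And>z. norm z < 1 \<Longrightarrow> norm (\<phi> z) < 1"
    and \<Phi>: "\<And>z. norm z < 1 \<Longrightarrow> \<Phi> (slice i z) = slice i (\<phi> z)" and z: "norm z < 1"
  shows "deriv_x0 (comp_op i \<Phi> f) (slice i z) = slice i (deriv \<phi> z) * deriv_x0 f (slice i (\<phi> z))"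
proof -
  let ?g = "\<lambda>w. comp_op i \<Phi> f (slice i w)"
  have "slice_regular (comp_op i \<Phi> f)" using comp_op_SR[OF f i \<phi> \<Phi>] by (simp add: SR_def)
  then have 1: "(?g has_derivative (\<lambda>h. slice i h * deriv_x0 (comp_op i \<Phi> f) (slice i z))) (at z)"
    using i z by (rule slice_regular_has_derivative_slice)
  have "(\<phi> has_field_derivative deriv \<phi> z) (at z)"
    using \<phi>(1) z by (intro holomorphic_derivI[OF _ open_ball]) auto
  then have "(\<phi> has_derivative (\<lambda>h. deriv \<phi> z * h)) (at z)" by (simp add: has_field_derivative_def)
  from has_derivative_compose[OF this slice_regular_has_derivative_slice[OF f i \<phi>(2)[OF z]]]
  have "((\<lambda>w. f (slice i (\<phi> w))) has_derivative (\<lambda>h. slice i (deriv \<phi> z * h) * deriv_x0 f (slice i (\<phi> z)))) (at z)" .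
  then have "(?g has_derivative (\<lambda>h. slice i (deriv \<phi> z * h) * deriv_x0 f (slice i (\<phi> z)))) (at z)"
    by (rule has_derivative_transform_within_open[OF _ open_ball[of 0 1]])
      (use z in \<open>auto simp: comp_op_slice[OF i] \<Phi>\<close>)
  from fun_cong[OF has_derivative_unique[OF 1 this], of 1] show ?thesis by simp
qed

section \<open>Estimates for the Bloch seminorm\<close>

lemma bloch_seminorm_ge:
  assumes "i \<in> imag_units" "norm z < 1"
  shows "ennreal ((1 - (norm z)\<^sup>2) * norm (deriv_x0 f (slice i z))) \<le> bloch_seminorm f"
  unfolding bloch_seminorm_def
  by (intro SUP_upper2[OF assms(1)] SUP_upper2[of "slice i z"])
    (use assms in \<open>auto simp: slice_in_slice_ball norm_slice\<close>)

lemma ball_convergent_diff: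
  assumes "ball_convergent F" "ball_convergent G"
  shows "ball_convergent (F - G)"
  unfolding ball_convergent_def
proof (intro allI impI)
  fix r :: real assume r: "0 \<le> r \<and> r < 1"
  then have "summable (\<lambda>n. norm (fps_nth F n) * r ^ n + norm (fps_nth G n) * r ^ n)"
    using assms by (intro summable_add) (auto simp: ball_convergent_def)
  then show "summable (\<lambda>n. norm (fps_nth (F - G) n) * r ^ n)"
    by (rule summable_comparison_test'[where N = 0])
      (use r in \<open>simp add: distrib_right[symmetric] mult_right_mono norm_triangle_ineq4\<close>)
qed

lemma rps_eval_diff:
  assumes "ball_convergent F" "ball_convergent G" "q \<in> qball"
  shows "rps_eval (F - G) q = rps_eval F q - rps_eval G q"
proof -
  have "(\<lambda>n. q ^ n * fps_nth F n - q ^ n * fps_nth G n) sums (rps_eval F q - rps_eval G q)"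
    by (intro sums_diff ball_convergent_sums assms)
  then show ?thesis unfolding rps_eval_def[of "F - G"] by (simp add: right_diff_distrib sums_iff)
qed

text \<open>By the representation formula, a bound on one slice costs only a factor two on the ball.\<close>

lemma bloch_seminorm_le:
  assumes F: "ball_convergent F" "\<And>q. q \<in> qball \<Longrightarrow> f q = rps_eval F q" and i: "i \<in> imag_units"
    and K: "\<And>z. norm z < 1 \<Longrightarrow> (1 - (norm z)\<^sup>2) * norm (deriv_x0 f (slice i z)) \<le> K"
  shows "bloch_seminorm f \<le> ennreal (2 * K)"
  unfolding bloch_seminorm_def
proof (intro SUP_least)
  fix I q assume I: "I \<in> imag_units" and "q \<in> slice_ball I"
  then obtain z where q: "q = slice I z" and z: "norm z < 1" using slice_ball_cases by metis
  let ?D = "\<lambda>q. norm (rps_eval (fps_deriv F) q)"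
  have eq: "deriv_x0 f (slice J w) = rps_eval (fps_deriv F) (slice J w)" if "J \<in> imag_units" "norm w < 1" for J w
    using that by (intro deriv_x0_rps_eval F) (simp_all add: norm_slice)
  have "0 \<le> 1 - (norm z)\<^sup>2" using z by (simp add: power_le_one)
  then have "(1 - (norm z)\<^sup>2) * ?D q \<le> (1 - (norm z)\<^sup>2) * (?D (slice i z) + ?D (slice i (cnj z)))"
    unfolding q by (intro mult_left_mono norm_rps_eval_representation ball_convergent_deriv F i I z)
  also have "\<dots> \<le> K + K"
    using K[OF z] K[of "cnj z"] eq[OF i, of z] eq[OF i, of "cnj z"] z by (simp add: distrib_left)
  finally show "ennreal ((1 - (norm q)\<^sup>2) * norm (deriv_x0 f q)) \<le> ennreal (2 * K)"
    using eq[OF I z] by (intro ennreal_leI) (simp add: q norm_slice[OF I])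
qed

section \<open>Area integrals in the complex plane\<close>

text \<open>The change of variables theorem used below is stated on real vectors with a Jacobian
  determinant; this identification carries it to the complex plane.\<close>

definition complex_of_vec :: "real^2 \<Rightarrow> complex" where
  "complex_of_vec v = Complex (v $ 1) (v $ 2)"

definition vec_of_complex :: "complex \<Rightarrow> real^2" where
  "vec_of_complex z = vector [Re z, Im z]"

lemma complex_of_vec_inverse [simp]: "vec_of_complex (complex_of_vec v) = v"
  and vec_of_complex_inverse [simp]: "complex_of_vec (vec_of_complex z) = z"
  by (simp_all add: complex_of_vec_def vec_of_complex_def vec_eq_iff forall_2)

lemma bounded_linear_complex_of_vec: "bounded_linear complex_of_vec"
proof -
  have "linear complex_of_vec"
    by (rule linearI) (simp_all add: complex_of_vec_def complex_eq_iff)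
  then show ?thesis by (rule linear_conv_bounded_linear[THEN iffD1])
qed

lemma bounded_linear_vec_of_complex: "bounded_linear vec_of_complex"
proof -
  have "linear vec_of_complex"
    by (rule linearI) (simp_all add: vec_of_complex_def vec_eq_iff forall_2)
  then show ?thesis by (rule linear_conv_bounded_linear[THEN iffD1])
qed

lemma measurable_complex_of_vec [measurable]: "complex_of_vec \<in> borel_measurable borel"
  by (intro borel_measurable_continuous_onI linear_continuous_on bounded_linear_complex_of_vec)

lemma lborel_complex_of_vec: "lborel = distr (lborel :: (real^2) measure) borel complex_of_vec"
proof (rule lborel_eqI)
  fix l u :: complex assume le: "\<And>b. b \<in> Basis \<Longrightarrow> l \<bullet> b \<le> u \<bullet> b"
  have lu: "Re l \<le> Re u" "Im l \<le> Im u"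
    using le[of 1] le[of \<i>] by (simp_all add: Basis_complex_def)
  let ?l = "vec_of_complex l" and ?u = "vec_of_complex u"
  have "?l \<in> cbox ?l ?u" using lu by (simp add: mem_box_cart forall_2 vec_of_complex_def)
  then have ne: "cbox ?l ?u \<noteq> {}" by blast
  have le: "?l \<bullet> b \<le> ?u \<bullet> b" if "b \<in> Basis" for b
    using ne that box_ne_empty(1) by blast
  have "complex_of_vec -` box l u \<inter> space lborel = box ?l ?u"
    by (auto simp: mem_box_cart forall_2 in_box_complex_iff complex_of_vec_def vec_of_complex_def)
  then have "emeasure (distr (lborel :: (real^2) measure) borel complex_of_vec) (box l u) = emeasure lborel (box ?l ?u)"
    by (simp add: emeasure_distr)
  also have "\<dots> = ennreal (measure lborel (cbox ?l ?u))"
    using le by (simp add: emeasure_lborel_box content_cbox'[OF ne] inner_diff_left)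
  also have "measure lborel (cbox ?l ?u) = (Re u - Re l) * (Im u - Im l)"
    unfolding content_cbox_cart[OF ne] by (simp add: UNIV_2 vec_of_complex_def)
  also have "\<dots> = (\<Prod>b\<in>Basis. (u - l) \<bullet> b)"
    by (simp add: Basis_complex_def)
  finally show "emeasure (distr (lborel :: (real^2) measure) borel complex_of_vec) (box l u) = ennreal (\<Prod>b\<in>Basis. (u - l) \<bullet> b)" .
qed simp

lemma nn_integral_complex_of_vec:
  assumes [measurable]: "f \<in> borel_measurable borel"
  shows "(\<integral>\<^sup>+ z. f z \<partial>lborel) = (\<integral>\<^sup>+ v. f (complex_of_vec v) \<partial>lborel)"
  by (subst lborel_complex_of_vec, subst nn_integral_distr) auto

text \<open>Includes the divergent case, so that the substitution rule holds in
  \<open>ennreal\<close> without any integrability assumption.\<close>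

lemma nn_integral_set_eq_integral:
  fixes f :: "'a::euclidean_space \<Rightarrow> real"
  assumes [measurable]: "(\<lambda>x. indicator S x * f x) \<in> borel_measurable borel" and f: "\<And>x. x \<in> S \<Longrightarrow> 0 \<le> f x"
  shows "(\<integral>\<^sup>+x\<in>S. ennreal (f x) \<partial>lborel) = (if f absolutely_integrable_on S then ennreal (integral S f) else \<infinity>)"
proof -
  let ?h = "\<lambda>x. indicator S x * f x"
  have h0: "0 \<le> ?h x" for x using f by (auto simp: indicator_def)
  have eq: "(\<integral>\<^sup>+x\<in>S. ennreal (f x) \<partial>lborel) = (\<integral>\<^sup>+x. ennreal (?h x) \<partial>lebesgue)"
    unfolding nn_integral_completion by (intro nn_integral_cong) (auto simp: indicator_def)
  show ?thesis
  proof (cases "f absolutely_integrable_on S")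
    case True
    then have i: "integrable lebesgue ?h" by (simp add: set_integrable_def)
    have "(\<integral>\<^sup>+x. ennreal (?h x) \<partial>lebesgue) = ennreal (integral\<^sup>L lebesgue ?h)"
      by (rule nn_integral_eq_integral[OF i]) (simp add: h0)
    also have "integral\<^sup>L lebesgue ?h = integral S f"
      using set_lebesgue_integral_eq_integral(2)[OF True] by (simp add: set_lebesgue_integral_def)
    finally show ?thesis using True eq by simp
  next
    case False
    have "(\<integral>\<^sup>+x. ennreal (?h x) \<partial>lebesgue) = \<infinity>"
    proof (rule ccontr)
      assume "\<not> ?thesis"
      then have "integrable lebesgue ?h"
        using h0 by (intro integrableI_nonneg measurable_completion) (auto simp: less_top)
      with False show False by (simp add: set_integrable_def)
    qed
    with False eq show ?thesis by simp
  qed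
qed

text \<open>The real Jacobian of a holomorphic map is |g'|^2, the determinant of multiplication by
  g'.\<close>

lemma nn_integral_holomorphic_substitution:
  fixes f :: "complex \<Rightarrow> real"
  assumes D: "open D" and g: "g holomorphic_on D" and inj: "inj_on g D"
    and [measurable]: "f \<in> borel_measurable borel" and f: "\<And>w. w \<in> g ` D \<Longrightarrow> 0 \<le> f w"
  shows "(\<integral>\<^sup>+z\<in>D. ennreal ((cmod (deriv g z))\<^sup>2 * f (g z)) \<partial>lborel) = (\<integral>\<^sup>+w\<in>g ` D. ennreal (f w) \<partial>lborel)"
proof -
  let ?T = complex_of_vec and ?U = vec_of_complex
  define S where "S = ?T -` D"
  define G where "G = (\<lambda>x. ?U (g (?T x)))"
  define G' where "G' = (\<lambda>x h. ?U (deriv g (?T x) * ?T h))"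
  have gD: "open (g ` D)" using open_mapping_thm3[OF g D inj] .
  have S: "open S" unfolding S_def
    by (intro open_vimage D linear_continuous_on bounded_linear_complex_of_vec)
  have GS: "G ` S = ?T -` (g ` D)"
  proof (intro set_eqI iffI)
    fix x assume "x \<in> ?T -` (g ` D)"
    then obtain z where "z \<in> D" "?T x = g z" by auto
    then have "?U z \<in> S" "G (?U z) = x" by (simp_all add: S_def G_def) (metis complex_of_vec_inverse)
    then show "x \<in> G ` S" by blast
  qed (auto simp: G_def S_def)
  have GSo: "open (G ` S)" unfolding GS
    by (intro open_vimage gD linear_continuous_on bounded_linear_complex_of_vec)
  have der: "(G has_derivative G' x) (at x within S)" if "x \<in> S" for x
  proof -
    have "(g has_field_derivative deriv g (?T x)) (at (?T x))"
      using that by (intro holomorphic_derivI[OF g D]) (auto simp: S_def)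
    then have "(g has_derivative (*) (deriv g (?T x))) (at (?T x))" by (simp add: has_field_derivative_def)
    from has_derivative_compose[OF bounded_linear_imp_has_derivative[OF bounded_linear_complex_of_vec] this]
    have "((\<lambda>x. g (?T x)) has_derivative (\<lambda>h. deriv g (?T x) * ?T h)) (at x within S)" .
    from bounded_linear.has_derivative[OF bounded_linear_vec_of_complex this]
    show ?thesis by (simp add: G_def[abs_def] G'_def)
  qed
  have det: "\<bar>det (matrix (G' x))\<bar> = (cmod (deriv g (?T x)))\<^sup>2" for x
    by (simp add: det_2 matrix_def G'_def vec_of_complex_def complex_of_vec_def axis_def cmod_power2)
      (simp add: power2_eq_square)
  have injG: "inj_on G S"
    using inj unfolding inj_on_def G_def S_def by (metis complex_of_vec_inverse vec_of_complex_inverse vimageE)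
  \<comment> \<open>Nothing is known about \<open>g\<close> and its derivative off \<open>D\<close>;
    cutting off by the indicator gives Borel functions on the whole plane.\<close>
  have gm: "(\<lambda>z. indicator D z *\<^sub>R g z) \<in> borel_measurable borel"
    by (intro borel_measurable_continuous_on_indicator holomorphic_on_imp_continuous_on g) (use D in auto)
  have dm: "(\<lambda>z. indicator D z *\<^sub>R deriv g z) \<in> borel_measurable borel"
    by (intro borel_measurable_continuous_on_indicator holomorphic_on_imp_continuous_on holomorphic_deriv g D) (use D in auto)
  have [measurable]: "D \<in> sets borel" "g ` D \<in> sets borel" "S \<in> sets borel" "G ` S \<in> sets borel"
    using D gD S GSo by auto
  have "(\<lambda>z. indicator D z * ((cmod (indicator D z *\<^sub>R deriv g z))\<^sup>2 * f (indicator D z *\<^sub>R g z))) \<in> borel_measurable borel"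
    using gm dm by measurable
  also have "(\<lambda>z. indicator D z * ((cmod (indicator D z *\<^sub>R deriv g z))\<^sup>2 * f (indicator D z *\<^sub>R g z)))
     = (\<lambda>z. indicator D z * ((cmod (deriv g z))\<^sup>2 * f (g z)))"
    by (auto simp: indicator_def)
  finally have lm [measurable]: "(\<lambda>z. indicator D z * ((cmod (deriv g z))\<^sup>2 * f (g z))) \<in> borel_measurable borel" .
  let ?L = "\<lambda>x. (cmod (deriv g (?T x)))\<^sup>2 * f (g (?T x))" and ?R = "\<lambda>x. f (?T x)"
  have "(\<integral>\<^sup>+z\<in>D. ennreal ((cmod (deriv g z))\<^sup>2 * f (g z)) \<partial>lborel)
      = (\<integral>\<^sup>+z. ennreal (indicator D z * ((cmod (deriv g z))\<^sup>2 * f (g z))) \<partial>lborel)"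
    by (intro nn_integral_cong) (auto simp: indicator_def)
  also have "\<dots> = (\<integral>\<^sup>+x. ennreal (indicator D (?T x) * ?L x) \<partial>lborel)"
    by (rule nn_integral_complex_of_vec) measurable
  also have "\<dots> = (\<integral>\<^sup>+x\<in>S. ennreal (?L x) \<partial>lborel)"
    by (intro nn_integral_cong) (auto simp: indicator_def S_def)
  also have "\<dots> = (if ?L absolutely_integrable_on S then ennreal (integral S ?L) else \<infinity>)"
  proof (rule nn_integral_set_eq_integral)
    have "(\<lambda>x. indicator S x * ?L x) = (\<lambda>x. indicator D (?T x) * ?L x)" by (auto simp: S_def indicator_def)
    also have "\<dots> \<in> borel_measurable borel"
      using measurable_compose[OF measurable_complex_of_vec lm] by simp
    finally show "(\<lambda>x. indicator S x * ?L x) \<in> borel_measurable borel" .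
  qed (use f in \<open>auto simp: S_def\<close>)
  also have "\<dots> = (if ?R absolutely_integrable_on G ` S then ennreal (integral (G ` S) ?R) else \<infinity>)"
  proof -
    \<comment> \<open>The theorem is for vector-valued functions, hence the detour through
      \<open>real^1\<close>. Being an equivalence for every value \<open>b\<close>, it transfers
      integrability and value in both directions.\<close>
    have "(\<lambda>x. \<bar>det (matrix (G' x))\<bar> *\<^sub>R (vec (?R (G x)) :: real^1)) absolutely_integrable_on S \<and>
        integral S (\<lambda>x. \<bar>det (matrix (G' x))\<bar> *\<^sub>R (vec (?R (G x)) :: real^1)) = vec b \<longleftrightarrow>
        (\<lambda>x. vec (?R x) :: real^1) absolutely_integrable_on (G ` S) \<and> integral (G ` S) (\<lambda>x. vec (?R x) :: real^1) = vec b" for b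
      using S by (intro has_absolute_integral_change_of_variables der injG) auto
    then have eq: "?L absolutely_integrable_on S \<and> integral S ?L = b \<longleftrightarrow>
        ?R absolutely_integrable_on (G ` S) \<and> integral (G ` S) ?R = b" for b
      unfolding det by (simp add: G_def absolutely_integrable_on_1_iff integral_on_1_eq)
    show ?thesis
      using eq[of "integral S ?L"] eq[of "integral (G ` S) ?R"]
      by (cases "?L absolutely_integrable_on S"; cases "?R absolutely_integrable_on (G ` S)") simp_all
  qed
  also have "\<dots> = (\<integral>\<^sup>+x\<in>G ` S. ennreal (?R x) \<partial>lborel)"
    by (rule nn_integral_set_eq_integral[symmetric]) (use f GS in auto)
  also have "\<dots> = (\<integral>\<^sup>+x. ennreal (f (?T x)) * indicator (g ` D) (?T x) \<partial>lborel)"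
    by (intro nn_integral_cong) (auto simp: indicator_def GS)
  also have "\<dots> = (\<integral>\<^sup>+w\<in>g ` D. ennreal (f w) \<partial>lborel)"
    by (rule nn_integral_complex_of_vec[symmetric]) measurable
  finally show ?thesis .
qed

lemma emeasure_complex_ball: "r \<ge> 0 \<Longrightarrow> emeasure lborel (ball (z::complex) r) = ennreal (pi * r\<^sup>2)"
  by (simp add: emeasure_ball unit_ball_vol_2)

lemma nn_integral_rotation:
  fixes z \<omega> :: complex
  assumes \<omega>: "norm \<omega> = 1" and [measurable]: "f \<in> borel_measurable borel" and f: "\<And>w. 0 \<le> f w"
  shows "(\<integral>\<^sup>+w\<in>ball z r. ennreal (f (z + \<omega> * (w - z))) \<partial>lborel) = (\<integral>\<^sup>+w\<in>ball z r. ennreal (f w) \<partial>lborel)"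
proof -
  let ?g = "\<lambda>w. z + \<omega> * (w - z)"
  have "(?g has_field_derivative \<omega>) (at w)" for w
    by (auto intro!: derivative_eq_intros)
  then have d: "deriv ?g w = \<omega>" for w by (rule DERIV_imp_deriv)
  have \<omega>0: "\<omega> \<noteq> 0" using \<omega> by auto
  have im: "?g ` ball z r = ball z r"
  proof (intro set_eqI iffI)
    fix u assume "u \<in> ball z r"
    then have "z + (u - z) / \<omega> \<in> ball z r" "u = ?g (z + (u - z) / \<omega>)"
      using \<omega> \<omega>0 by (simp_all add: dist_norm norm_minus_commute norm_divide)
    then show "u \<in> ?g ` ball z r" by blast
  qed (use \<omega> in \<open>auto simp: dist_norm norm_minus_commute norm_mult\<close>)
  have "(\<integral>\<^sup>+w\<in>ball z r. ennreal ((cmod (deriv ?g w))\<^sup>2 * f (?g w)) \<partial>lborel) = (\<integral>\<^sup>+w\<in>?g ` ball z r. ennreal (f w) \<partial>lborel)"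
    by (rule nn_integral_holomorphic_substitution) (use \<omega>0 f in \<open>auto intro!: holomorphic_intros simp: inj_on_def\<close>)
  then show ?thesis unfolding im d \<omega> by simp
qed

section \<open>Mean values over a disc\<close>

context
  fixes z :: complex and r :: real and U :: "complex measure"
  assumes r: "r > 0"
  defines "U \<equiv> uniform_measure lborel (ball z r)"
begin

lemma disc_emeasure: "emeasure lborel (ball z r) \<noteq> 0" "emeasure lborel (ball z r) \<noteq> \<infinity>"
  using r by (simp_all add: emeasure_complex_ball)

lemma finite_measure_disc: "finite_measure U" and measure_disc [simp]: "measure U UNIV = 1"
proof -
  have 1: "emeasure U UNIV = 1"
    unfolding U_def using r by (simp add: emeasure_uniform_measure disc_emeasure emeasure_complex_ball ennreal_divide_self)
  then show "finite_measure U" by (intro finite_measureI) (simp add: U_def)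
  show "measure U UNIV = 1" by (simp add: measure_def 1)
qed

lemma space_disc [simp]: "space U = UNIV"
  by (simp add: U_def)

lemma sets_disc [measurable_cong, simp]: "sets U = sets borel"
  by (simp add: U_def)

lemma AE_disc: "(\<And>w. w \<in> ball z r \<Longrightarrow> P w) \<Longrightarrow> AE w in U. P w"
  unfolding U_def by (rule AE_uniform_measureI) auto

lemma distr_disc_rotation:
  assumes \<omega>: "norm \<omega> = 1"
  shows "distr U borel (\<lambda>w. z + \<omega> * (w - z)) = U"
proof (rule measure_eqI)
  fix A assume "A \<in> sets (distr U borel (\<lambda>w. z + \<omega> * (w - z)))"
  then have [measurable]: "A \<in> sets borel" by simp
  let ?g = "\<lambda>w. z + \<omega> * (w - z)"
  have [measurable]: "?g -` A \<in> sets borel"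
    using measurable_sets[of ?g borel borel A] by (auto intro!: borel_measurable_continuous_onI continuous_intros)
  have "emeasure lborel (ball z r \<inter> ?g -` A) = (\<integral>\<^sup>+w\<in>ball z r. ennreal (indicator A (?g w)) \<partial>lborel)"
  proof -
    have "emeasure lborel (ball z r \<inter> ?g -` A) = (\<integral>\<^sup>+w. indicator (ball z r \<inter> ?g -` A) w \<partial>lborel)"
      by (rule nn_integral_indicator[symmetric]) simp
    also have "\<dots> = (\<integral>\<^sup>+w\<in>ball z r. ennreal (indicator A (?g w)) \<partial>lborel)"
      by (intro nn_integral_cong) (auto simp: indicator_def)
    finally show ?thesis .
  qed
  also have "\<dots> = (\<integral>\<^sup>+w\<in>ball z r. ennreal (indicator A w) \<partial>lborel)"
    by (rule nn_integral_rotation[OF \<omega>]) auto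
  also have "\<dots> = (\<integral>\<^sup>+w. indicator (ball z r \<inter> A) w \<partial>lborel)"
    by (intro nn_integral_cong) (auto simp: indicator_def)
  also have "\<dots> = emeasure lborel (ball z r \<inter> A)"
    by (rule nn_integral_indicator) simp
  finally have "emeasure U (?g -` A) = emeasure U A"
    unfolding U_def by (simp add: emeasure_uniform_measure)
  then show "emeasure (distr U borel ?g) A = emeasure U A"
    by (subst emeasure_distr) (auto simp: U_def)
qed simp

text \<open>Rotating the disc by an \<open>n\<close>-th root of \<open>-1\<close> changes the sign of the integrand.\<close>

lemma integral_disc_power:
  assumes n: "n > 0"
  shows "(LINT w|U. (w - z) ^ n) = 0"
proof -
  define \<omega> where "\<omega> = cis (pi / real n)"
  have "real n * (pi / real n) = pi" using n by simp
  then have \<omega>: "\<omega> ^ n = - 1" unfolding \<omega>_def by (metis Complex.DeMoivre cis_pi)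
  have \<omega>1: "norm \<omega> = 1" by (simp add: \<omega>_def)
  have "(LINT w|U. (w - z) ^ n) = (LINT w|distr U borel (\<lambda>w. z + \<omega> * (w - z)). (w - z) ^ n)"
    by (simp only: distr_disc_rotation[OF \<omega>1])
  also have "\<dots> = (LINT w|U. (z + \<omega> * (w - z) - z) ^ n)"
    by (rule integral_distr) measurable
  also have "\<dots> = (LINT w|U. - ((w - z) ^ n))"
    by (simp add: power_mult_distrib \<omega>)
  finally show ?thesis by simp
qed

text \<open>The Taylor series at \<open>z\<close> is integrated term by term; rotation invariance
  kills all powers but the constant one. The margin r < R makes the series converge absolutely and
  uniformly on the disc.\<close>

lemma mean_value_disc:
  assumes G: "G holomorphic_on ball z R" and R: "r < R" and [measurable]: "G \<in> borel_measurable borel"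
  shows "(LINT w|U. G w) = G z"
proof -
  interpret finite_measure U by (rule finite_measure_disc)
  define c where "c = (\<lambda>n. (deriv ^^ n) G z / fact n)"
  define s where "s = complex_of_real ((r + R) / 2)"
  have s: "norm (complex_of_real r) < norm s" "norm s < R"
    using r R unfolding s_def norm_of_real by simp_all
  have sums: "(\<lambda>n. c n * (w - z) ^ n) sums G w" if "w \<in> ball z R" for w
    using holomorphic_power_series[OF G that] by (simp add: c_def)
  have "summable (\<lambda>n. c n * s ^ n)"
    using sums_summable[OF sums[of "z + s"]] s by (simp add: dist_norm)
  from powser_insidea[OF this s(1)]
  have sc: "summable (\<lambda>n. norm (c n) * r ^ n)" using r by (simp add: norm_mult norm_power)
  have bd: "norm (c n * (w - z) ^ n) \<le> norm (c n) * r ^ n" if "w \<in> ball z r" for w n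
    using that by (auto simp: norm_mult norm_power dist_norm norm_minus_commute intro!: mult_left_mono power_mono)
  have int: "integrable U (\<lambda>w. c n * (w - z) ^ n)" for n
    by (rule integrable_const_bound[where B = "norm (c n) * r ^ n"]) (auto intro!: AE_disc bd simp del: norm_mult)
  have "(LINT w|U. G w) = (LINT w|U. (\<Sum>n. c n * (w - z) ^ n))"
    by (rule integral_cong_AE) (use R in \<open>auto intro!: AE_disc sums_unique sums\<close>)
  also have "\<dots> = (\<Sum>n. LINT w|U. c n * (w - z) ^ n)"
  proof (rule integral_suminf[OF int])
    show "AE w in U. summable (\<lambda>n. norm (c n * (w - z) ^ n))"
      by (rule AE_disc, rule summable_comparison_test'[OF sc, of 0]) (use bd in auto)
    show "summable (\<lambda>n. LINT w|U. norm (c n * (w - z) ^ n))"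
    proof (rule summable_comparison_test'[OF sc, of 0])
      fix n
      have "(LINT w|U. norm (c n * (w - z) ^ n)) \<le> (LINT w|U. norm (c n) * r ^ n)"
        by (intro integral_mono_AE integrable_norm int AE_disc bd) auto
      then show "norm (LINT w|U. norm (c n * (w - z) ^ n)) \<le> norm (c n) * r ^ n"
        by simp
    qed
  qed
  also have "\<dots> = (\<Sum>n. if n = 0 then c 0 else 0)"
    by (intro suminf_cong) (simp add: integral_disc_power)
  also have "\<dots> = G z" using sums_unique[OF sums_single[of 0 "\<lambda>_. c 0"]] by (simp add: c_def)
  finally show ?thesis .
qed

text \<open>Jensen's inequality for t^p: the tangent line at |G z| is integrated over the
  probability measure \<open>U\<close>, and |G z| is at most the mean of |G|.\<close>

lemma power_mean_disc:
  assumes G: "G holomorphic_on ball z R" and R: "r < R" and [measurable]: "G \<in> borel_measurable borel"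
    and p: "p \<ge> 1"
  shows "ennreal (norm (G z) powr p) \<le> (\<integral>\<^sup>+w. ennreal (norm (G w) powr p) \<partial>U)"
proof (cases "G z = 0")
  case False
  interpret finite_measure U by (rule finite_measure_disc)
  define s where "s = norm (G z)"
  have s: "s > 0" using False by (simp add: s_def)
  have "continuous_on (cball z r) G"
    by (rule holomorphic_on_imp_continuous_on[OF holomorphic_on_subset[OF G]]) (use R in auto)
  then have "bounded (G ` cball z r)" by (intro compact_imp_bounded compact_continuous_image) auto
  then obtain B where B: "\<And>w. w \<in> cball z r \<Longrightarrow> norm (G w) \<le> B" unfolding bounded_iff by blast
  have i1: "integrable U G"
    by (rule integrable_const_bound[where B = B]) (auto intro!: AE_disc B)
  have i2: "integrable U (\<lambda>w. norm (G w) powr p)"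
    by (rule integrable_const_bound[where B = "B powr p"]) (use p in \<open>auto intro!: AE_disc powr_mono2 B\<close>)
  \<comment> \<open>The graph of t^p lies above its tangent at s. This is Young's inequality for t^p
    and s^p with weights 1/p and 1 - 1/p.\<close>
  have tangent: "p * s powr (p - 1) * t - (p - 1) * s powr p \<le> t powr p" if "t \<ge> 0" for t
  proof (cases "t = 0")
    case True
    then show ?thesis using p by simp
  next
    case False
    then have t: "t > 0" using that by simp
    have "(t powr p) powr (1 / p) * (s powr p) powr (1 - 1 / p) \<le> (1 / p) * t powr p + (1 - 1 / p) * s powr p"
      by (rule Youngs_inequality_0) (use p s t in auto)
    also have "(t powr p) powr (1 / p) = t" using t p by (simp add: powr_powr)
    also have "(s powr p) powr (1 - 1 / p) = s powr (p - 1)" using p by (simp add: powr_powr right_diff_distrib)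
    finally have "p * (t * s powr (p - 1)) \<le> p * ((1 / p) * t powr p + (1 - 1 / p) * s powr p)"
      using p by (intro mult_left_mono) auto
    also have "\<dots> = t powr p + (p - 1) * s powr p" using p by (simp add: field_simps)
    finally show ?thesis by (simp add: mult_ac)
  qed
  have "s = norm (LINT w|U. G w)" by (simp add: s_def mean_value_disc[OF G R])
  also have "\<dots> \<le> (LINT w|U. norm (G w))" by (rule integral_norm_bound)
  finally have "p * s powr (p - 1) * s - (p - 1) * s powr p \<le> p * s powr (p - 1) * (LINT w|U. norm (G w)) - (p - 1) * s powr p"
    using p by (intro diff_right_mono mult_left_mono) auto
  also have "\<dots> = (LINT w|U. p * s powr (p - 1) * norm (G w) - (p - 1) * s powr p)"
    using i1 by simp
  also have "\<dots> \<le> (LINT w|U. norm (G w) powr p)"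
    by (rule integral_mono) (use i1 i2 tangent in auto)
  finally have "p * s powr (p - 1) * s - (p - 1) * s powr p \<le> (LINT w|U. norm (G w) powr p)" .
  moreover have "s powr (p - 1) * s = s powr p"
    using s powr_add[of s "p - 1" 1] by simp
  ultimately have "s powr p \<le> (LINT w|U. norm (G w) powr p)"
    by (simp add: mult.assoc left_diff_distrib)
  then have "ennreal (s powr p) \<le> ennreal (LINT w|U. norm (G w) powr p)" by (rule ennreal_leI)
  also have "\<dots> = (\<integral>\<^sup>+w. ennreal (norm (G w) powr p) \<partial>U)"
    by (rule nn_integral_eq_integral[symmetric, OF i2]) auto
  finally show ?thesis by (simp add: s_def)
qed simp

end

section \<open>The hyperbolic area\<close>

lemma sets_hyp_area [measurable_cong, simp]: "sets hyp_area = sets borel"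
  by (simp add: hyp_area_def)

lemma nn_integral_hyp_area:
  assumes [measurable]: "f \<in> borel_measurable borel"
  shows "(\<integral>\<^sup>+z\<in>ball 0 1. f z \<partial>hyp_area)
    = (\<integral>\<^sup>+z\<in>ball 0 1. f z * ennreal (1 / (1 - (norm z)\<^sup>2)\<^sup>2) \<partial>lborel) / ennreal pi"
proof -
  let ?w = "\<lambda>z::complex. ennreal (1 / (1 - (norm z)\<^sup>2)\<^sup>2)"
  have [measurable_cong]: "sets (uniform_measure lborel (ball (0::complex) 1)) = sets borel" by simp
  have [measurable]: "ball (0::complex) 1 \<in> sets borel" by simp
  have "(\<integral>\<^sup>+z\<in>ball 0 1. f z \<partial>hyp_area) = (\<integral>\<^sup>+z. ?w z * (f z * indicator (ball 0 1) z) \<partial>uniform_measure lborel (ball 0 1))"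
    unfolding hyp_area_def by (rule nn_integral_density) measurable
  also have "\<dots> = (\<integral>\<^sup>+z. ?w z * (f z * indicator (ball 0 1) z) * indicator (ball 0 1) z \<partial>lborel) / emeasure lborel (ball (0::complex) 1)"
    by (rule nn_integral_uniform_measure) auto
  also have "(\<integral>\<^sup>+z. ?w z * (f z * indicator (ball 0 1) z) * indicator (ball 0 1) z \<partial>lborel)
     = (\<integral>\<^sup>+z\<in>ball 0 1. f z * ?w z \<partial>lborel)"
    by (intro nn_integral_cong) (auto simp: indicator_def mult_ac)
  finally show ?thesis by (simp add: emeasure_complex_ball)
qed

text \<open>The submean value property of |G|^p is used on the disc of radius \<rho>, half the
  distance of \<open>z\<close> to the circle. There 1 - |w|^2 lies between \<rho> and 6 \<rho>, so
  the weight (1 - |w|^2)^(p-2) is at least \<open>c\<close>; this is the origin of the 6.\<close>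

lemma besov_pointwise_bound:
  assumes G: "G holomorphic_on ball 0 1" and p: "p \<ge> 1" and z: "norm z < 1"
  shows "ennreal (((1 - (norm z)\<^sup>2) * norm (G z)) powr p) \<le> ennreal (4 powr p * 6 powr \<bar>p - 2\<bar>) *
    (\<integral>\<^sup>+w\<in>ball 0 1. ennreal (((1 - (norm w)\<^sup>2) * norm (G w)) powr p) \<partial>hyp_area)"
proof -
  define \<rho> where "\<rho> = (1 - norm z) / 2"
  have \<rho>: "\<rho> > 0" using z by (simp add: \<rho>_def)
  \<comment> \<open>Extension by zero, which provides the global measurability that the mean value
    lemmas ask for.\<close>
  define H where "H = (\<lambda>w. indicator (ball 0 1) w *\<^sub>R G w)"
  have [measurable]: "H \<in> borel_measurable borel" unfolding H_def
    by (intro borel_measurable_continuous_on_indicator holomorphic_on_imp_continuous_on G) simp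
  have sub: "ball z (2 * \<rho>) \<subseteq> ball 0 1"
  proof
    fix w assume "w \<in> ball z (2 * \<rho>)"
    then show "w \<in> ball 0 1" using norm_triangle_ineq4[of z "z - w"] by (simp add: \<rho>_def dist_norm)
  qed
  have H: "H holomorphic_on ball z (2 * \<rho>)"
    by (rule holomorphic_transform[OF holomorphic_on_subset[OF G sub]]) (use sub in \<open>auto simp: H_def\<close>)
  have [measurable]: "ball z \<rho> \<in> sets borel" by simp
  define c where "c = (6 powr - \<bar>p - 2\<bar>) * \<rho> powr (p - 2)"
  have c: "c > 0" using \<rho> by (simp add: c_def)
  have weight: "c \<le> (1 - (norm w)\<^sup>2) powr p * (1 / (1 - (norm w)\<^sup>2)\<^sup>2)" if w: "w \<in> ball z \<rho>" for w
  proof -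
    have zw: "norm (z - w) < \<rho>" using w by (simp add: dist_norm)
    have n: "norm w \<le> norm z + \<rho>" "norm z - \<rho> \<le> norm w"
      using norm_triangle_ineq4[of z "z - w"] norm_triangle_ineq2[of z w] zw by simp_all
    have w1: "norm w < 1" using n(1) z by (simp add: \<rho>_def field_simps)
    define t where "t = (1 - (norm w)\<^sup>2) / \<rho>"
    have e: "1 - (norm w)\<^sup>2 = (1 - norm w) * (1 + norm w)" by (simp add: power2_eq_square algebra_simps)
    have "norm z = 1 - 2 * \<rho>" by (simp add: \<rho>_def field_simps)
    then have n': "\<rho> \<le> 1 - norm w" "1 - norm w \<le> 3 * \<rho>" using n by linarith+
    have "\<rho> * 1 \<le> (1 - norm w) * (1 + norm w)" using n' w1 \<rho> by (intro mult_mono) auto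
    then have t1: "1 \<le> t" using \<rho> by (simp add: t_def e)
    have "(1 - norm w) * (1 + norm w) \<le> (3 * \<rho>) * 2" using n' w1 \<rho> by (intro mult_mono) auto
    then have t6: "t \<le> 6" using \<rho> by (simp add: t_def e divide_le_eq)
    have t\<rho>: "1 - (norm w)\<^sup>2 = t * \<rho>" using \<rho> by (simp add: t_def)
    \<comment> \<open>The exponent p - 2 can have either sign; - |p - 2| bounds it from below, which
      is the right direction because t lies between 1 and 6.\<close>
    have "6 powr - \<bar>p - 2\<bar> \<le> t powr - \<bar>p - 2\<bar>" using t1 t6 by (intro powr_mono2') auto
    also have "\<dots> \<le> t powr (p - 2)" using t1 by (intro powr_mono) auto
    finally have "c \<le> t powr (p - 2) * \<rho> powr (p - 2)" unfolding c_def by (rule mult_right_mono) simp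
    also have "\<dots> = (t * \<rho>) powr (p - 2)" using t1 \<rho> by (simp add: powr_mult)
    also have "\<dots> = (t * \<rho>) powr p * (1 / (t * \<rho>)\<^sup>2)" using t1 \<rho> by (simp add: powr_diff powr_numeral)
    finally show ?thesis by (simp add: t\<rho>)
  qed
  let ?E = "\<integral>\<^sup>+w\<in>ball 0 1. ennreal (((1 - (norm w)\<^sup>2) * norm (G w)) powr p) \<partial>hyp_area"
  have "(\<integral>\<^sup>+w. ennreal (norm (H w) powr p) * indicator (ball z \<rho>) w \<partial>lborel) * ennreal c
      = (\<integral>\<^sup>+w. ennreal (norm (H w) powr p) * indicator (ball z \<rho>) w * ennreal c \<partial>lborel)"
    by (rule nn_integral_multc[symmetric]) measurable
  also have "\<dots> \<le> (\<integral>\<^sup>+w\<in>ball 0 1. ennreal (((1 - (norm w)\<^sup>2) * norm (H w)) powr p) * ennreal (1 / (1 - (norm w)\<^sup>2)\<^sup>2) \<partial>lborel)"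
  proof (rule nn_integral_mono)
    fix w
    show "ennreal (norm (H w) powr p) * indicator (ball z \<rho>) w * ennreal c \<le>
       ennreal (((1 - (norm w)\<^sup>2) * norm (H w)) powr p) * ennreal (1 / (1 - (norm w)\<^sup>2)\<^sup>2) * indicator (ball 0 1) w"
    proof (cases "w \<in> ball z \<rho>")
      case True
      then have "w \<in> ball z (2 * \<rho>)" using \<rho> by simp
      then have w: "w \<in> ball 0 1" using sub by blast
      then have "0 \<le> 1 - (norm w)\<^sup>2" by (simp add: power_le_one)
      then have "norm (H w) powr p * c \<le> ((1 - (norm w)\<^sup>2) * norm (H w)) powr p * (1 / (1 - (norm w)\<^sup>2)\<^sup>2)"
        using mult_left_mono[OF weight[OF True], of "norm (H w) powr p"] by (simp add: powr_mult mult_ac)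
      then show ?thesis using True w c by (simp add: ennreal_mult[symmetric] ennreal_leI)
    qed simp
  qed
  also have "\<dots> = (\<integral>\<^sup>+w\<in>ball 0 1. ennreal (((1 - (norm w)\<^sup>2) * norm (H w)) powr p) \<partial>hyp_area) * ennreal pi"
    by (subst nn_integral_hyp_area) (simp_all add: ennreal_divide_times mult_divide_eq_ennreal)
  also have "(\<integral>\<^sup>+w\<in>ball 0 1. ennreal (((1 - (norm w)\<^sup>2) * norm (H w)) powr p) \<partial>hyp_area) = ?E"
    by (intro nn_integral_cong) (auto simp: H_def indicator_def)
  finally have 1: "(\<integral>\<^sup>+w. ennreal (norm (H w) powr p) * indicator (ball z \<rho>) w \<partial>lborel) * ennreal c \<le> ?E * ennreal pi" .
  have "ennreal (norm (H z) powr p) \<le> (\<integral>\<^sup>+w. ennreal (norm (H w) powr p) \<partial>uniform_measure lborel (ball z \<rho>))"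
    by (rule power_mean_disc[OF \<rho> H]) (use \<rho> p in auto)
  also have "\<dots> = (\<integral>\<^sup>+w. ennreal (norm (H w) powr p) * indicator (ball z \<rho>) w \<partial>lborel) / ennreal (pi * \<rho>\<^sup>2)"
    using \<rho> by (subst nn_integral_uniform_measure) (auto simp: emeasure_complex_ball)
  finally have avg: "ennreal (norm (H z) powr p) \<le> (\<integral>\<^sup>+w. ennreal (norm (H w) powr p) * indicator (ball z \<rho>) w \<partial>lborel) / ennreal (pi * \<rho>\<^sup>2)" .
  have "ennreal (norm (H z) powr p) * ennreal (pi * \<rho>\<^sup>2) \<le> (\<integral>\<^sup>+w. ennreal (norm (H w) powr p) * indicator (ball z \<rho>) w \<partial>lborel)"
  proof -
    have "ennreal (norm (H z) powr p) * ennreal (pi * \<rho>\<^sup>2) \<le> Y / ennreal (pi * \<rho>\<^sup>2) * ennreal (pi * \<rho>\<^sup>2)"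
      if "ennreal (norm (H z) powr p) \<le> Y / ennreal (pi * \<rho>\<^sup>2)" for Y
      using that by (rule mult_right_mono) simp
    moreover have "Y / ennreal (pi * \<rho>\<^sup>2) * ennreal (pi * \<rho>\<^sup>2) = Y" for Y
      using \<rho> by (simp add: ennreal_divide_times ennreal_divide_self)
    ultimately show ?thesis using avg by metis
  qed
  then have "ennreal (norm (H z) powr p) * ennreal (pi * \<rho>\<^sup>2) * ennreal c \<le> ?E * ennreal pi"
    using 1 by (meson mult_right_mono order_trans zero_le)
  then have "ennreal (norm (G z) powr p * \<rho>\<^sup>2 * c) * ennreal pi \<le> ?E * ennreal pi"
    using z c by (simp add: H_def ennreal_mult'[symmetric] mult_ac)
  then have 2: "ennreal (norm (G z) powr p * \<rho>\<^sup>2 * c) \<le> ?E"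
    using ennreal_mult_le_mult_iff[of "ennreal pi"] by (simp add: mult.commute[of _ "ennreal pi"])
  have e: "\<rho>\<^sup>2 * c * 6 powr \<bar>p - 2\<bar> = \<rho> powr p"
    using \<rho> by (simp add: c_def powr_minus powr_diff powr_numeral)
  \<comment> \<open>The factor 4^p comes from 1 - |z|^2 <= 4 \<rho>.\<close>
  have "1 - (norm z)\<^sup>2 = (1 - norm z) * (1 + norm z)" by (simp add: power2_eq_square algebra_simps)
  also have "\<dots> \<le> (2 * \<rho>) * 2" using z by (intro mult_mono) (auto simp: \<rho>_def)
  finally have "((1 - (norm z)\<^sup>2) * norm (G z)) powr p \<le> (4 * \<rho> * norm (G z)) powr p"
    using z p by (intro powr_mono2 mult_right_mono) (auto simp: power_le_one)
  also have "\<dots> = 4 powr p * 6 powr \<bar>p - 2\<bar> * (norm (G z) powr p * \<rho>\<^sup>2 * c)"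
    using \<rho> e by (simp add: powr_mult mult_ac)
  finally have "ennreal (((1 - (norm z)\<^sup>2) * norm (G z)) powr p) \<le> ennreal (4 powr p * 6 powr \<bar>p - 2\<bar>) * ennreal (norm (G z) powr p * \<rho>\<^sup>2 * c)"
    by (subst ennreal_mult[symmetric]) (use c in \<open>auto intro!: ennreal_leI\<close>)
  also have "\<dots> \<le> ennreal (4 powr p * 6 powr \<bar>p - 2\<bar>) * ?E"
    by (rule mult_left_mono[OF 2]) simp
  finally show ?thesis .
qed

text \<open>A difference of two disc areas, with inner radius sqrt (1 - u): area is proportional to
  u in the variable 1 - |w|^2.\<close>

lemma emeasure_boundary_annulus:
  assumes u: "0 < u" "u \<le> 1"
  shows "emeasure lborel {w \<in> ball (0::complex) 1. 1 - (norm w)\<^sup>2 \<le> u} = ennreal (pi * u)"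
proof -
  have "{w \<in> ball (0::complex) 1. 1 - (norm w)\<^sup>2 \<le> u} = ball 0 1 - ball 0 (sqrt (1 - u))"
  proof -
    have s1: "norm w < sqrt (1 - u) \<longleftrightarrow> (norm w)\<^sup>2 < 1 - u" for w :: complex
      using real_sqrt_less_iff[of "(norm w)\<^sup>2" "1 - u"] by simp
    have s2: "norm w < 1" if "norm w < sqrt (1 - u)" for w :: complex
    proof -
      have "sqrt (1 - u) \<le> 1" using u by simp
      with that show ?thesis by linarith
    qed
    have "w \<in> {w \<in> ball (0::complex) 1. 1 - (norm w)\<^sup>2 \<le> u} \<longleftrightarrow> w \<in> ball 0 1 - ball 0 (sqrt (1 - u))" for w
      using s1[of w] s2[of w] by auto
    then show ?thesis by blast
  qed
  also have "emeasure lborel \<dots> = emeasure lborel (ball (0::complex) 1) - emeasure lborel (ball (0::complex) (sqrt (1 - u)))"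
    using u by (intro emeasure_Diff subset_ball) (auto simp: emeasure_complex_ball)
  also have "\<dots> = ennreal (pi * u)"
    using u by (simp add: emeasure_complex_ball ennreal_minus algebra_simps)
  finally show ?thesis .
qed

text \<open>For p >= 2 the integrand is at most 1. For p < 2 the disc is cut dyadically: where 1 -
  |w|^2 lies between 2^-(k+1) and 2^-k, the integrand is at most \<open>c k\<close> and the area at
  most \<pi> 2^-k. The products form a geometric series with ratio 2^-(p-1), less than 1 because p >
  1.\<close>

lemma nn_integral_disc_powr_finite:
  assumes p: "p > 1"
  shows "(\<integral>\<^sup>+w\<in>ball (0::complex) 1. ennreal ((1 - (norm w)\<^sup>2) powr (p - 2)) \<partial>lborel) < \<infinity>"
proof (cases "p \<ge> 2")
  case True
  have "(\<integral>\<^sup>+w\<in>ball (0::complex) 1. ennreal ((1 - (norm w)\<^sup>2) powr (p - 2)) \<partial>lborel) \<le> (\<integral>\<^sup>+w. indicator (ball (0::complex) 1) w \<partial>lborel)"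
    using True by (intro nn_integral_mono) (auto simp: indicator_def power_le_one intro!: powr_le1)
  also have "\<dots> < \<infinity>" by (simp add: emeasure_complex_ball)
  finally show ?thesis .
next
  case False
  define A where "A = (\<lambda>k::nat. {w \<in> ball (0::complex) 1. 1 - (norm w)\<^sup>2 \<le> (1/2) ^ k})"
  have A [measurable]: "A k \<in> sets borel" for k
  proof -
    have "A k = ball 0 1 \<inter> {w. 1 - (norm w)\<^sup>2 \<le> (1/2) ^ k}" by (auto simp: A_def)
    also have "\<dots> \<in> sets borel"
      by (intro sets.Int[OF borel_open borel_closed] open_ball closed_Collect_le continuous_intros)
    finally show ?thesis .
  qed
  define c where "c = (\<lambda>k::nat. ((1/2) ^ Suc k) powr (p - 2))"
  have c0: "c k \<ge> 0" for k by (simp add: c_def)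
  have bound: "ennreal ((1 - (norm w)\<^sup>2) powr (p - 2)) * indicator (ball 0 1) w \<le> (\<Sum>k. ennreal (c k) * indicator (A k) w)" for w :: complex
  proof (cases "w \<in> ball 0 1")
    case True
    define u where "u = 1 - (norm w)\<^sup>2"
    have u: "0 < u" "u \<le> 1" using True by (simp_all add: u_def power_less_one_iff)
    \<comment> \<open>The first power of 1/2 below u. It is not the power 0, as u <= 1, so its
      predecessor k satisfies 2^-(k+1) < u <= 2^-k.\<close>
    define n where "n = (LEAST n. (1/2) ^ n < u)"
    have "\<exists>n. (1/2::real) ^ n < u" by (rule real_arch_pow_inv) (use u in auto)
    then have n: "(1/2) ^ n < u" unfolding n_def by (rule LeastI_ex)
    then have "n \<noteq> 0" using u by (intro notI) simp
    then obtain k where k: "n = Suc k" by (cases n) auto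
    have "\<not> (1/2) ^ k < u" by (rule not_less_Least) (use k n_def in simp)
    then have "w \<in> A k" using True by (simp add: A_def u_def)
    have "u powr (p - 2) \<le> c k" unfolding c_def
      by (rule powr_mono2') (use False n k in auto)
    then have "ennreal (u powr (p - 2)) * indicator (ball 0 1) w \<le> ennreal (c k) * indicator (A k) w"
      using \<open>w \<in> A k\<close> True by (simp add: ennreal_leI)
    \<comment> \<open>The sets \<open>A k\<close> are nested rather than disjoint; the single term
      for this \<open>k\<close> is enough.\<close>
    also have "\<dots> \<le> (\<Sum>k. ennreal (c k) * indicator (A k) w)"
      using sum_le_suminf[of "\<lambda>k. ennreal (c k) * indicator (A k) w" "{k}"] by (simp del: sum_mult_indicator)
    finally show ?thesis by (simp add: u_def)
  qed simp
  have ck: "c k * (pi * (1/2) ^ k) = (pi * (1/2) powr (p - 2)) * ((1/2) powr (p - 1)) ^ k" for k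
  proof -
    have "((1/2::real) powr (p - 1)) ^ k = (1/2) powr ((p - 1) * real k)" by (simp add: powr_realpow[symmetric] powr_powr)
    moreover have "c k = (1/2) powr (real (Suc k) * (p - 2))"
    proof -
      have "(1/2::real) ^ Suc k = (1/2) powr real (Suc k)" by (rule powr_realpow[symmetric]) simp
      then show ?thesis unfolding c_def by (simp only: powr_powr)
    qed
    moreover have "(1/2::real) ^ k = (1/2) powr real k" by (simp add: powr_realpow)
    ultimately show ?thesis by (simp add: powr_add[symmetric] algebra_simps)
  qed
  have "(\<integral>\<^sup>+w\<in>ball (0::complex) 1. ennreal ((1 - (norm w)\<^sup>2) powr (p - 2)) \<partial>lborel)
     \<le> (\<integral>\<^sup>+w. (\<Sum>k. ennreal (c k) * indicator (A k) w) \<partial>lborel)"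
    by (rule nn_integral_mono) (rule bound)
  also have "\<dots> = (\<Sum>k. \<integral>\<^sup>+w. ennreal (c k) * indicator (A k) w \<partial>lborel)"
    by (rule nn_integral_suminf) measurable
  also have "\<dots> = (\<Sum>k. ennreal (c k * (pi * (1/2) ^ k)))"
  proof (rule suminf_cong)
    fix k
    have "(\<integral>\<^sup>+w. ennreal (c k) * indicator (A k) w \<partial>lborel) = ennreal (c k) * emeasure lborel (A k)"
      by (rule nn_integral_cmult_indicator) simp
    also have "emeasure lborel (A k) = ennreal (pi * (1/2) ^ k)"
      unfolding A_def by (rule emeasure_boundary_annulus) (simp_all add: power_le_one)
    finally show "(\<integral>\<^sup>+w. ennreal (c k) * indicator (A k) w \<partial>lborel) = ennreal (c k * (pi * (1/2) ^ k))"
      using c0 by (simp add: ennreal_mult)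
  qed
  also have "\<dots> < \<infinity>"
  proof -
    have "(1/2::real) powr (p - 1) < 1" using p powr_less_mono2[of "p - 1" "1/2" 1] by simp
    then have "summable (\<lambda>k. (pi * (1/2) powr (p - 2)) * ((1/2) powr (p - 1)) ^ k)"
      by (intro summable_mult summable_geometric) simp
    then show ?thesis
      unfolding ck by (subst suminf_ennreal2) auto
  qed
  finally show ?thesis .
qed

section \<open>Moebius transformations\<close>

definition disc_moebius :: "complex \<Rightarrow> complex \<Rightarrow> complex" where
  "disc_moebius \<alpha> z = (\<alpha> - z) / (1 - cnj \<alpha> * z)"

lemma moebius_denominator:
  assumes "norm \<alpha> < 1" "norm z < 1"
  shows "1 - norm z \<le> norm (1 - cnj \<alpha> * z)" "1 - cnj \<alpha> * z \<noteq> 0"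
proof -
  have "norm (cnj \<alpha> * z) \<le> 1 * norm z"
    unfolding norm_mult using assms by (intro mult_right_mono) auto
  then show 1: "1 - norm z \<le> norm (1 - cnj \<alpha> * z)"
    using norm_triangle_ineq2[of 1 "cnj \<alpha> * z"] by simp
  then show "1 - cnj \<alpha> * z \<noteq> 0" using assms by auto
qed

lemma moebius_deriv:
  assumes "norm \<alpha> < 1" "norm z < 1"
  shows "(disc_moebius \<alpha> has_field_derivative (- of_real (1 - (norm \<alpha>)\<^sup>2) / (1 - cnj \<alpha> * z)\<^sup>2)) (at z)"
proof -
  have n: "complex_of_real ((norm \<alpha>)\<^sup>2) = \<alpha> * cnj \<alpha>" by (rule complex_norm_square)
  have "((\<lambda>z. (\<alpha> - z) / (1 - cnj \<alpha> * z)) has_field_derivative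
      ((0 - 1) * (1 - cnj \<alpha> * z) - (\<alpha> - z) * (0 - cnj \<alpha>)) / ((1 - cnj \<alpha> * z) * (1 - cnj \<alpha> * z))) (at z)"
    by (rule DERIV_divide) (use moebius_denominator(2)[OF assms] in \<open>auto intro!: derivative_eq_intros\<close>)
  also have "(0 - 1) * (1 - cnj \<alpha> * z) - (\<alpha> - z) * (0 - cnj \<alpha>) = - of_real (1 - (norm \<alpha>)\<^sup>2)"
    unfolding of_real_diff n by (simp add: algebra_simps)
  finally show ?thesis unfolding disc_moebius_def[abs_def] power2_eq_square[of "1 - cnj \<alpha> * z"] .
qed

lemma moebius_holomorphic: "norm \<alpha> < 1 \<Longrightarrow> disc_moebius \<alpha> holomorphic_on ball 0 1"
  unfolding holomorphic_on_open[OF open_ball] by (intro ballI exI, rule moebius_deriv) auto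

lemma norm_deriv_moebius:
  assumes "norm \<alpha> < 1" "norm z < 1"
  shows "norm (deriv (disc_moebius \<alpha>) z) = (1 - (norm \<alpha>)\<^sup>2) / (norm (1 - cnj \<alpha> * z))\<^sup>2"
proof -
  have "norm (complex_of_real (1 - (norm \<alpha>)\<^sup>2)) = 1 - (norm \<alpha>)\<^sup>2"
    unfolding norm_of_real using assms by (simp add: power_le_one)
  then show ?thesis
    unfolding DERIV_imp_deriv[OF moebius_deriv[OF assms]] norm_divide norm_minus_cancel norm_power by (simp only:)
qed

text \<open>Equality in Schwarz-Pick, from |1 - conj \<alpha> z|^2 - |\<alpha> - z|^2 = (1 -
  |z|^2)(1 - |\<alpha>|^2). It turns the Besov integrand of an automorphism \<sigma> into (1 -
  |\<sigma>|^2)^p.\<close>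

lemma schwarz_pick_moebius:
  assumes "norm \<alpha> < 1" "norm z < 1"
  shows "1 - (norm (disc_moebius \<alpha> z))\<^sup>2 = (1 - (norm z)\<^sup>2) * norm (deriv (disc_moebius \<alpha>) z)"
proof -
  have "(norm (1 - cnj \<alpha> * z))\<^sup>2 - (norm (\<alpha> - z))\<^sup>2 = (1 - (norm z)\<^sup>2) * (1 - (norm \<alpha>)\<^sup>2)"
    by (simp add: cmod_power2) (simp add: power2_eq_square algebra_simps)
  then show ?thesis
    using moebius_denominator(2)[OF assms]
    by (simp add: norm_deriv_moebius[OF assms] disc_moebius_def norm_divide field_simps)
qed

lemma norm_moebius_less_1:
  assumes "norm \<alpha> < 1" "norm z < 1"
  shows "norm (disc_moebius \<alpha> z) < 1"
proof -
  have "0 < 1 - (norm (disc_moebius \<alpha> z))\<^sup>2"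
    unfolding schwarz_pick_moebius[OF assms] norm_deriv_moebius[OF assms]
    using assms moebius_denominator(2)[OF assms] by (simp add: power_less_one_iff)
  then show ?thesis by (simp add: power_less_one_iff)
qed

lemma moebius_involution:
  assumes "norm \<alpha> < 1" "norm z < 1"
  shows "disc_moebius \<alpha> (disc_moebius \<alpha> z) = z"
proof -
  define d where "d = 1 - cnj \<alpha> * z"
  have d: "d \<noteq> 0" unfolding d_def by (rule moebius_denominator[OF assms])
  have e: "1 - cnj \<alpha> * disc_moebius \<alpha> z \<noteq> 0"
    by (rule moebius_denominator(2)[OF assms(1) norm_moebius_less_1[OF assms]])
  have m: "disc_moebius \<alpha> z * d = \<alpha> - z" using d by (simp add: disc_moebius_def d_def)
  have "(\<alpha> - disc_moebius \<alpha> z) * d = z * (1 - cnj \<alpha> * disc_moebius \<alpha> z) * d"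
  proof -
    have "(\<alpha> - disc_moebius \<alpha> z) * d = \<alpha> * d - (\<alpha> - z)" by (simp add: left_diff_distrib m)
    also have "\<dots> = z * (d - cnj \<alpha> * (\<alpha> - z))" by (simp add: d_def algebra_simps)
    also have "\<dots> = z * (1 - cnj \<alpha> * disc_moebius \<alpha> z) * d" by (simp add: m[symmetric] algebra_simps)
    finally show ?thesis .
  qed
  then have "\<alpha> - disc_moebius \<alpha> z = z * (1 - cnj \<alpha> * disc_moebius \<alpha> z)" using d by simp
  then show ?thesis using e by (simp add: disc_moebius_def[of \<alpha> "disc_moebius \<alpha> z"])
qed

text \<open>With u = 1 - |\<sigma> z|^2 and v = 1 - |z|^2, Schwarz-Pick gives u = v |\<sigma>'|,
  hence u^p / v^2 = |\<sigma>'|^2 u^(p-2), and w = \<sigma> z can be substituted. The result does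
  not contain \<alpha>, which makes the energy bound uniform.\<close>

lemma moebius_energy:
  assumes \<alpha>: "norm \<alpha> < 1"
  shows "(\<integral>\<^sup>+z\<in>ball 0 1. ennreal ((1 - (norm (disc_moebius \<alpha> z))\<^sup>2) powr p) \<partial>hyp_area)
    = (\<integral>\<^sup>+w\<in>ball (0::complex) 1. ennreal ((1 - (norm w)\<^sup>2) powr (p - 2)) \<partial>lborel) / ennreal pi"
proof -
  let ?s = "disc_moebius \<alpha>"
  have [measurable]: "?s \<in> borel_measurable borel" unfolding disc_moebius_def[abs_def] by measurable
  have inj: "inj_on ?s (ball 0 1)" by (rule inj_on_inverseI[of _ ?s]) (simp add: moebius_involution[OF \<alpha>])
  have im: "?s ` ball 0 1 = ball 0 1"
  proof
    show "ball 0 1 \<subseteq> ?s ` ball 0 1"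
      using moebius_involution[OF \<alpha>] norm_moebius_less_1[OF \<alpha>] by (auto simp: image_iff) (metis dist_0_norm mem_ball)
  qed (use norm_moebius_less_1[OF \<alpha>] in auto)
  have "(\<integral>\<^sup>+z\<in>ball 0 1. ennreal ((1 - (norm (?s z))\<^sup>2) powr p) \<partial>hyp_area)
     = (\<integral>\<^sup>+z\<in>ball 0 1. ennreal ((1 - (norm (?s z))\<^sup>2) powr p) * ennreal (1 / (1 - (norm z)\<^sup>2)\<^sup>2) \<partial>lborel) / ennreal pi"
    by (rule nn_integral_hyp_area) measurable
  also have "(\<integral>\<^sup>+z\<in>ball 0 1. ennreal ((1 - (norm (?s z))\<^sup>2) powr p) * ennreal (1 / (1 - (norm z)\<^sup>2)\<^sup>2) \<partial>lborel)
     = (\<integral>\<^sup>+z\<in>ball 0 1. ennreal ((cmod (deriv ?s z))\<^sup>2 * (1 - (norm (?s z))\<^sup>2) powr (p - 2)) \<partial>lborel)"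
  proof (rule nn_integral_cong)
    fix z
    show "ennreal ((1 - (norm (?s z))\<^sup>2) powr p) * ennreal (1 / (1 - (norm z)\<^sup>2)\<^sup>2) * indicator (ball 0 1) z =
      ennreal ((cmod (deriv ?s z))\<^sup>2 * (1 - (norm (?s z))\<^sup>2) powr (p - 2)) * indicator (ball 0 1) z"
    proof (cases "z \<in> ball 0 1")
      case True
      define u where "u = 1 - (norm (?s z))\<^sup>2"
      define v where "v = 1 - (norm z)\<^sup>2"
      have u: "u > 0" using norm_moebius_less_1[OF \<alpha>, of z] True by (simp add: u_def power_less_one_iff)
      have v: "v > 0" using True by (simp add: v_def power_less_one_iff)
      have uv: "u = v * cmod (deriv ?s z)" using schwarz_pick_moebius[OF \<alpha>, of z] True by (simp add: u_def v_def)
      have "u powr p * (1 / v\<^sup>2) = u powr (p - 2) * u\<^sup>2 / v\<^sup>2" using u by (simp add: powr_diff powr_numeral)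
      also have "u\<^sup>2 / v\<^sup>2 = (cmod (deriv ?s z))\<^sup>2" using v by (simp add: uv power_mult_distrib)
      then have "u powr (p - 2) * u\<^sup>2 / v\<^sup>2 = (cmod (deriv ?s z))\<^sup>2 * u powr (p - 2)" by (metis mult.commute times_divide_eq_right)
      finally have e: "u powr p * (1 / v\<^sup>2) = (cmod (deriv ?s z))\<^sup>2 * u powr (p - 2)" .
      show ?thesis using True e by (simp add: ennreal_mult[symmetric] u_def v_def)
    qed simp
  qed
  also have "\<dots> = (\<integral>\<^sup>+w\<in>?s ` ball 0 1. ennreal ((1 - (norm w)\<^sup>2) powr (p - 2)) \<partial>lborel)"
    by (rule nn_integral_holomorphic_substitution[OF open_ball moebius_holomorphic[OF \<alpha>] inj]) auto
  finally show ?thesis unfolding im .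
qed

section \<open>Quaternionic Moebius maps\<close>

text \<open>The geometric series in conj a, star-multiplied by a - q: for n > 0 the coefficient is
  (conj a)^n a - (conj a)^(n-1), and conj a times a is the real number |a|^2.\<close>

definition qmoebius_fps :: "quat \<Rightarrow> quat fps" where
  "qmoebius_fps a = Abs_fps (\<lambda>n. if n = 0 then a else - ((1 - (norm a)\<^sup>2) *\<^sub>R qcnj a ^ (n - 1)))"

lemma norm_qcnj [simp]: "norm (qcnj a) = norm a"
  by (simp add: norm_quat_def)

lemma qcnj_slice: "i \<in> imag_units \<Longrightarrow> qcnj (slice i z) = slice i (cnj z)"
  using imag_units_Re0[of i] by (simp add: quat_eq_iff slice_alt)

lemma ball_convergent_bounded:
  assumes "\<And>n. norm (fps_nth F n) \<le> K"
  shows "ball_convergent F"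
  unfolding ball_convergent_def
proof (intro allI impI)
  fix r :: real assume r: "0 \<le> r \<and> r < 1"
  then have "summable (\<lambda>n. K * r ^ n)" by (intro summable_mult summable_geometric) auto
  then show "summable (\<lambda>n. norm (fps_nth F n) * r ^ n)"
    by (rule summable_comparison_test'[where N = 0]) (use r assms in \<open>auto intro: mult_right_mono\<close>)
qed

lemma ball_convergent_qmoebius_fps:
  assumes a: "norm a < 1"
  shows "ball_convergent (qmoebius_fps a)"
proof (rule ball_convergent_bounded)
  fix n
  have "(1 - (norm a)\<^sup>2) * norm a ^ (n - 1) \<le> 1 * 1"
    using a by (intro mult_mono) (auto simp: power_le_one)
  then show "norm (fps_nth (qmoebius_fps a) n) \<le> 1"
    using a by (auto simp: qmoebius_fps_def norm_power power_le_one)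
qed

text \<open>The star inverse of 1 - q conj a is the geometric series \<open>P\<close>; uniqueness of
  expansions (\<open>rps_of_eqI\<close>) lets \<open>rps_of\<close> recover it from its sum.\<close>

lemma qmoebius_rps_eval:
  assumes a: "norm a < 1" and q: "q \<in> qball"
  shows "qmoebius a q = rps_eval (qmoebius_fps a) q"
proof -
  define P where "P = Abs_fps (\<lambda>n. qcnj a ^ n)"
  have "(1 - fps_X * fps_const (qcnj a)) * P = 1"
  proof (rule fps_ext)
    fix n
    show "fps_nth ((1 - fps_X * fps_const (qcnj a)) * P) n = fps_nth 1 n"
      by (cases n) (simp_all add: left_diff_distrib mult.assoc P_def)
  qed
  then have inv: "inverse (1 - fps_X * fps_const (qcnj a)) = P" by (rule fps_inverse_unique)
  have P: "ball_convergent P"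
    by (rule ball_convergent_bounded[of _ 1]) (use a in \<open>simp add: P_def norm_power power_le_one\<close>)
  have "rps_of (star_inverse (\<lambda>q. 1 - q * qcnj a)) = P"
    by (rule rps_of_eqI) (simp add: star_inverse_def qmoebius_series inv ball_convergent_sums[OF P])
  moreover have "P * (fps_const a - fps_X) = qmoebius_fps a"
  proof (rule fps_ext)
    fix n
    show "fps_nth (P * (fps_const a - fps_X)) n = fps_nth (qmoebius_fps a) n"
    proof (cases n)
      case (Suc m)
      have "qcnj a ^ Suc m * a = qcnj a ^ m * (qcnj a * a)" by (simp add: power_commutes mult.assoc[symmetric])
      also have "\<dots> = (norm a)\<^sup>2 *\<^sub>R qcnj a ^ m" by (simp add: mult_qcnj)
      finally show ?thesis
        by (simp add: Suc right_diff_distrib P_def qmoebius_fps_def scaleR_diff_left)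
    qed (simp add: right_diff_distrib P_def qmoebius_fps_def)
  qed
  ultimately show ?thesis
    using q by (simp add: qmoebius_def star_mult_def qmoebius_series)
qed

text \<open>On the slice of its parameter all coefficients of the series lie in that slice, so it is
  the image of the Taylor series of the complex automorphism.\<close>

lemma qmoebius_slice:
  assumes i: "i \<in> imag_units" and \<alpha>: "norm \<alpha> < 1" and z: "norm z < 1"
  shows "qmoebius (slice i \<alpha>) (slice i z) = slice i (disc_moebius \<alpha> z)"
proof -
  let ?a = "slice i \<alpha>"
  have a: "norm ?a < 1" and zq: "slice i z \<in> qball" using \<alpha> z by (simp_all add: norm_slice[OF i])
  define m where "m = (\<lambda>n. if n = 0 then \<alpha> else - (of_real (1 - (norm \<alpha>)\<^sup>2) * cnj \<alpha> ^ (n - 1)))"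
  have lt: "norm (cnj \<alpha> * z) < 1"
    using \<alpha> z mult_strict_mono[of "norm \<alpha>" 1 "norm z" 1] by (simp add: norm_mult)
  have "(\<lambda>n. - (of_real (1 - (norm \<alpha>)\<^sup>2) * z) * (cnj \<alpha> * z) ^ n) sums (- (of_real (1 - (norm \<alpha>)\<^sup>2) * z) * (1 / (1 - cnj \<alpha> * z)))"
    by (intro sums_mult geometric_sums lt)
  also have "(\<lambda>n. - (of_real (1 - (norm \<alpha>)\<^sup>2) * z) * (cnj \<alpha> * z) ^ n) = (\<lambda>n. z ^ Suc n * m (Suc n))"
    by (rule ext) (simp add: m_def power_mult_distrib mult_ac)
  finally have "(\<lambda>n. z ^ n * m n) sums (- (of_real (1 - (norm \<alpha>)\<^sup>2) * z) * (1 / (1 - cnj \<alpha> * z)) + z ^ 0 * m 0)"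
    by (rule sums_Suc)
  also have "- (of_real (1 - (norm \<alpha>)\<^sup>2) * z) * (1 / (1 - cnj \<alpha> * z)) + z ^ 0 * m 0 = disc_moebius \<alpha> z"
  proof -
    have n: "complex_of_real ((norm \<alpha>)\<^sup>2) = \<alpha> * cnj \<alpha>" by (rule complex_norm_square)
    show ?thesis
      using moebius_denominator(2)[OF \<alpha> z] n by (simp add: m_def disc_moebius_def field_simps)
  qed
  finally have "(\<lambda>n. slice i (z ^ n * m n)) sums slice i (disc_moebius \<alpha> z)"
    by (rule bounded_linear.sums[OF bounded_linear_slice])
  moreover have "slice i (z ^ n * m n) = slice i z ^ n * fps_nth (qmoebius_fps ?a) n" for n
  proof -
    have "slice i (m n) = fps_nth (qmoebius_fps ?a) n"
    proof (cases n)
      case (Suc k)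
      have "m n = (- (1 - (norm \<alpha>)\<^sup>2)) *\<^sub>R (cnj \<alpha> ^ k)" by (simp add: m_def Suc scaleR_conv_of_real left_diff_distrib)
      then show ?thesis
        by (simp add: Suc qmoebius_fps_def slice_scaleR slice_power[OF i] qcnj_slice[OF i] norm_slice[OF i] scaleR_diff_left slice_diff)
    qed (simp add: m_def qmoebius_fps_def)
    then show ?thesis by (simp add: slice_mult[OF i] slice_power[OF i])
  qed
  ultimately have "(\<lambda>n. slice i z ^ n * fps_nth (qmoebius_fps ?a) n) sums slice i (disc_moebius \<alpha> z)" by simp
  moreover have "(\<lambda>n. slice i z ^ n * fps_nth (qmoebius_fps ?a) n) sums qmoebius ?a (slice i z)"
    unfolding qmoebius_rps_eval[OF a zq] by (rule ball_convergent_sums[OF ball_convergent_qmoebius_fps[OF a] zq])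
  ultimately show ?thesis using sums_unique2 by blast
qed

lemma qmoebius_SR:
  assumes "norm a < 1"
  shows "qmoebius a \<in> SR" "slice_regular (qmoebius a)"
proof -
  show "slice_regular (qmoebius a)"
    by (rule slice_regular_rps_eval[OF ball_convergent_qmoebius_fps[OF assms] qmoebius_rps_eval[OF assms]])
  then show "qmoebius a \<in> SR" by (simp add: SR_def qmoebius_def star_mult_def)
qed

lemma deriv_x0_qmoebius:
  assumes i: "i \<in> imag_units" and \<alpha>: "norm \<alpha> < 1" and z: "norm z < 1"
  shows "deriv_x0 (qmoebius (slice i \<alpha>)) (slice i z) = slice i (deriv (disc_moebius \<alpha>) z)"
proof -
  have a: "norm (slice i \<alpha>) < 1" using \<alpha> by (simp add: norm_slice[OF i])
  have 1: "((\<lambda>w. qmoebius (slice i \<alpha>) (slice i w)) has_derivative (\<lambda>h. slice i h * deriv_x0 (qmoebius (slice i \<alpha>)) (slice i z))) (at z)"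
    by (rule slice_regular_has_derivative_slice[OF qmoebius_SR(2)[OF a] i z])
  have "(disc_moebius \<alpha> has_derivative (*) (deriv (disc_moebius \<alpha>) z)) (at z)"
    using holomorphic_derivI[OF moebius_holomorphic[OF \<alpha>] open_ball, of z] z by (simp add: has_field_derivative_def)
  from bounded_linear.has_derivative[OF bounded_linear_slice this]
  have "((\<lambda>w. slice i (disc_moebius \<alpha> w)) has_derivative (\<lambda>h. slice i (deriv (disc_moebius \<alpha>) z * h))) (at z)" .
  then have "((\<lambda>w. qmoebius (slice i \<alpha>) (slice i w)) has_derivative (\<lambda>h. slice i (deriv (disc_moebius \<alpha>) z * h))) (at z)"
    by (rule has_derivative_transform_within_open[OF _ open_ball[of 0 1]]) (use z in \<open>auto simp: qmoebius_slice[OF i \<alpha>]\<close>)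
  from fun_cong[OF has_derivative_unique[OF 1 this], of 1] show ?thesis by simp
qed

text \<open>The representation formula brings in the conjugate point. Since |1 - conj \<alpha> conj
  z| = |1 - \<alpha> z|, this contribution is rewritten as the automorphism with conjugate parameter
  at z itself.\<close>

lemma norm_deriv_x0_qmoebius_le:
  assumes i: "i \<in> imag_units" and I: "I \<in> imag_units" and \<alpha>: "norm \<alpha> < 1" and z: "norm z < 1"
  shows "norm (deriv_x0 (qmoebius (slice i \<alpha>)) (slice I z)) \<le>
    norm (deriv (disc_moebius \<alpha>) z) + norm (deriv (disc_moebius (cnj \<alpha>)) z)"
proof -
  have a: "norm (slice i \<alpha>) < 1" using \<alpha> by (simp add: norm_slice[OF i])
  let ?F = "qmoebius_fps (slice i \<alpha>)"
  have d: "rps_eval (fps_deriv ?F) (slice J w) = deriv_x0 (qmoebius (slice i \<alpha>)) (slice J w)"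
    if "J \<in> imag_units" "norm w < 1" for J w
    by (rule deriv_x0_rps_eval[symmetric, OF ball_convergent_qmoebius_fps[OF a] qmoebius_rps_eval[OF a]])
      (use that in \<open>simp_all add: norm_slice\<close>)
  have "norm (deriv (disc_moebius \<alpha>) (cnj z)) = norm (deriv (disc_moebius (cnj \<alpha>)) z)"
  proof -
    have "1 - cnj \<alpha> * cnj z = cnj (1 - cnj (cnj \<alpha>) * z)" by simp
    then have "norm (1 - cnj \<alpha> * cnj z) = norm (1 - cnj (cnj \<alpha>) * z)" by (metis complex_mod_cnj)
    then show ?thesis using \<alpha> z by (simp add: norm_deriv_moebius)
  qed
  then show ?thesis
    using norm_rps_eval_representation[OF ball_convergent_deriv[OF ball_convergent_qmoebius_fps[OF a]] i I z] z
    by (simp add: d[OF I z] d[OF i] deriv_x0_qmoebius[OF i \<alpha>] norm_slice[OF i])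
qed

text \<open>The denominators are at least 1 - |q|, so at a fixed distance from the boundary the
  derivative is of order 1 - |a|^2. The 2 counts the parameters \<alpha> and conj \<alpha>.\<close>

lemma norm_deriv_x0_qmoebius_locally:
  assumes a: "norm a < 1" and q: "q \<in> qball"
  shows "norm (deriv_x0 (qmoebius a) q) \<le> 2 * (1 - (norm a)\<^sup>2) / (1 - norm q)\<^sup>2"
proof -
  obtain i \<alpha> where i: "i \<in> imag_units" and a': "a = slice i \<alpha>" by (rule slice_cases)
  obtain I z where I: "I \<in> imag_units" and q': "q = slice I z" by (rule slice_cases)
  have \<alpha>: "norm \<alpha> < 1" and z: "norm z < 1" using a q by (simp_all add: a' q' norm_slice[OF i] norm_slice[OF I])
  have b: "norm (deriv (disc_moebius \<beta>) z) \<le> (1 - (norm \<beta>)\<^sup>2) / (1 - norm z)\<^sup>2" if "norm \<beta> < 1" for \<beta>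
    unfolding norm_deriv_moebius[OF that z]
    by (rule divide_left_mono) (use moebius_denominator[OF that z] that z in \<open>auto intro!: power_mono simp: power_le_one\<close>)
  have b': "norm (deriv (disc_moebius (cnj \<alpha>)) z) \<le> (1 - (norm \<alpha>)\<^sup>2) / (1 - norm z)\<^sup>2"
    using b[of "cnj \<alpha>"] \<alpha> by simp
  have "norm (deriv_x0 (qmoebius a) q) \<le> norm (deriv (disc_moebius \<alpha>) z) + norm (deriv (disc_moebius (cnj \<alpha>)) z)"
    unfolding a' q' by (rule norm_deriv_x0_qmoebius_le[OF i I \<alpha> z])
  also have "\<dots> \<le> (1 - (norm \<alpha>)\<^sup>2) / (1 - norm z)\<^sup>2 + (1 - (norm \<alpha>)\<^sup>2) / (1 - norm z)\<^sup>2"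
    by (intro add_mono b[OF \<alpha>] b')
  finally show ?thesis
    by (simp only: a' q' norm_slice[OF i] norm_slice[OF I] mult_2 add_divide_distrib[symmetric])
qed

text \<open>The integrand is at most (x + y)^p with x and y belonging to \<alpha> and conj \<alpha>,
  and (x + y)^p <= 2^p (x^p + y^p) through the maximum. Both parameters have the same energy
  \<open>?J\<close>.\<close>

lemma besov_energy_qmoebius:
  assumes p: "p > 1"
  obtains K where "K < \<infinity>" "\<And>a. norm a < 1 \<Longrightarrow> besov_energy p (qmoebius a) \<le> K"
proof
  let ?J = "(\<integral>\<^sup>+w\<in>ball (0::complex) 1. ennreal ((1 - (norm w)\<^sup>2) powr (p - 2)) \<partial>lborel) / ennreal pi"
  let ?K = "ennreal (2 powr p) * (?J + ?J)"
  have "?J < \<infinity>" using nn_integral_disc_powr_finite[OF p] by (simp add: divide_ennreal_def inverse_ennreal ennreal_mult_less_top)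
  then show "?K < \<infinity>" by (simp add: ennreal_mult_less_top)
  fix a :: quat assume a: "norm a < 1"
  obtain i \<alpha> where i: "i \<in> imag_units" and a': "a = slice i \<alpha>" by (rule slice_cases)
  have \<alpha>: "norm \<alpha> < 1" "norm (cnj \<alpha>) < 1" using a by (simp_all add: a' norm_slice[OF i])
  let ?u = "\<lambda>\<beta> z. 1 - (norm (disc_moebius \<beta> z))\<^sup>2"
  have [measurable]: "disc_moebius \<beta> \<in> borel_measurable borel" for \<beta> unfolding disc_moebius_def[abs_def] by measurable
  have [measurable]: "ball (0::complex) 1 \<in> sets borel" by simp
  show "besov_energy p (qmoebius a) \<le> ?K"
    unfolding besov_energy_def
  proof (rule SUP_least)
    fix I assume I: "I \<in> imag_units"
    have pt: "((1 - (norm (slice I z))\<^sup>2) * norm (deriv_x0 (qmoebius a) (slice I z))) powr p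
        \<le> 2 powr p * (?u \<alpha> z powr p + ?u (cnj \<alpha>) z powr p)" if z: "norm z < 1" for z
    proof -
      define x where "x = ?u \<alpha> z"
      define y where "y = ?u (cnj \<alpha>) z"
      have xy: "x \<ge> 0" "y \<ge> 0"
        using norm_moebius_less_1[OF \<alpha>(1) z] norm_moebius_less_1[OF \<alpha>(2) z] by (simp_all add: x_def y_def power_le_one)
      have "(1 - (norm z)\<^sup>2) * norm (deriv_x0 (qmoebius a) (slice I z)) \<le>
        (1 - (norm z)\<^sup>2) * (norm (deriv (disc_moebius \<alpha>) z) + norm (deriv (disc_moebius (cnj \<alpha>)) z))"
        unfolding a' by (intro mult_left_mono norm_deriv_x0_qmoebius_le i I \<alpha> z) (use z in \<open>simp add: power_le_one\<close>)
      also have "\<dots> = x + y"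
        unfolding x_def y_def schwarz_pick_moebius[OF \<alpha>(1) z] schwarz_pick_moebius[OF \<alpha>(2) z] by (rule distrib_left)
      also have "\<dots> \<le> 2 * max x y" by simp
      finally have "((1 - (norm z)\<^sup>2) * norm (deriv_x0 (qmoebius a) (slice I z))) powr p \<le> (2 * max x y) powr p"
        using z p by (intro powr_mono2) (auto simp: power_le_one)
      also have "\<dots> = 2 powr p * max x y powr p" using xy by (simp add: powr_mult)
      also have "\<dots> \<le> 2 powr p * (x powr p + y powr p)"
        by (intro mult_left_mono) (auto simp: max_def)
      finally show ?thesis by (simp add: x_def y_def norm_slice[OF I])
    qed
    have "(\<integral>\<^sup>+z\<in>ball 0 1. ennreal (((1 - (norm (slice I z))\<^sup>2) * norm (deriv_x0 (qmoebius a) (slice I z))) powr p) \<partial>hyp_area)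
      \<le> (\<integral>\<^sup>+z. ennreal (2 powr p) * (ennreal (?u \<alpha> z powr p) * indicator (ball 0 1) z + ennreal (?u (cnj \<alpha>) z powr p) * indicator (ball 0 1) z) \<partial>hyp_area)"
    proof (rule nn_integral_mono)
      fix z
      show "ennreal (((1 - (norm (slice I z))\<^sup>2) * norm (deriv_x0 (qmoebius a) (slice I z))) powr p) * indicator (ball 0 1) z
        \<le> ennreal (2 powr p) * (ennreal (?u \<alpha> z powr p) * indicator (ball 0 1) z + ennreal (?u (cnj \<alpha>) z powr p) * indicator (ball 0 1) z)"
        using pt[of z] by (cases "norm z < 1") (simp_all add: ennreal_plus[symmetric] ennreal_mult[symmetric] ennreal_leI del: ennreal_plus)
    qed
    also have "\<dots> = ennreal (2 powr p) * ((\<integral>\<^sup>+z\<in>ball 0 1. ennreal (?u \<alpha> z powr p) \<partial>hyp_area) + (\<integral>\<^sup>+z\<in>ball 0 1. ennreal (?u (cnj \<alpha>) z powr p) \<partial>hyp_area))"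
      by (simp add: nn_integral_cmult nn_integral_add)
    also have "\<dots> = ?K" unfolding moebius_energy[OF \<alpha>(1)] moebius_energy[OF \<alpha>(2)] ..
    finally show "(\<integral>\<^sup>+z\<in>ball 0 1. ennreal (((1 - (norm (slice I z))\<^sup>2) * norm (deriv_x0 (qmoebius a) (slice I z))) powr p) \<partial>hyp_area) \<le> ?K" .
  qed
qed

section \<open>Besov functions are Bloch functions\<close>

lemma norm_le_slice_coord:
  assumes "i \<in> imag_units" "j \<in> imag_units" "i * j = - (j * i)"
  shows "norm q \<le> norm (slice_coord i (q * 1)) + norm (slice_coord i (q * (- j)))"
proof -
  have "norm q \<le> norm (slice i (slice_coord i q)) + norm (slice i (slice_coord i (- (q * j))) * j)"
    by (subst (1) slice_coord_decomposition[OF assms]) (rule norm_triangle_ineq)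
  then show ?thesis by (simp add: norm_mult norm_slice[OF assms(1)] imag_units_norm[OF assms(2)])
qed

lemma slice_coord_deriv_holomorphic:
  assumes f: "slice_regular f" and i: "i \<in> imag_units"
  shows "(\<lambda>w. slice_coord i (deriv_x0 f (slice i w) * c)) holomorphic_on ball 0 1"
proof -
  have "deriv (\<lambda>w. slice_coord i (f (slice i w) * c)) holomorphic_on ball 0 1"
    by (rule holomorphic_deriv[OF slice_coord_holomorphic[OF f i] open_ball])
  then show ?thesis
    by (rule holomorphic_transform) (auto intro!: DERIV_imp_deriv slice_coord_has_field_derivative f i)
qed

text \<open>The pointwise bound is applied to the two holomorphic components of the derivative. In
  the constant 4 K^(1/p), one factor 2 undoes the halving in \<open>G\<close> and the other counts
  the components.\<close>

lemma besov_bloch_on_slice: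
  assumes p: "p > 1"
  obtains C where "C \<ge> 0"
    "\<And>f i z. f \<in> Besov p \<Longrightarrow> i \<in> imag_units \<Longrightarrow> norm z < 1 \<Longrightarrow>
      (1 - (norm z)\<^sup>2) * norm (deriv_x0 f (slice i z)) \<le> C * besov_norm p f"
proof
  define K where "K = 4 powr p * 6 powr \<bar>p - 2\<bar>"
  have K: "K \<ge> 0" by (simp add: K_def)
  let ?C = "4 * K powr (1 / p)"
  show "?C \<ge> 0" by simp
  fix f i z assume fB: "f \<in> Besov p" and i: "i \<in> imag_units" and z: "norm (z::complex) < 1"
  have f: "slice_regular f" and fin: "besov_energy p f < \<infinity>" using fB by (auto simp: Besov_def SR_def)
  obtain j where j: "j \<in> imag_units" "i * j = - (j * i)" using anticommuting_unit_exists[OF i] .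
  define E where "E = enn2real (besov_energy p f)"
  have E: "besov_energy p f = ennreal E" "E \<ge> 0" using fin by (simp_all add: E_def less_top)
  have z2: "0 \<le> 1 - (norm z)\<^sup>2" using z by (simp add: power_le_one)
  have part: "(1 - (norm z)\<^sup>2) * norm (slice_coord i (deriv_x0 f (slice i z) * c)) \<le> 2 * (K powr (1 / p) * E powr (1 / p))"
    if c: "norm c = 1" for c
  proof -
    \<comment> \<open>The 1/2 absorbs the factor in \<open>norm_slice_coord_le\<close>, so that |G|
      is at most the norm of the derivative and its integral at most the Besov energy.\<close>
    define G where "G = (\<lambda>w. (1/2) * slice_coord i (deriv_x0 f (slice i w) * c))"
    have G: "G holomorphic_on ball 0 1"
      unfolding G_def by (intro holomorphic_intros slice_coord_deriv_holomorphic f i)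
    have Gn: "norm (G w) \<le> norm (deriv_x0 f (slice i w))" for w
      using norm_slice_coord_le[OF i, of "deriv_x0 f (slice i w) * c"] c by (simp add: G_def norm_mult)
    have "ennreal (((1 - (norm z)\<^sup>2) * norm (G z)) powr p) \<le> ennreal K *
      (\<integral>\<^sup>+w\<in>ball 0 1. ennreal (((1 - (norm w)\<^sup>2) * norm (G w)) powr p) \<partial>hyp_area)"
      unfolding K_def using p by (intro besov_pointwise_bound G z) simp
    also have "(\<integral>\<^sup>+w\<in>ball 0 1. ennreal (((1 - (norm w)\<^sup>2) * norm (G w)) powr p) \<partial>hyp_area)
      \<le> (\<integral>\<^sup>+w\<in>ball 0 1. ennreal (((1 - (norm (slice i w))\<^sup>2) * norm (deriv_x0 f (slice i w))) powr p) \<partial>hyp_area)"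
      using p Gn by (intro nn_integral_mono)
        (auto simp: indicator_def norm_slice[OF i] power_le_one intro!: ennreal_leI powr_mono2 mult_left_mono)
    also have "\<dots> \<le> besov_energy p f" unfolding besov_energy_def by (rule SUP_upper[OF i])
    finally have "ennreal (((1 - (norm z)\<^sup>2) * norm (G z)) powr p) \<le> ennreal (K * E)"
      using K E by (simp add: ennreal_mult mult_left_mono)
    then have "((1 - (norm z)\<^sup>2) * norm (G z)) powr p \<le> K * E" using K E by simp
    then have "(((1 - (norm z)\<^sup>2) * norm (G z)) powr p) powr (1 / p) \<le> (K * E) powr (1 / p)"
      using p by (intro powr_mono2) auto
    then have "(1 - (norm z)\<^sup>2) * norm (G z) \<le> K powr (1 / p) * E powr (1 / p)"
      using p z2 K E by (simp add: powr_powr powr_mult)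
    then show ?thesis by (simp add: G_def norm_mult)
  qed
  have "(1 - (norm z)\<^sup>2) * norm (deriv_x0 f (slice i z)) \<le>
      (1 - (norm z)\<^sup>2) * (norm (slice_coord i (deriv_x0 f (slice i z) * 1)) + norm (slice_coord i (deriv_x0 f (slice i z) * (- j))))"
    by (rule mult_left_mono[OF norm_le_slice_coord[OF i j] z2])
  also have "\<dots> \<le> 2 * (K powr (1 / p) * E powr (1 / p)) + 2 * (K powr (1 / p) * E powr (1 / p))"
    unfolding distrib_left by (intro add_mono part) (simp_all add: imag_units_norm[OF j(1)])
  also have "\<dots> = ?C * E powr (1 / p)" by simp
  also have "\<dots> \<le> ?C * besov_norm p f"
    by (rule mult_left_mono) (simp_all add: besov_norm_def E_def)
  finally show "(1 - (norm z)\<^sup>2) * norm (deriv_x0 f (slice i z)) \<le> ?C * besov_norm p f" .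
qed

section \<open>Composition operators and the Bloch seminorm\<close>

text \<open>A weak Schwarz-Pick inequality: Cauchy's estimate on the disc of radius \<rho>, half the
  distance to the circle, together with 1 - |z|^2 <= 4 \<rho>.\<close>

lemma holomorphic_disc_deriv_bound:
  assumes \<phi>: "\<phi> holomorphic_on ball 0 1" "\<And>z. norm z < 1 \<Longrightarrow> norm (\<phi> z) < 1" and z: "norm z < 1"
  shows "(1 - (norm z)\<^sup>2) * norm (deriv \<phi> z) \<le> 4"
proof -
  define \<rho> where "\<rho> = (1 - norm z) / 2"
  have \<rho>: "\<rho> > 0" "norm z + \<rho> < 1" using z by (simp_all add: \<rho>_def field_simps)
  have sub: "cball z \<rho> \<subseteq> ball 0 1"
  proof
    fix w assume "w \<in> cball z \<rho>"
    then show "w \<in> ball 0 1" using norm_triangle_ineq4[of z "z - w"] \<rho> by (simp add: dist_norm)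
  qed
  have "norm ((deriv ^^ 1) \<phi> z) \<le> fact 1 * 1 / \<rho> ^ 1"
  proof (rule Cauchy_inequality)
    show "\<phi> holomorphic_on ball z \<rho>" using sub by (intro holomorphic_on_subset[OF \<phi>(1)]) auto
    show "continuous_on (cball z \<rho>) \<phi>"
      by (intro holomorphic_on_imp_continuous_on holomorphic_on_subset[OF \<phi>(1)] sub)
    fix x assume "norm (z - x) = \<rho>"
    then have "x \<in> ball 0 1" using sub by (auto simp: dist_norm)
    then show "norm (\<phi> x) \<le> 1" using \<phi>(2)[of x] by simp
  qed (rule \<rho>)
  then have "norm (deriv \<phi> z) \<le> 1 / \<rho>" by simp
  moreover have "1 - (norm z)\<^sup>2 \<le> 4 * \<rho>"
  proof -
    have "1 - (norm z)\<^sup>2 = (1 - norm z) * (1 + norm z)" by (simp add: power2_eq_square algebra_simps)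
    also have "\<dots> \<le> (1 - norm z) * 2" using z by (intro mult_left_mono) auto
    finally show ?thesis by (simp add: \<rho>_def)
  qed
  ultimately have "(1 - (norm z)\<^sup>2) * norm (deriv \<phi> z) \<le> (4 * \<rho>) * (1 / \<rho>)"
    using \<rho> by (intro mult_mono) auto
  then show ?thesis using \<rho> by simp
qed

context
  fixes i :: quat and \<Phi> :: "quat \<Rightarrow> quat" and \<phi> :: "complex \<Rightarrow> complex"
  assumes i: "i \<in> imag_units"
    and hol: "\<phi> holomorphic_on ball 0 1" and bd: "\<And>z. norm z < 1 \<Longrightarrow> norm (\<phi> z) < 1"
    and \<Phi>: "\<And>z. norm z < 1 \<Longrightarrow> \<Phi> (slice i z) = slice i (\<phi> z)"
begin

lemma deriv_comp_op:
  assumes "slice_regular f" "norm z < 1"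
  shows "deriv_x0 (comp_op i \<Phi> f) (slice i z) = slice i (deriv \<phi> z) * deriv_x0 f (slice i (\<phi> z))"
  by (rule deriv_x0_comp_op[OF assms(1) i hol bd \<Phi> assms(2)])

text \<open>The derivative of \<open>\<sigma>\<^sub>a\<close> at \<open>a\<close> has modulus \<open>1 / (1 - \<bar>a\<bar>\<^sup>2)\<close>, so evaluating at \<open>z\<close> with \<open>a = \<phi> z\<close>
  recovers the hyperbolic derivative of \<open>\<phi>\<close>.\<close>

lemma hyperbolic_derivative_le:
  assumes z: "norm z < 1"
  shows "ennreal ((1 - (norm z)\<^sup>2) * norm (deriv \<phi> z) / (1 - (norm (\<phi> z))\<^sup>2))
    \<le> bloch_seminorm (comp_op i \<Phi> (qmoebius (slice i (\<phi> z))))"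
proof -
  let ?\<alpha> = "\<phi> z"
  have \<alpha>: "norm ?\<alpha> < 1" by (rule bd[OF z])
  then have a: "norm (slice i ?\<alpha>) < 1" by (simp add: norm_slice[OF i])
  have pos: "0 < 1 - (norm ?\<alpha>)\<^sup>2" using \<alpha> by (simp add: power_less_one_iff)
  have "1 - cnj ?\<alpha> * ?\<alpha> = of_real (1 - (norm ?\<alpha>)\<^sup>2)"
    using complex_norm_square[of ?\<alpha>] by (simp add: mult.commute)
  then have "norm (1 - cnj ?\<alpha> * ?\<alpha>) = 1 - (norm ?\<alpha>)\<^sup>2" using pos by (simp only: norm_of_real)
  then have "norm (deriv (disc_moebius ?\<alpha>) ?\<alpha>) = 1 / (1 - (norm ?\<alpha>)\<^sup>2)"
    unfolding norm_deriv_moebius[OF \<alpha> \<alpha>] using pos by (simp add: power2_eq_square[of "1 - _"])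
  then have "norm (deriv_x0 (comp_op i \<Phi> (qmoebius (slice i ?\<alpha>))) (slice i z)) = norm (deriv \<phi> z) / (1 - (norm ?\<alpha>)\<^sup>2)"
    unfolding deriv_comp_op[OF qmoebius_SR(2)[OF a] z] deriv_x0_qmoebius[OF i \<alpha> \<alpha>]
    by (simp add: norm_mult norm_slice[OF i])
  then show ?thesis
    using bloch_seminorm_ge[OF i z, of "comp_op i \<Phi> (qmoebius (slice i ?\<alpha>))"] by simp
qed

text \<open>The filter is pulled back along \<open>norm\<close>, so the smallness of the seminorm
  depends on |a| alone and applies to every a = \<phi> z with |\<phi> z| close to 1.\<close>

lemma hyperbolic_derivative_small:
  assumes lim: "((\<lambda>a. bloch_seminorm (comp_op i \<Phi> (qmoebius a))) \<longlongrightarrow> 0) (filtercomap norm (at_left 1))"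
    and \<epsilon>: "\<epsilon> > 0"
  obtains r where "0 \<le> r" "r < 1"
    "\<And>z. norm z < 1 \<Longrightarrow> r < norm (\<phi> z) \<Longrightarrow> (1 - (norm z)\<^sup>2) * norm (deriv \<phi> z) \<le> \<epsilon> * (1 - (norm (\<phi> z))\<^sup>2)"
proof -
  have "\<forall>\<^sub>F a in filtercomap norm (at_left 1). bloch_seminorm (comp_op i \<Phi> (qmoebius a)) < ennreal \<epsilon>"
    using lim \<epsilon> by (intro order_tendstoD) auto
  then obtain Q where Q: "eventually Q (at_left (1::real))" "\<And>a. Q (norm a) \<Longrightarrow> bloch_seminorm (comp_op i \<Phi> (qmoebius a)) < ennreal \<epsilon>"
    unfolding eventually_filtercomap by blast
  then obtain b where b: "b < 1" "\<And>y. b < y \<Longrightarrow> y < 1 \<Longrightarrow> Q y" unfolding eventually_at_left_field by blast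
  show ?thesis
  \<comment> \<open>The threshold \<open>b\<close> delivered by \<open>at_left 1\<close> may be
    negative.\<close>
  proof (rule that[of "max 0 b"])
    fix z assume z: "norm z < 1" and r: "max 0 b < norm (\<phi> z)"
    have pos: "0 < 1 - (norm (\<phi> z))\<^sup>2" using bd[OF z] by (simp add: power_less_one_iff)
    have "Q (norm (slice i (\<phi> z)))" using b(2)[of "norm (\<phi> z)"] r bd[OF z] by (simp add: norm_slice[OF i])
    then have "ennreal ((1 - (norm z)\<^sup>2) * norm (deriv \<phi> z) / (1 - (norm (\<phi> z))\<^sup>2)) < ennreal \<epsilon>"
      using hyperbolic_derivative_le[OF z] Q(2) by (meson le_less_trans)
    then have "\<not> \<epsilon> \<le> (1 - (norm z)\<^sup>2) * norm (deriv \<phi> z) / (1 - (norm (\<phi> z))\<^sup>2)"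
      using ennreal_leI leD by blast
    then show "(1 - (norm z)\<^sup>2) * norm (deriv \<phi> z) \<le> \<epsilon> * (1 - (norm (\<phi> z))\<^sup>2)"
      using pos by (simp add: not_le divide_less_eq)
  qed (use b in auto)
qed

lemma comp_op_slice_regular:
  assumes "slice_regular f"
  shows "slice_regular (comp_op i \<Phi> f)"
proof -
  have "comp_op i \<Phi> f \<in> SR" by (rule comp_op_SR[OF assms i hol bd \<Phi>])
  then show ?thesis by (simp add: SR_def)
qed

lemma bloch_seminorm_comp_op_diff_le:
  assumes f: "slice_regular f" and g: "slice_regular g"
    and K: "\<And>z. norm z < 1 \<Longrightarrow> (1 - (norm z)\<^sup>2) * norm (deriv \<phi> z) *
        norm (deriv_x0 f (slice i (\<phi> z)) - deriv_x0 g (slice i (\<phi> z))) \<le> K"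
  shows "bloch_seminorm (\<lambda>q. comp_op i \<Phi> f q - comp_op i \<Phi> g q) \<le> ennreal (2 * K)"
proof -
  obtain F where F: "ball_convergent F" "\<And>q. q \<in> qball \<Longrightarrow> comp_op i \<Phi> f q = rps_eval F q"
    using comp_op_power_series[OF f i hol bd \<Phi>] by blast
  obtain G where G: "ball_convergent G" "\<And>q. q \<in> qball \<Longrightarrow> comp_op i \<Phi> g q = rps_eval G q"
    using comp_op_power_series[OF g i hol bd \<Phi>] by blast
  show ?thesis
  proof (rule bloch_seminorm_le[OF ball_convergent_diff[OF F(1) G(1)] _ i])
    show "comp_op i \<Phi> f q - comp_op i \<Phi> g q = rps_eval (F - G) q" if "q \<in> qball" for q
      using that by (simp only: F(2) G(2) rps_eval_diff[OF F(1) G(1)])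
    fix z assume z: "norm (z::complex) < 1"
    then have q: "slice i z \<in> qball" by (simp add: norm_slice[OF i])
    have "deriv_x0 (\<lambda>q. comp_op i \<Phi> f q - comp_op i \<Phi> g q) (slice i z) =
      slice i (deriv \<phi> z) * (deriv_x0 f (slice i (\<phi> z)) - deriv_x0 g (slice i (\<phi> z)))"
      unfolding deriv_x0_diff[OF comp_op_slice_regular[OF f] comp_op_slice_regular[OF g] q]
        deriv_comp_op[OF f z] deriv_comp_op[OF g z] by (rule right_diff_distrib[symmetric])
    then show "(1 - (norm z)\<^sup>2) * norm (deriv_x0 (\<lambda>q. comp_op i \<Phi> f q - comp_op i \<Phi> g q) (slice i z)) \<le> K"
      using K[OF z] by (simp only: norm_mult norm_slice[OF i] mult.assoc)
  qed
qed

text \<open>Where |\<phi> z| > r, the bound on the derivative of \<phi> meets the Bloch bound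
  \<open>L\<close> and yields \<epsilon> L; elsewhere (1 - |z|^2) |\<phi>' z| <= 4 meets the
  closeness \<delta>. It serves both for boundedness, with g = 0, and for convergence.\<close>

lemma bloch_seminorm_comp_op_diff_two_regimes:
  assumes f: "slice_regular f" and g: "slice_regular g"
    and r: "\<And>z. norm z < 1 \<Longrightarrow> r < norm (\<phi> z) \<Longrightarrow> (1 - (norm z)\<^sup>2) * norm (deriv \<phi> z) \<le> \<epsilon> * (1 - (norm (\<phi> z))\<^sup>2)"
    and \<epsilon>: "\<epsilon> \<ge> 0"
    and L: "\<And>w. norm w < 1 \<Longrightarrow> (1 - (norm w)\<^sup>2) * norm (deriv_x0 f (slice i w) - deriv_x0 g (slice i w)) \<le> L"
    and \<delta>: "\<And>w. norm w \<le> r \<Longrightarrow> norm w < 1 \<Longrightarrow> norm (deriv_x0 f (slice i w) - deriv_x0 g (slice i w)) \<le> \<delta>" "\<delta> \<ge> 0"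
  shows "bloch_seminorm (\<lambda>q. comp_op i \<Phi> f q - comp_op i \<Phi> g q) \<le> ennreal (2 * (4 * \<delta> + \<epsilon> * L))"
proof (rule bloch_seminorm_comp_op_diff_le[OF f g])
  \<comment> \<open>\<open>L\<close> is nonnegative because it bounds a norm at w = 0; the second
    case adds \<epsilon> L on the right.\<close>
  have "0 \<le> (1 - (norm (0::complex))\<^sup>2) * norm (deriv_x0 f (slice i 0) - deriv_x0 g (slice i 0))" by simp
  also have "\<dots> \<le> L" by (rule L) simp
  finally have L0: "0 \<le> L" .
  fix z assume z: "norm (z::complex) < 1"
  let ?D = "norm (deriv_x0 f (slice i (\<phi> z)) - deriv_x0 g (slice i (\<phi> z)))"
  show "(1 - (norm z)\<^sup>2) * norm (deriv \<phi> z) * ?D \<le> 4 * \<delta> + \<epsilon> * L"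
  proof (cases "r < norm (\<phi> z)")
    case True
    have "(1 - (norm z)\<^sup>2) * norm (deriv \<phi> z) * ?D \<le> \<epsilon> * (1 - (norm (\<phi> z))\<^sup>2) * ?D"
      by (rule mult_right_mono[OF r[OF z True]]) simp
    also have "\<dots> \<le> \<epsilon> * L" unfolding mult.assoc by (rule mult_left_mono[OF L[OF bd[OF z]] \<epsilon>])
    finally show ?thesis using \<delta>(2) by simp
  next
    case False
    have "(1 - (norm z)\<^sup>2) * norm (deriv \<phi> z) * ?D \<le> 4 * \<delta>"
      by (intro mult_mono holomorphic_disc_deriv_bound hol bd z \<delta>(1)) (use False in auto)
    then show ?thesis using \<epsilon> L0 by (simp add: add_increasing2)
  qed
qed

end

section \<open>Sufficiency\<close>

text \<open>By Bolzano-Weierstrass an accumulation point of each infinite subset is enough. It is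
  the limit of a subsequence of an injective sequence in that subset.\<close>

lemma (in Metric_space) compactin_closure_of_sequentially:
  assumes S: "S \<subseteq> M"
    and seq: "\<And>\<sigma> :: nat \<Rightarrow> 'a. range \<sigma> \<subseteq> S \<Longrightarrow> \<exists>l r. strict_mono r \<and> limitin mtopology (\<sigma> \<circ> r) l sequentially"
  shows "compactin mtopology (mtopology closure_of S)"
  unfolding compact_closure_of_eq_Bolzano_Weierstrass
proof (intro allI impI)
  fix T assume T: "infinite T \<and> T \<subseteq> S \<and> T \<subseteq> M"
  then obtain \<sigma> :: "nat \<Rightarrow> 'a" where \<sigma>: "inj \<sigma>" "range \<sigma> \<subseteq> T"
    using infinite_countable_subset by blast
  obtain l r where r: "strict_mono (r :: nat \<Rightarrow> nat)" and lim: "limitin mtopology (\<sigma> \<circ> r) l sequentially"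
    using seq[of \<sigma>] \<sigma>(2) T by blast
  have "l \<in> mtopology derived_set_of T"
    unfolding in_derived_set_of
  proof (intro conjI allI impI)
    show "l \<in> topspace mtopology" using lim by (rule limitin_topspace)
    fix U assume "l \<in> U \<and> openin mtopology U"
    then have "\<forall>\<^sub>F n in sequentially. (\<sigma> \<circ> r) n \<in> U" using lim by (simp add: limitin_def)
    then obtain N where N: "\<And>n. n \<ge> N \<Longrightarrow> \<sigma> (r n) \<in> U" by (auto simp: eventually_sequentially)
    \<comment> \<open>The limit may itself be a term of the sequence; of two consecutive, hence
      distinct, terms at least one differs from it.\<close>
    have "r N \<noteq> r (Suc N)" using r by (metis n_not_Suc_n strict_mono_eq)
    then have "\<sigma> (r N) \<noteq> \<sigma> (r (Suc N))" using \<sigma>(1) by (simp add: inj_eq)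
    then have "\<sigma> (r N) \<noteq> l \<or> \<sigma> (r (Suc N)) \<noteq> l" by auto
    then show "\<exists>y\<noteq>l. y \<in> T \<and> y \<in> U" using N[of N] N[of "Suc N"] \<sigma>(2) by auto
  qed
  then show "mtopology derived_set_of T \<noteq> {}" by auto
qed

section \<open>Normal families under a Bloch bound\<close>

lemma uniform_limit_deriv:
  fixes A :: "nat \<Rightarrow> complex \<Rightarrow> complex"
  assumes A: "\<And>n. A n holomorphic_on ball 0 1" and B: "B holomorphic_on ball 0 1"
    and lim: "\<And>K. compact K \<Longrightarrow> K \<subseteq> ball 0 1 \<Longrightarrow> uniform_limit K A B sequentially"
    and r: "r < 1" and \<delta>: "\<delta> > 0"
  shows "\<forall>\<^sub>F n in sequentially. \<forall>w. norm w \<le> r \<longrightarrow> norm (deriv (A n) w - deriv B w) \<le> \<delta>"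
proof -
  define \<rho> where "\<rho> = (1 - r) / 2"
  have \<rho>: "\<rho> > 0" "r + \<rho> < 1" using r by (simp_all add: \<rho>_def field_simps)
  have "uniform_limit (cball 0 (r + \<rho>)) A B sequentially"
    using \<rho> by (intro lim) auto
  \<comment> \<open>The tolerance \<delta> \<rho> is what Cauchy's estimate over radius \<rho> turns
    into \<delta>.\<close>
  then have "\<forall>\<^sub>F n in sequentially. \<forall>x\<in>cball 0 (r + \<rho>). dist (A n x) (B x) < \<delta> * \<rho>"
    using \<delta> \<rho> by (intro uniform_limitD) simp_all
  then show ?thesis
  proof eventually_elim
    case (elim n)
    show ?case
    proof (intro allI impI)
      fix w :: complex assume w: "norm w \<le> r"
      have sub: "cball w \<rho> \<subseteq> cball 0 (r + \<rho>)"
      proof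
        fix x assume "x \<in> cball w \<rho>"
        then show "x \<in> cball 0 (r + \<rho>)" using norm_triangle_ineq4[of w "w - x"] w by (simp add: dist_norm)
      qed
      have sub1: "cball w \<rho> \<subseteq> ball 0 1" using sub \<rho> by auto
      have w1: "w \<in> ball 0 1" using w r by simp
      have h: "(\<lambda>x. A n x - B x) holomorphic_on cball w \<rho>"
        by (intro holomorphic_intros holomorphic_on_subset[OF A sub1] holomorphic_on_subset[OF B sub1])
      have "norm ((deriv ^^ 1) (\<lambda>x. A n x - B x) w) \<le> fact 1 * (\<delta> * \<rho>) / \<rho> ^ 1"
      proof (rule Cauchy_inequality)
        show "(\<lambda>x. A n x - B x) holomorphic_on ball w \<rho>" by (rule holomorphic_on_subset[OF h]) auto
        show "continuous_on (cball w \<rho>) (\<lambda>x. A n x - B x)" by (rule holomorphic_on_imp_continuous_on[OF h])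
        fix x assume "norm (w - x) = \<rho>"
        then have "x \<in> cball 0 (r + \<rho>)" using sub by (auto simp: dist_norm)
        then show "norm (A n x - B x) \<le> \<delta> * \<rho>" using elim by (auto simp: dist_norm less_imp_le)
      qed (rule \<rho>)
      moreover have "deriv (\<lambda>x. A n x - B x) w = deriv (A n) w - deriv B w"
        by (intro deriv_diff holomorphic_on_imp_differentiable_at[OF _ open_ball w1] A B)
      ultimately show "norm (deriv (A n) w - deriv B w) \<le> \<delta>" using \<rho> by simp
    qed
  qed
qed

lemma bloch_bound_nonneg:
  fixes D :: "complex \<Rightarrow> 'a::real_normed_vector"
  assumes "\<And>w. norm w < 1 \<Longrightarrow> (1 - (norm w)\<^sup>2) * norm (D w) \<le> L"
  shows "0 \<le> L"
proof -
  have "(1 - (norm (0::complex))\<^sup>2) * norm (D 0) \<le> L" by (rule assms) simp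
  then have "norm (D 0) \<le> L" by simp
  then show ?thesis using norm_ge_zero order_trans by blast
qed

text \<open>Mean value inequality on the convex disc of radius \<open>r\<close>; it supplies the
  local boundedness required by Montel's theorem.\<close>

lemma norm_le_of_deriv_bound:
  assumes A: "A holomorphic_on ball 0 1"
    and L: "\<And>w. norm w < 1 \<Longrightarrow> (1 - (norm w)\<^sup>2) * norm (deriv A w) \<le> L"
    and r: "0 \<le> r" "r < 1" and z: "norm z \<le> r"
  shows "norm (A z) \<le> norm (A 0) + L / (1 - r\<^sup>2)"
proof -
  have r2: "0 < 1 - r\<^sup>2" using r by (simp add: power_less_one_iff)
  have "0 \<le> L" using L by (rule bloch_bound_nonneg)
  have "norm (A z - A 0) \<le> L / (1 - r\<^sup>2) * norm (z - 0)"
  proof (rule field_differentiable_bound[of "cball 0 r" A "deriv A"])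
    fix w :: complex assume w: "w \<in> cball 0 r"
    then show "(A has_field_derivative deriv A w) (at w within cball 0 r)"
      using r by (auto intro: has_field_derivative_at_within[OF holomorphic_derivI[OF A open_ball]])
    have "(norm w)\<^sup>2 \<le> r\<^sup>2" using w by (intro power_mono) auto
    then have "(1 - r\<^sup>2) * norm (deriv A w) \<le> (1 - (norm w)\<^sup>2) * norm (deriv A w)" by (intro mult_right_mono) auto
    also have "\<dots> \<le> L" using w r by (intro L) auto
    finally show "norm (deriv A w) \<le> L / (1 - r\<^sup>2)" using r2 by (simp add: pos_le_divide_eq mult.commute)
  qed (use r z in auto)
  also have "\<dots> \<le> L / (1 - r\<^sup>2) * 1"
    using r r2 z \<open>0 \<le> L\<close> by (intro mult_left_mono) auto
  finally show ?thesis using norm_triangle_ineq2[of "A z" "A 0"] by simp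
qed

lemma montel_disc:
  fixes A :: "nat \<Rightarrow> complex \<Rightarrow> complex"
  assumes A: "\<And>n. A n holomorphic_on ball 0 1" and A0: "\<And>n. norm (A n 0) \<le> M"
    and L: "\<And>n w. norm w < 1 \<Longrightarrow> (1 - (norm w)\<^sup>2) * norm (deriv (A n) w) \<le> L"
  obtains B s where "B holomorphic_on ball 0 1" "strict_mono (s :: nat \<Rightarrow> nat)"
    "\<And>K. compact K \<Longrightarrow> K \<subseteq> ball 0 1 \<Longrightarrow> uniform_limit K (A \<circ> s) B sequentially"
proof (rule Montel[of "ball 0 1" "range A" A])
  fix K :: "complex set" assume K: "compact K" "K \<subseteq> ball 0 1"
  obtain r where r: "0 \<le> r" "r < 1" "K \<subseteq> cball 0 r"
  proof (cases "K = {}")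
    case False
    obtain x where x: "x \<in> K" "\<And>y. y \<in> K \<Longrightarrow> norm y \<le> norm x"
      using continuous_attains_sup[OF K(1) False, of norm] continuous_on_norm_id by blast
    then show ?thesis using K(2) by (intro that[of "norm x"]) auto
  qed (use that[of 0] in auto)
  show "\<exists>B. \<forall>h\<in>range A. \<forall>z\<in>K. norm (h z) \<le> B"
  proof (intro exI ballI)
    fix h z assume "h \<in> range A" "z \<in> K"
    then obtain n where "h = A n" by auto
    moreover have "norm (A n z) \<le> norm (A n 0) + L / (1 - r\<^sup>2)"
      by (rule norm_le_of_deriv_bound[OF A L r(1,2)]) (use r(3) \<open>z \<in> K\<close> in auto)
    ultimately show "norm (h z) \<le> M + L / (1 - r\<^sup>2)" using A0[of n] by simp
  qed
qed (use A that in auto)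

text \<open>Montel's theorem, applied to the two holomorphic components of a Bloch-bounded sequence.\<close>

lemma bloch_bounded_subsequence:
  fixes f :: "nat \<Rightarrow> quat \<Rightarrow> quat"
  assumes i: "i \<in> imag_units" and f: "\<And>n. slice_regular (f n)" and f0: "\<And>n. norm (f n 0) \<le> M"
    and L: "\<And>n z. norm z < 1 \<Longrightarrow> (1 - (norm z)\<^sup>2) * norm (deriv_x0 (f n) (slice i z)) \<le> L"
  obtains g s where "slice_regular g" "strict_mono (s :: nat \<Rightarrow> nat)"
    "\<forall>z. norm z < 1 \<longrightarrow> (\<lambda>n. f (s n) (slice i z)) \<longlonglongrightarrow> g (slice i z)"
    "\<forall>r \<delta>. r < 1 \<longrightarrow> \<delta> > 0 \<longrightarrow> (\<forall>\<^sub>F n in sequentially. \<forall>w. norm w \<le> r \<longrightarrow>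
      norm (deriv_x0 (f (s n)) (slice i w) - deriv_x0 g (slice i w)) \<le> \<delta>)"
proof -
  obtain j where j: "j \<in> imag_units" "i * j = - (j * i)" using anticommuting_unit_exists[OF i] .
  define A where "A = (\<lambda>c n w. slice_coord i (f n (slice i w) * c))"
  have A: "A c n holomorphic_on ball 0 1" for c n
    unfolding A_def by (rule slice_coord_holomorphic[OF f i])
  have dA: "deriv (A c n) w = slice_coord i (deriv_x0 (f n) (slice i w) * c)" if "norm w < 1" for c n w
    unfolding A_def by (rule DERIV_imp_deriv[OF slice_coord_has_field_derivative[OF f i that]])
  have Ab: "norm (A c n 0) \<le> 2 * M" "norm w < 1 \<Longrightarrow> (1 - (norm w)\<^sup>2) * norm (deriv (A c n) w) \<le> 2 * L"
    if c: "norm c = 1" for c n w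
  proof -
    show "norm (A c n 0) \<le> 2 * M"
      using norm_slice_coord_le[OF i, of "f n 0 * c"] f0[of n] c by (simp add: A_def norm_mult)
    assume w: "norm w < 1"
    have "(1 - (norm w)\<^sup>2) * norm (deriv (A c n) w) \<le> (1 - (norm w)\<^sup>2) * (2 * norm (deriv_x0 (f n) (slice i w)))"
      using norm_slice_coord_le[OF i, of "deriv_x0 (f n) (slice i w) * c"] c w
      by (intro mult_left_mono) (auto simp: dA norm_mult power_le_one)
    then show "(1 - (norm w)\<^sup>2) * norm (deriv (A c n) w) \<le> 2 * L" using L[OF w, of n] by simp
  qed
  obtain B1 s1 where B1: "B1 holomorphic_on ball 0 1" and s1: "strict_mono (s1 :: nat \<Rightarrow> nat)"
    and lim1: "\<And>K. compact K \<Longrightarrow> K \<subseteq> ball 0 1 \<Longrightarrow> uniform_limit K (A 1 \<circ> s1) B1 sequentially"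
    by (rule montel_disc[of "A 1", OF A Ab]) auto
  \<comment> \<open>The second extraction runs along the first subsequence, so that both components
    converge along the same indices.\<close>
  obtain B2 s2 where B2: "B2 holomorphic_on ball 0 1" and s2: "strict_mono (s2 :: nat \<Rightarrow> nat)"
    and lim2: "\<And>K. compact K \<Longrightarrow> K \<subseteq> ball 0 1 \<Longrightarrow> uniform_limit K ((A (- j) \<circ> s1) \<circ> s2) B2 sequentially"
    by (rule montel_disc[of "A (- j) \<circ> s1" "2 * M" "2 * L"]) (use A Ab[of "- j"] imag_units_norm[OF j(1)] in auto)
  define s where "s = s1 \<circ> s2"
  have s: "strict_mono s" unfolding s_def by (rule strict_mono_o[OF s1 s2])
  have l1: "uniform_limit K (\<lambda>n. A 1 (s n)) B1 sequentially" if "compact K" "K \<subseteq> ball 0 1" for K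
    using filterlim_compose[OF lim1[OF that] filterlim_subseq[OF s2]] by (simp add: s_def o_def)
  have l2: "uniform_limit K (\<lambda>n. A (- j) (s n)) B2 sequentially" if "compact K" "K \<subseteq> ball 0 1" for K
    using lim2[OF that] by (simp add: s_def o_def)
  obtain F where F: "ball_convergent F"
    "\<And>z. norm z < 1 \<Longrightarrow> rps_eval F (slice i z) = slice i (B1 z) + slice i (B2 z) * j"
    using rps_eval_of_holomorphic_pair[OF i B1 B2, of j] by blast
  let ?g = "rps_eval F"
  have g: "slice_regular ?g" by (rule slice_regular_rps_eval[OF F(1) refl])
  \<comment> \<open>The components of the reassembled function are the limits themselves. The
    projection kills \<open>j\<close> because i j i = j, so the splitting is unique.\<close>
  have gc: "slice_coord i (?g (slice i w) * 1) = B1 w" "slice_coord i (?g (slice i w) * (- j)) = B2 w" if "norm w < 1" for w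
  proof -
    have 0: "slice_coord i j = 0"
    proof -
      have "i * j * i = j" by (simp add: j(2) mult.assoc imag_units_mult_self[OF i])
      then have "slice i (slice_coord i j) = 0" by (simp add: slice_slice_coord[OF i])
      then have "norm (slice i (slice_coord i j)) = 0" by simp
      then show ?thesis by (simp add: norm_slice[OF i])
    qed
    have 1: "slice_coord i 1 = 1" using slice_coord_slice[OF i, of 1] by simp
    have lin: "slice_coord i (x + y) = slice_coord i x + slice_coord i y" for x y
      using bounded_linear_slice_coord by (simp add: linear_add bounded_linear.linear)
    show "slice_coord i (?g (slice i w) * 1) = B1 w"
      by (simp add: F(2)[OF that] lin slice_coord_mult[OF i] slice_coord_slice[OF i] 0)
    have "?g (slice i w) * (- j) = slice i (B2 w) * 1 + slice i (B1 w) * (- j)"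
      by (simp add: F(2)[OF that] distrib_right mult.assoc imag_units_mult_self[OF j(1)])
    moreover have "slice_coord i (- j) = 0"
      using 0 linear_neg[OF bounded_linear.linear[OF bounded_linear_slice_coord], of i j] by simp
    ultimately show "slice_coord i (?g (slice i w) * (- j)) = B2 w"
      by (simp only: lin slice_coord_mult[OF i] 1) simp
  qed
  have dB: "deriv B1 w = slice_coord i (deriv_x0 ?g (slice i w) * 1)"
    "deriv B2 w = slice_coord i (deriv_x0 ?g (slice i w) * (- j))" if "norm w < 1" for w
  proof -
    have "(B1 has_field_derivative slice_coord i (deriv_x0 ?g (slice i w) * 1)) (at w)"
      by (rule has_field_derivative_transform_within_open[OF slice_coord_has_field_derivative[OF g i that, of 1] open_ball[of 0 1]])
        (use that gc(1) in auto)
    then show "deriv B1 w = slice_coord i (deriv_x0 ?g (slice i w) * 1)" by (rule DERIV_imp_deriv)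
    have "(B2 has_field_derivative slice_coord i (deriv_x0 ?g (slice i w) * (- j))) (at w)"
      by (rule has_field_derivative_transform_within_open[OF slice_coord_has_field_derivative[OF g i that, of "- j"] open_ball[of 0 1]])
        (use that gc(2) in auto)
    then show "deriv B2 w = slice_coord i (deriv_x0 ?g (slice i w) * (- j))" by (rule DERIV_imp_deriv)
  qed
  have diff: "slice_coord i ((x - y) * c) = slice_coord i (x * c) - slice_coord i (y * c)" for x y c
    using linear_diff[OF bounded_linear.linear[OF bounded_linear_slice_coord]] by (simp add: left_diff_distrib)
  have conv: "(\<lambda>n. f (s n) (slice i z)) \<longlonglongrightarrow> ?g (slice i z)" if z: "norm z < 1" for z
  proof -
    have "(\<lambda>n. A 1 (s n) z) \<longlonglongrightarrow> B1 z" "(\<lambda>n. A (- j) (s n) z) \<longlonglongrightarrow> B2 z"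
      using l1[of "{z}"] l2[of "{z}"] z by (auto intro: tendsto_uniform_limitI)
    then have "(\<lambda>n. slice i (A 1 (s n) z) + slice i (A (- j) (s n) z) * j) \<longlonglongrightarrow> slice i (B1 z) + slice i (B2 z) * j"
      by (intro tendsto_intros bounded_linear.tendsto[OF bounded_linear_slice])
    moreover have "slice i (A 1 n z) + slice i (A (- j) n z) * j = f n (slice i z)" for n
      unfolding A_def using slice_coord_decomposition[OF i j, of "f n (slice i z)"] by simp
    ultimately show ?thesis using F(2)[OF z] by simp
  qed
  have dconv: "\<forall>\<^sub>F n in sequentially. \<forall>w. norm w \<le> r \<longrightarrow> norm (deriv_x0 (f (s n)) (slice i w) - deriv_x0 ?g (slice i w)) \<le> \<delta>"
    if r: "r < 1" and \<delta>: "\<delta> > 0" for r \<delta>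
  proof -
    have "\<forall>\<^sub>F n in sequentially. \<forall>w. norm w \<le> r \<longrightarrow> norm (deriv (A 1 (s n)) w - deriv B1 w) \<le> \<delta> / 2"
      by (rule uniform_limit_deriv[OF A B1 l1 r]) (use \<delta> in auto)
    moreover have "\<forall>\<^sub>F n in sequentially. \<forall>w. norm w \<le> r \<longrightarrow> norm (deriv (A (- j) (s n)) w - deriv B2 w) \<le> \<delta> / 2"
      by (rule uniform_limit_deriv[OF A B2 l2 r]) (use \<delta> in auto)
    ultimately show ?thesis
    proof eventually_elim
      case (elim n)
      show ?case
      proof (intro allI impI)
        fix w :: complex assume w: "norm w \<le> r"
        then have w1: "norm w < 1" using r by simp
        let ?d = "deriv_x0 (f (s n)) (slice i w) - deriv_x0 ?g (slice i w)"
        have "norm ?d \<le> norm (slice_coord i (?d * 1)) + norm (slice_coord i (?d * (- j)))"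
          by (rule norm_le_slice_coord[OF i j])
        also have "\<dots> = norm (deriv (A 1 (s n)) w - deriv B1 w) + norm (deriv (A (- j) (s n)) w - deriv B2 w)"
          by (simp only: diff dA[OF w1] dB[OF w1])
        also have "\<dots> \<le> \<delta> / 2 + \<delta> / 2" using elim w by (intro add_mono) auto
        finally show "norm ?d \<le> \<delta>" by simp
      qed
    qed
  qed
  show ?thesis by (rule that[of ?g s]) (use g s conv dconv in auto)
qed

lemma comp_op_0:
  assumes "i \<in> imag_units" "\<Phi> 0 = slice i w"
  shows "comp_op i \<Phi> f 0 = f (slice i w)"
  using comp_op_slice[OF assms(1), of 0 \<Phi> w f] assms by simp

text \<open>A single estimate carries both halves of compactness: comparison with the zero function
  shows that the range lies in \<open>Bloch\<close>, and comparison with the Montel limit gives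
  convergence of subsequences.\<close>

lemma compact_comp_op_if_vanishing:
  assumes p: "p > 1" and i: "i \<in> imag_units"
    and hol: "\<phi> holomorphic_on ball 0 1" and bd: "\<And>z. norm z < 1 \<Longrightarrow> norm (\<phi> z) < 1"
    and \<Phi>: "\<And>z. norm z < 1 \<Longrightarrow> \<Phi> (slice i z) = slice i (\<phi> z)"
    and lim: "((\<lambda>a. bloch_seminorm (comp_op i \<Phi> (qmoebius a))) \<longlongrightarrow> 0) (filtercomap norm (at_left 1))"
  shows "compact_Besov_Bloch p (comp_op i \<Phi>)"
proof -
  let ?T = "comp_op i \<Phi>"
  have TSR: "?T f \<in> SR" if "slice_regular f" for f by (rule comp_op_SR[OF that i hol bd \<Phi>])
  have z0: "slice_regular (\<lambda>q. 0)" by (simp add: slice_regular_def)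
  have T0: "?T (\<lambda>q. 0) q = 0" if "q \<in> qball" for q
    using that by (simp add: comp_op_def slice_extend_def o_def)
  have d0: "deriv_x0 (\<lambda>q. 0) q = 0" for q by (simp add: deriv_x0_def)
  have small: "\<exists>r. 0 \<le> r \<and> r < 1 \<and> (\<forall>z. norm z < 1 \<longrightarrow> r < norm (\<phi> z) \<longrightarrow>
      (1 - (norm z)\<^sup>2) * norm (deriv \<phi> z) \<le> \<epsilon> * (1 - (norm (\<phi> z))\<^sup>2))" if "\<epsilon> > 0" for \<epsilon>
    using hyperbolic_derivative_small[OF i hol bd \<Phi> lim that] by metis
  have T_Bloch: "?T f \<in> Bloch"
    if f: "slice_regular f" and L: "\<And>z. norm z < 1 \<Longrightarrow> (1 - (norm z)\<^sup>2) * norm (deriv_x0 f (slice i z)) \<le> L" for f L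
  proof -
    obtain r where r: "0 \<le> r" "r < 1" "\<And>z. norm z < 1 \<Longrightarrow> r < norm (\<phi> z) \<Longrightarrow>
      (1 - (norm z)\<^sup>2) * norm (deriv \<phi> z) \<le> 1 * (1 - (norm (\<phi> z))\<^sup>2)" using small[of 1] by auto
    have r2: "0 < 1 - r\<^sup>2" using r by (simp add: power_less_one_iff)
    have "0 \<le> L" using L by (rule bloch_bound_nonneg)
    \<comment> \<open>The two regimes with g = 0 and \<epsilon> = 1. On |w| <= r the Bloch bound
      divided by 1 - r^2 bounds the derivative itself.\<close>
    have "bloch_seminorm (\<lambda>q. ?T f q - ?T (\<lambda>q. 0) q) \<le> ennreal (2 * (4 * (L / (1 - r\<^sup>2)) + 1 * L))"
    proof (rule bloch_seminorm_comp_op_diff_two_regimes[OF i hol bd \<Phi> f z0 r(3)])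
      fix w :: complex assume w: "norm w < 1"
      show "(1 - (norm w)\<^sup>2) * norm (deriv_x0 f (slice i w) - deriv_x0 (\<lambda>q. 0) (slice i w)) \<le> L"
        using L[OF w] by (simp add: d0)
      assume "norm w \<le> r"
      then have "(norm w)\<^sup>2 \<le> r\<^sup>2" by (intro power_mono) auto
      then have "(1 - r\<^sup>2) * norm (deriv_x0 f (slice i w)) \<le> (1 - (norm w)\<^sup>2) * norm (deriv_x0 f (slice i w))"
        by (intro mult_right_mono) auto
      also have "\<dots> \<le> L" by (rule L[OF w])
      finally show "norm (deriv_x0 f (slice i w) - deriv_x0 (\<lambda>q. 0) (slice i w)) \<le> L / (1 - r\<^sup>2)"
        using r2 by (simp add: d0 pos_le_divide_eq mult.commute)
    qed (use r2 \<open>0 \<le> L\<close> in auto)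
    \<comment> \<open>\<open>?T\<close> of the zero function is zero only on the ball and
      \<open>undefined\<close> outside, so derivatives are compared at points of the ball.\<close>
    moreover have "bloch_seminorm (\<lambda>q. ?T f q - ?T (\<lambda>q. 0) q) = bloch_seminorm (?T f)"
      unfolding bloch_seminorm_def
    proof (intro SUP_cong refl)
      fix I q assume "q \<in> slice_ball I"
      then have q: "q \<in> qball" by (rule slice_ball_qball)
      have "slice_regular (?T f)" "slice_regular (?T (\<lambda>q. 0))" using TSR[OF f] TSR[OF z0] by (auto simp: SR_def)
      moreover have "deriv_x0 (?T (\<lambda>q. 0)) q = 0"
      proof -
        have "deriv_x0 (?T (\<lambda>q. 0)) q = rps_eval (fps_deriv 0) q"
          by (rule deriv_x0_rps_eval[OF _ _ q]) (auto simp: ball_convergent_def T0 rps_eval_def)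
        then show ?thesis by (simp add: rps_eval_def)
      qed
      ultimately show "ennreal ((1 - (norm q)\<^sup>2) * norm (deriv_x0 (\<lambda>q. ?T f q - ?T (\<lambda>q. 0) q) q)) =
         ennreal ((1 - (norm q)\<^sup>2) * norm (deriv_x0 (?T f) q))"
        using q by (simp add: deriv_x0_diff)
    qed
    ultimately have "bloch_seminorm (?T f) < \<infinity>" by (simp add: order_le_less_trans)
    then show ?thesis using TSR[OF f] by (simp add: Bloch_def)
  qed
  obtain C where C: "C \<ge> 0" "\<And>f i z. f \<in> Besov p \<Longrightarrow> i \<in> imag_units \<Longrightarrow> norm z < 1 \<Longrightarrow>
      (1 - (norm z)\<^sup>2) * norm (deriv_x0 f (slice i z)) \<le> C * besov_norm p f"
    using besov_bloch_on_slice[OF p] by blast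
  have Besov_sr: "slice_regular f" if "f \<in> Besov p" for f using that by (simp add: Besov_def SR_def)
  have TB: "?T ` Besov p \<subseteq> Bloch"
    using T_Bloch[OF Besov_sr C(2)[OF _ i]] by blast
  interpret Metric_space Bloch bloch_dist by (rule Metric_space_Bloch)
  show ?thesis
    unfolding compact_Besov_Bloch_def
  proof (intro conjI allI impI TB)
    fix F assume F: "F \<subseteq> Besov p" and "bdd_above (besov_norm p ` F)"
    then obtain M where M: "\<And>f. f \<in> F \<Longrightarrow> besov_norm p f \<le> M" unfolding bdd_above_def by auto
    show "compactin mtopology (mtopology closure_of (?T ` F))"
    proof (rule compactin_closure_of_sequentially)
      show "?T ` F \<subseteq> Bloch" using F TB by blast
      fix \<sigma> :: "nat \<Rightarrow> quat \<Rightarrow> quat" assume "range \<sigma> \<subseteq> ?T ` F"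
      then have "\<forall>n. \<exists>f. f \<in> F \<and> \<sigma> n = ?T f" by blast
      then obtain f where f: "\<And>n. f n \<in> F" "\<And>n. \<sigma> n = ?T (f n)" by metis
      have fB: "f n \<in> Besov p" for n using f(1) F by blast
      have fs: "slice_regular (f n)" for n by (rule Besov_sr[OF fB])
      define L where "L = C * M"
      have fL: "(1 - (norm z)\<^sup>2) * norm (deriv_x0 (f n) (slice i z)) \<le> L" if "norm z < 1" for n z
        using C(2)[OF fB i that, of n] mult_left_mono[OF M[OF f(1)] C(1), of n] by (simp add: L_def)
      have f0: "norm (f n 0) \<le> M" for n
      proof -
        have "norm (f n 0) \<le> besov_norm p (f n)" by (simp add: besov_norm_def)
        then show ?thesis using M[OF f(1), of n] by simp
      qed
      obtain g s where g: "slice_regular g" and s: "strict_mono (s :: nat \<Rightarrow> nat)"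
        and conv': "\<forall>z. norm z < 1 \<longrightarrow> (\<lambda>n. f (s n) (slice i z)) \<longlonglongrightarrow> g (slice i z)"
        and dconv': "\<forall>r \<delta>. r < 1 \<longrightarrow> \<delta> > 0 \<longrightarrow> (\<forall>\<^sub>F n in sequentially. \<forall>w. norm w \<le> r \<longrightarrow>
          norm (deriv_x0 (f (s n)) (slice i w) - deriv_x0 g (slice i w)) \<le> \<delta>)"
        by (rule bloch_bounded_subsequence[OF i fs f0 fL])
      note conv = conv'[rule_format] and dconv = dconv'[THEN spec, THEN spec, THEN mp, THEN mp]
      have gL: "(1 - (norm z)\<^sup>2) * norm (deriv_x0 g (slice i z)) \<le> L" if z: "norm z < 1" for z
      proof (rule tendsto_upperbound)
        have "(\<lambda>n. deriv_x0 (f (s n)) (slice i z)) \<longlonglongrightarrow> deriv_x0 g (slice i z)"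
        proof (rule tendstoI)
          fix e :: real assume e: "e > 0"
          show "\<forall>\<^sub>F n in sequentially. dist (deriv_x0 (f (s n)) (slice i z)) (deriv_x0 g (slice i z)) < e"
            using dconv[OF z, of "e / 2"] e by (auto elim!: eventually_mono simp: dist_norm dest!: spec[of _ z])
        qed
        then show "(\<lambda>n. (1 - (norm z)\<^sup>2) * norm (deriv_x0 (f (s n)) (slice i z))) \<longlonglongrightarrow> (1 - (norm z)\<^sup>2) * norm (deriv_x0 g (slice i z))"
          by (intro tendsto_intros)
        show "\<forall>\<^sub>F n in sequentially. (1 - (norm z)\<^sup>2) * norm (deriv_x0 (f (s n)) (slice i z)) \<le> L"
          using fL[OF z] by simp
      qed simp
      have "0 \<le> L" using fL by (rule bloch_bound_nonneg)
      have dL: "(1 - (norm w)\<^sup>2) * norm (deriv_x0 (f n) (slice i w) - deriv_x0 g (slice i w)) \<le> 2 * L" if w: "norm w < 1" for n w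
      proof -
        have "(1 - (norm w)\<^sup>2) * norm (deriv_x0 (f n) (slice i w) - deriv_x0 g (slice i w))
          \<le> (1 - (norm w)\<^sup>2) * (norm (deriv_x0 (f n) (slice i w)) + norm (deriv_x0 g (slice i w)))"
          by (intro mult_left_mono norm_triangle_ineq4) (use w in \<open>simp add: power_le_one\<close>)
        then show ?thesis using fL[OF w, of n] gL[OF w] by (simp add: distrib_left)
      qed
      have "limitin mtopology (\<sigma> \<circ> s) (?T g) sequentially"
        unfolding limit_metric_sequentially
      proof (intro conjI allI impI)
        show "?T g \<in> Bloch" by (rule T_Bloch[OF g gL])
        fix \<eta> :: real assume \<eta>: "\<eta> > 0"
        \<comment> \<open>With the Bloch bound 2 L for differences, 2 (4 \<delta> + \<epsilon> 2 L)
          <= \<eta> / 2; the other half of \<eta> is for the value at 0. Using L + 1 avoids division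
          by zero.\<close>
        define \<epsilon> where "\<epsilon> = \<eta> / (16 * (L + 1))"
        have \<epsilon>: "\<epsilon> > 0" "\<epsilon> * L \<le> \<eta> / 16"
          using \<eta> \<open>0 \<le> L\<close> by (simp_all add: \<epsilon>_def field_simps)
        define \<delta> where "\<delta> = \<eta> / 32"
        have \<delta>: "\<delta> > 0" using \<eta> by (simp add: \<delta>_def)
        obtain r where r: "0 \<le> r" "r < 1" "\<And>z. norm z < 1 \<Longrightarrow> r < norm (\<phi> z) \<Longrightarrow>
          (1 - (norm z)\<^sup>2) * norm (deriv \<phi> z) \<le> \<epsilon> * (1 - (norm (\<phi> z))\<^sup>2)" using small[OF \<epsilon>(1)] by auto
        \<comment> \<open>The term |f(0)| of the Bloch norm becomes the value at \<phi> 0 after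
          composition, so pointwise convergence at that point handles it.\<close>
        have \<phi>0: "norm (\<phi> 0) < 1" "\<Phi> 0 = slice i (\<phi> 0)" using bd[of 0] \<Phi>[of 0] by simp_all
        have "\<forall>\<^sub>F n in sequentially. dist (f (s n) (slice i (\<phi> 0))) (g (slice i (\<phi> 0))) < \<eta> / 2"
          using conv[OF \<phi>0(1)] \<eta> by (intro tendstoD) simp_all
        moreover note dconv[OF r(2) \<delta>]
        ultimately have "\<forall>\<^sub>F n in sequentially. bloch_dist ((\<sigma> \<circ> s) n) (?T g) < \<eta>"
        proof eventually_elim
          case (elim n)
          let ?h = "\<lambda>q. ?T (f (s n)) q - ?T g q"
          have "bloch_seminorm ?h \<le> ennreal (2 * (4 * \<delta> + \<epsilon> * (2 * L)))"
            by (rule bloch_seminorm_comp_op_diff_two_regimes[OF i hol bd \<Phi> fs g r(3)])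
              (use \<epsilon> \<delta> dL elim(2) in auto)
          also have "\<dots> \<le> ennreal (\<eta> / 2)"
            using \<epsilon>(2) by (intro ennreal_leI) (simp add: \<delta>_def)
          finally have "enn2real (bloch_seminorm ?h) \<le> \<eta> / 2" using \<eta> by (intro enn2real_leI) auto
          moreover have "norm (?h 0) < \<eta> / 2"
            using elim(1) by (simp add: comp_op_0[OF i, of \<Phi> "\<phi> 0"] \<phi>0(2) dist_norm)
          ultimately show ?case by (simp add: bloch_dist_def bloch_norm_def f(2))
        qed
        moreover have "(\<sigma> \<circ> s) n \<in> Bloch" for n using TB fB by (auto simp: f(2))
        ultimately show "\<exists>N. \<forall>n\<ge>N. (\<sigma> \<circ> s) n \<in> Bloch \<and> bloch_dist ((\<sigma> \<circ> s) n) (?T g) < \<eta>"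
          unfolding eventually_sequentially by blast
      qed
      then show "\<exists>l r. strict_mono r \<and> limitin mtopology (\<sigma> \<circ> r) l sequentially" using s by blast
    qed
  qed
qed

section \<open>Necessity\<close>

text \<open>A limit point is determined only up to a constant. That suffices, since subtracting a
  function with zero derivative does not change the seminorm.\<close>

lemma vanishing_if_compact_comp_op:
  assumes p: "p > 1" and i: "i \<in> imag_units"
    and hol: "\<phi> holomorphic_on ball 0 1" and bd: "\<And>z. norm z < 1 \<Longrightarrow> norm (\<phi> z) < 1"
    and \<Phi>: "\<And>z. norm z < 1 \<Longrightarrow> \<Phi> (slice i z) = slice i (\<phi> z)"
    and cpt: "compact_Besov_Bloch p (comp_op i \<Phi>)"
  shows "((\<lambda>a. bloch_seminorm (comp_op i \<Phi> (qmoebius a))) \<longlongrightarrow> 0) (filtercomap norm (at_left 1))"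
proof (rule order_tendstoI)
  let ?T = "comp_op i \<Phi>"
  interpret Metric_space Bloch bloch_dist by (rule Metric_space_Bloch)
  fix e :: ennreal assume e: "0 < e"
  show "\<forall>\<^sub>F a in filtercomap norm (at_left 1). bloch_seminorm (?T (qmoebius a)) < e"
  proof (rule ccontr)
    assume contra: "\<not> ?thesis"
    \<comment> \<open>Otherwise the interval from \<open>b\<close> to 1 would witness the eventual
      bound in \<open>at_left 1\<close>.\<close>
    have "\<exists>a. b < norm a \<and> norm a < 1 \<and> e \<le> bloch_seminorm (?T (qmoebius a))" if "b < 1" for b
    proof (rule ccontr)
      assume "\<not> ?thesis"
      then have "\<forall>a. norm a \<in> {b<..<1} \<longrightarrow> bloch_seminorm (?T (qmoebius a)) < e" by (auto simp: not_le)
      with eventually_at_left_real[OF that] have "\<forall>\<^sub>F a in filtercomap norm (at_left 1). bloch_seminorm (?T (qmoebius a)) < e"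
        unfolding eventually_filtercomap by blast
      with contra show False by contradiction
    qed
    then have "\<forall>n. \<exists>a. 1 - 1 / real (Suc n) < norm a \<and> norm a < 1 \<and> e \<le> bloch_seminorm (?T (qmoebius a))"
      by simp
    then obtain a where a: "\<And>n. 1 - 1 / real (Suc n) < norm (a n)" "\<And>n. norm (a n) < 1"
      "\<And>n. e \<le> bloch_seminorm (?T (qmoebius (a n)))" by metis
    have alim: "(\<lambda>n. norm (a n)) \<longlonglongrightarrow> 1"
    proof (rule tendsto_sandwich)
      show "(\<lambda>n. 1 - 1 / real (Suc n)) \<longlonglongrightarrow> 1"
        using tendsto_diff[OF tendsto_const LIMSEQ_inverse_real_of_nat, of 1] by (simp add: inverse_eq_divide)
    qed (use a in \<open>auto intro!: always_eventually less_imp_le\<close>)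
    obtain K where K: "K < \<infinity>" "\<And>a. norm a < 1 \<Longrightarrow> besov_energy p (qmoebius a) \<le> K"
      using besov_energy_qmoebius[OF p] by blast
    define F where "F = range (\<lambda>n. qmoebius (a n))"
    have FB: "F \<subseteq> Besov p"
      using K qmoebius_SR(1)[OF a(2)] by (auto simp: F_def Besov_def intro: le_less_trans[OF K(2)[OF a(2)]])
    have "besov_norm p f \<le> 1 + enn2real K powr (1 / p)" if fF: "f \<in> F" for f
    proof -
      obtain n where f: "f = qmoebius (a n)" using fF by (auto simp: F_def)
      obtain j \<alpha> where j: "j \<in> imag_units" and an: "a n = slice j \<alpha>" by (rule slice_cases)
      have \<alpha>: "norm \<alpha> < 1" using a(2)[of n] by (simp add: an norm_slice[OF j])
      have "f 0 = a n" using qmoebius_slice[OF j \<alpha>, of 0] by (simp add: f an disc_moebius_def)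
      then have "norm (f 0) \<le> 1" using a(2)[of n] by simp
      moreover have "enn2real (besov_energy p f) powr (1 / p) \<le> enn2real K powr (1 / p)"
        using p K(1) K(2)[OF a(2), of n] by (intro powr_mono2 enn2real_mono) (auto simp: f)
      ultimately show ?thesis by (simp add: besov_norm_def)
    qed
    then have "bdd_above (besov_norm p ` F)" by (rule bdd_aboveI2)
    then have cp: "compactin mtopology (mtopology closure_of (?T ` F))" and TB: "?T ` Besov p \<subseteq> Bloch"
      using cpt FB by (auto simp: compact_Besov_Bloch_def)
    define \<sigma> where "\<sigma> = (\<lambda>n. ?T (qmoebius (a n)))"
    have \<sigma>F: "\<sigma> n \<in> ?T ` F" for n by (auto simp: \<sigma>_def F_def)
    have \<sigma>B: "\<sigma> n \<in> Bloch" for n using \<sigma>F FB TB by blast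
    have "?T ` F \<subseteq> topspace mtopology" using FB TB by auto
    from closure_of_subset[OF this] have "range \<sigma> \<subseteq> mtopology closure_of (?T ` F)" using \<sigma>F by blast
    then obtain l r where r: "strict_mono (r :: nat \<Rightarrow> nat)" and lim: "limitin mtopology (\<sigma> \<circ> r) l sequentially"
      using cp unfolding compactin_sequentially by blast
    have lB: "l \<in> Bloch" using lim limitin_topspace by fastforce
    have dist0: "(\<lambda>n. bloch_dist (\<sigma> (r n)) l) \<longlonglongrightarrow> 0"
      using lim unfolding limitin_metric_dist_null by (simp add: o_def)
    have sr: "slice_regular (\<sigma> n)" "slice_regular l" for n using \<sigma>B lB by (auto simp: Bloch_def SR_def)
    have fin: "bloch_seminorm (\<lambda>q. \<sigma> n q - l q) < \<infinity>" for n by (rule bloch_seminorm_diff_finite[OF \<sigma>B lB])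
    have alr: "(\<lambda>n. 1 - (norm (a (r n)))\<^sup>2) \<longlonglongrightarrow> 0"
      using tendsto_diff[OF tendsto_const[of 1] tendsto_power[OF LIMSEQ_subseq_LIMSEQ[OF alim r], of 2]] by (simp add: o_def)
    have dl: "deriv_x0 l q = 0" if q: "q \<in> qball" for q
    proof -
      obtain I z where I: "I \<in> imag_units" and qz: "q = slice I z" by (rule slice_cases)
      have z: "norm z < 1" using q by (simp add: qz norm_slice[OF I])
      let ?c = "\<lambda>w. norm (deriv \<phi> w) * (2 / (1 - norm (\<phi> w))\<^sup>2)"
      \<comment> \<open>The constant depends on \<open>w\<close> but not on \<open>n\<close>, so the
        factor 1 - |a n|^2 forces decay. Pointwise decay is enough, because convergence in the Bloch
        metric determines derivatives pointwise.\<close>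
      have on_slice: "norm (deriv_x0 (\<sigma> n) (slice i w)) \<le> ?c w * (1 - (norm (a n))\<^sup>2)" if w: "norm w < 1" for n w
      proof -
        have "slice i (\<phi> w) \<in> qball" using bd[OF w] by (simp add: norm_slice[OF i])
        from norm_deriv_x0_qmoebius_locally[OF a(2) this, of n]
        have le: "norm (deriv_x0 (qmoebius (a n)) (slice i (\<phi> w))) \<le> 2 * (1 - (norm (a n))\<^sup>2) / (1 - norm (\<phi> w))\<^sup>2"
          by (simp only: norm_slice[OF i])
        have "deriv_x0 (\<sigma> n) (slice i w) = slice i (deriv \<phi> w) * deriv_x0 (qmoebius (a n)) (slice i (\<phi> w))"
          unfolding \<sigma>_def by (rule deriv_comp_op[OF i hol bd \<Phi> qmoebius_SR(2)[OF a(2)] w])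
        then have "norm (deriv_x0 (\<sigma> n) (slice i w)) = norm (deriv \<phi> w) * norm (deriv_x0 (qmoebius (a n)) (slice i (\<phi> w)))"
          by (simp only: norm_mult norm_slice[OF i])
        also have "\<dots> \<le> norm (deriv \<phi> w) * (2 * (1 - (norm (a n))\<^sup>2) / (1 - norm (\<phi> w))\<^sup>2)"
          by (rule mult_left_mono[OF le]) simp
        also have "\<dots> = ?c w * (1 - (norm (a n))\<^sup>2)"
          by (simp only: times_divide_eq_left times_divide_eq_right mult.assoc)
        finally show ?thesis .
      qed
      have "norm (deriv_x0 (\<sigma> n) q) \<le> (?c z + ?c (cnj z)) * (1 - (norm (a n))\<^sup>2)" for n
      proof -
        obtain G where G: "ball_convergent G" "\<And>q. q \<in> qball \<Longrightarrow> \<sigma> n q = rps_eval G q"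
          using comp_op_power_series[OF qmoebius_SR(2)[OF a(2), of n] i hol bd \<Phi>] unfolding \<sigma>_def by blast
        have d: "deriv_x0 (\<sigma> n) (slice J w) = rps_eval (fps_deriv G) (slice J w)" if "J \<in> imag_units" "norm w < 1" for J w
          using that by (intro deriv_x0_rps_eval G) (simp_all add: norm_slice)
        have "norm (deriv_x0 (\<sigma> n) q) \<le> norm (deriv_x0 (\<sigma> n) (slice i z)) + norm (deriv_x0 (\<sigma> n) (slice i (cnj z)))"
          using norm_rps_eval_representation[OF ball_convergent_deriv[OF G(1)] i I z] z
          by (simp add: qz d[OF I] d[OF i])
        also have "\<dots> \<le> ?c z * (1 - (norm (a n))\<^sup>2) + ?c (cnj z) * (1 - (norm (a n))\<^sup>2)"
          using z by (intro add_mono on_slice) auto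
        finally show ?thesis by (simp only: distrib_right)
      qed
      then have 1: "(\<lambda>n. deriv_x0 (\<sigma> (r n)) q) \<longlonglongrightarrow> 0"
        by (intro Lim_null_comparison[OF always_eventually tendsto_mult_right_zero[OF alr]]) blast
      have pos: "0 < 1 - (norm q)\<^sup>2" using q by (simp add: power_less_one_iff)
      have "norm (deriv_x0 (\<sigma> n) q - deriv_x0 l q) \<le> bloch_dist (\<sigma> n) l / (1 - (norm q)\<^sup>2)" for n
      proof -
        have "ennreal ((1 - (norm q)\<^sup>2) * norm (deriv_x0 (\<lambda>q. \<sigma> n q - l q) q)) \<le> bloch_seminorm (\<lambda>q. \<sigma> n q - l q)"
          using bloch_seminorm_ge[OF I z, of "\<lambda>q. \<sigma> n q - l q"] by (simp add: qz norm_slice[OF I])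
        then have "(1 - (norm q)\<^sup>2) * norm (deriv_x0 (\<lambda>q. \<sigma> n q - l q) q) \<le> enn2real (bloch_seminorm (\<lambda>q. \<sigma> n q - l q))"
          using fin[of n] enn2real_mono pos by fastforce
        also have "\<dots> \<le> bloch_dist (\<sigma> n) l" by (simp add: bloch_dist_def bloch_norm_def)
        finally show ?thesis using pos deriv_x0_diff[OF sr q] by (simp add: pos_le_divide_eq mult.commute)
      qed
      then have "(\<lambda>n. deriv_x0 (\<sigma> (r n)) q - deriv_x0 l q) \<longlonglongrightarrow> 0"
        by (intro Lim_null_comparison[OF always_eventually tendsto_divide_zero[OF dist0]]) blast
      then have "(\<lambda>n. deriv_x0 (\<sigma> (r n)) q) \<longlonglongrightarrow> deriv_x0 l q" by (simp add: LIM_zero_iff)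
      with 1 show ?thesis using LIMSEQ_unique by blast
    qed
    \<comment> \<open>With zero derivative, \<open>l\<close> is invisible to the seminorm; hence the
      distance to \<open>l\<close> dominates the seminorms, all of which are at least
      \<open>e\<close>.\<close>
    have same: "bloch_seminorm (\<lambda>q. \<sigma> n q - l q) = bloch_seminorm (\<sigma> n)" for n
      unfolding bloch_seminorm_def
      by (intro SUP_cong refl) (use dl deriv_x0_diff[OF sr] slice_ball_qball in auto)
    \<comment> \<open>\<open>enn2real\<close> sends \<infinity> to 0, so \<open>e\<close> must be
      known to be finite before its real value can give a positive lower bound.\<close>
    have e_fin: "e < \<infinity>" using a(3)[of 0] fin[of 0] unfolding same by (simp add: \<sigma>_def order_le_less_trans)
    have "enn2real e \<le> bloch_dist (\<sigma> (r n)) l" for n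
    proof -
      have "enn2real e \<le> enn2real (bloch_seminorm (\<sigma> (r n)))"
        using a(3)[of "r n"] fin[of "r n"] unfolding same by (intro enn2real_mono) (simp_all add: \<sigma>_def)
      also have "\<dots> \<le> bloch_dist (\<sigma> (r n)) l" by (simp add: bloch_dist_def bloch_norm_def same)
      finally show ?thesis .
    qed
    then have "enn2real e \<le> 0" using dist0 by (intro tendsto_lowerbound[OF dist0]) auto
    moreover have "0 < enn2real e" using e e_fin by (simp add: enn2real_positive_iff)
    ultimately show False by simp
  qed
qed simp

text \<open>The filter \<open>filtercomap norm (at_left 1)\<close> encodes |a| -> 1 from inside the
  ball, in whatever direction a moves.\<close>

theorem proposition3p5:
  fixes p :: real and \<Phi> :: "quat \<Rightarrow> quat" and i :: quat
  assumes "p > 1"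
    and "slice_regular \<Phi>" and "\<Phi> ` qball \<subseteq> qball"
    and "i \<in> imag_units" and "\<Phi> ` slice_ball i \<subseteq> slice_ball i"
  shows "compact_Besov_Bloch p (comp_op i \<Phi>) \<longleftrightarrow>
    ((\<lambda>a. bloch_seminorm (comp_op i \<Phi> (qmoebius a))) \<longlongrightarrow> 0) (filtercomap norm (at_left 1))"
proof -
  obtain \<phi> where \<phi>: "\<phi> holomorphic_on ball 0 1" "\<And>z. norm z < 1 \<Longrightarrow> norm (\<phi> z) < 1"
    "\<And>z. norm z < 1 \<Longrightarrow> \<Phi> (slice i z) = slice i (\<phi> z)"
    using slice_preserving_map[OF assms(2,4,5)] by blast
  show ?thesis
  proof
    assume c: "compact_Besov_Bloch p (comp_op i \<Phi>)"
    show "((\<lambda>a. bloch_seminorm (comp_op i \<Phi> (qmoebius a))) \<longlongrightarrow> 0) (filtercomap norm (at_left 1))"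
      by (rule vanishing_if_compact_comp_op[OF assms(1,4) \<phi> c])
  next
    assume v: "((\<lambda>a. bloch_seminorm (comp_op i \<Phi> (qmoebius a))) \<longlongrightarrow> 0) (filtercomap norm (at_left 1))"
    show "compact_Besov_Bloch p (comp_op i \<Phi>)"
      by (rule compact_comp_op_if_vanishing[OF assms(1,4) \<phi> v])
  qed
qed

end
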